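(* Let $d\in\{2,3,\dots\}$ and $\gamma\in[-\frac12,\infty)$. Let $h_\tau\big(\varphi_\gamma;(x,t),(y,s)\big)$ be the Jacobi heat kernel on the conic surface $\mathbb{V}^{d+1}_0$. Then there is a constant $C\ge1$, depending only on $d,\gamma$, such that for all $(x,t),(y,s)\in\mathbb{V}^{d+1}_0$ the following hold. (i) For every $\tau\in(0,4]$, $$C^{-1}\,K_\tau\big((x,t),(y,s)\big)\le h_\tau\big(\varphi_\gamma;(x,t),(y,s)\big)\le C\,K_\tau\big((x,t),(y,s)\big),$$ where $$K_\tau\big((x,t),(y,s)\big):=\tau^{-\frac d2}\big(\sqrt{1-t}\sqrt{1-s}\vee\tau\big)^{-\gamma-\frac12}\big(\sqrt{st+\langle x,y\rangle}\vee\tau\big)^{-\frac d2+1}\exp\Big\{-\tfrac1\tau\,\mathrm{dist}^2_{\mathbb{V}^{d+1}_0}\big((x,t),(y,s)\big)\Big\}.$$ (ii) For every $\tau\in[4,\infty)$, $\;C^{-1}\le h_\tau\big(\varphi_\gamma;(x,t),(y,s)\big)\le C$.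
   Context: Notation: $a\vee b=\max(a,b)$; $\langle\cdot,\cdot\rangle$ and $\|\cdot\|$ are the Euclidean inner product and norm on $\mathbb{R}^d$. The surface of the cone is $\mathbb{V}^{d+1}_0:=\{(x,t)\in\mathbb{R}^d\times\mathbb{R}:\ \|x\|=t,\ t\in[0,1]\}$. Distance: $$\mathrm{dist}_{\mathbb{V}^{d+1}_0}\big((x,t),(y,s)\big):=\arccos\Big(\sqrt{\tfrac12\big(st+\langle x,y\rangle\big)}+\sqrt{1-t}\sqrt{1-s}\Big).$$ Measures on $[-1,1]$: for $\nu>-\frac12$, $\mathrm{d}\Pi_\nu(w):=c_\nu(1-w^2)^{\nu-\frac12}\,\mathrm{d}w$ with $c_\nu$ chosen so that $\Pi_\nu$ is a probability measure; $\Pi_{-1/2}:=\frac12(\delta_{-1}+\delta_1)$. Special functions: for $n\in\{0,1,\dots\}$, $\lambda\in[0,\infty)$, $w\in[-1,1]$, $$Z_n^{\lambda+\frac12}(w):=\frac{P_n^{\lambda,\lambda}(1)\,P_n^{\lambda,\lambda}(w)}{h_n^{\lambda,\lambda}},$$ where $P_n^{\lambda,\lambda}$ is the classical Jacobi polynomial of degree $n$ on $[-1,1]$ with both parameters equal to $\lambda$, and $h_n^{\lambda,\lambda}$ is the square of its norm in $L^2([-1,1],\mathrm{d}\Pi_{\lambda+\frac12})$. Put $\xi(x,t,y,s;v_1,v_2):=v_1\sqrt{\tfrac12(st+\langle x,y\rangle)}+v_2\sqrt{1-t}\sqrt{1-s}$, which lies in $[-1,1]$ for $v_1,v_2\in[-1,1]$,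 and $$P_n\big(\varphi_\gamma;(x,t),(y,s)\big):=\int_{[-1,1]^2}Z_{2n}^{\gamma+d-1}\big(\xi(x,t,y,s;v_1,v_2)\big)\,\mathrm{d}\Pi_{\frac{d-3}2}(v_1)\,\mathrm{d}\Pi_\gamma(v_2).$$ (This is the reproducing kernel of the space of orthogonal polynomials of degree $n$ on $\mathbb{V}^{d+1}_0$ for the weight $\varphi_\gamma(t)=t^{-1}(1-t)^\gamma$ with respect to $d$-dimensional surface measure, normalized to be a probability measure.) The Jacobi heat kernel on $\mathbb{V}^{d+1}_0$ is, for $\tau\in(0,\infty)$, $$h_\tau\big(\varphi_\gamma;(x,t),(y,s)\big):=\sum_{n=0}^\infty e^{-\tau n(n+\gamma+d-1)}\,P_n\big(\varphi_\gamma;(x,t),(y,s)\big).$$ *)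

theory Defs
  imports "HOL-Analysis.Analysis"
begin

definition cone_surface :: "((real ^ 'd) \<times> real) set" where
  "cone_surface = {(x, t). norm x = t \<and> 0 \<le> t \<and> t \<le> 1}"

fun cone_dist :: "(real ^ 'd) \<times> real \<Rightarrow> (real ^ 'd) \<times> real \<Rightarrow> real" where
  "cone_dist (x, t) (y, s) =
     arccos (sqrt (1/2 * (s * t + x \<bullet> y)) + sqrt (1 - t) * sqrt (1 - s))"

definition Pi_const :: "real \<Rightarrow> real" where
  "Pi_const \<nu> = 1 / (LBINT w:{-1..1}. (1 - w\<^sup>2) powr (\<nu> - 1/2))"

text \<open>All these measures live on the Borel sets of the real line and are concentrated on
  the interval from -1 to 1, so that integrals over that interval need no explicit
  restriction. Only \<open>\<nu> \<ge> -1/2\<close> is meaningful; for \<open>\<nu> = -1/2\<close> the measure puts mass 1/2 on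
  each of the two endpoints.\<close>

definition Pi_measure :: "real \<Rightarrow> real measure" where
  "Pi_measure \<nu> =
     (if \<nu> = -1/2 then distr (uniform_count_measure {-1, 1}) borel (\<lambda>w. w)
      else density lborel
        (\<lambda>w. ennreal (Pi_const \<nu> * (1 - w\<^sup>2) powr (\<nu> - 1/2) * indicator {-1..1} w)))"

text \<open>The explicit form of the classical Jacobi polynomials (Szego, Orthogonal Polynomials,
  (4.3.2)), with the usual normalization \<open>jacobi_P n \<alpha> \<beta> 1 = (n + \<alpha>) gchoose n\<close>.\<close>

definition jacobi_P :: "nat \<Rightarrow> real \<Rightarrow> real \<Rightarrow> real \<Rightarrow> real" where
  "jacobi_P n \<alpha> \<beta> w =
     (\<Sum>k\<le>n. ((real n + \<alpha>) gchoose (n - k)) * ((real n + \<beta>) gchoose k) *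
        ((w - 1) / 2) ^ k * ((w + 1) / 2) ^ (n - k))"

definition jacobi_h :: "nat \<Rightarrow> real \<Rightarrow> real" where
  "jacobi_h n l = (LINT w|Pi_measure (l + 1/2). (jacobi_P n l l w)\<^sup>2)"

text \<open>The second argument is the superscript \<open>\<mu> = \<lambda> + 1/2\<close>, not the Jacobi parameter \<open>\<lambda>\<close>.\<close>

definition zonal_Z :: "nat \<Rightarrow> real \<Rightarrow> real \<Rightarrow> real" where
  "zonal_Z n \<mu> w =
     (let l = \<mu> - 1/2 in jacobi_P n l l 1 * jacobi_P n l l w / jacobi_h n l)"

fun cone_xi :: "(real ^ 'd) \<times> real \<Rightarrow> (real ^ 'd) \<times> real \<Rightarrow> real \<Rightarrow> real \<Rightarrow> real" where
  "cone_xi (x, t) (y, s) v1 v2 =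
     v1 * sqrt (1/2 * (s * t + x \<bullet> y)) + v2 * sqrt (1 - t) * sqrt (1 - s)"

definition cone_P ::
  "nat \<Rightarrow> real \<Rightarrow> (real ^ 'd) \<times> real \<Rightarrow> (real ^ 'd) \<times> real \<Rightarrow> real" where
  "cone_P n \<gamma> p q =
     (LINT (v1, v2)|(Pi_measure ((real CARD('d) - 3) / 2) \<Otimes>\<^sub>M Pi_measure \<gamma>).
        zonal_Z (2 * n) (\<gamma> + real CARD('d) - 1) (cone_xi p q v1 v2))"

definition cone_heat ::
  "real \<Rightarrow> real \<Rightarrow> (real ^ 'd) \<times> real \<Rightarrow> (real ^ 'd) \<times> real \<Rightarrow> real" where
  "cone_heat \<gamma> \<tau> p q =
     (\<Sum>n. exp (- \<tau> * real n * (real n + \<gamma> + real CARD('d) - 1)) * cone_P n \<gamma> p q)"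

fun cone_K ::
  "real \<Rightarrow> real \<Rightarrow> (real ^ 'd) \<times> real \<Rightarrow> (real ^ 'd) \<times> real \<Rightarrow> real" where
  "cone_K \<gamma> \<tau> (x, t) (y, s) =
     \<tau> powr (- (real CARD('d) / 2)) *
     (max (sqrt (1 - t) * sqrt (1 - s)) \<tau>) powr (- \<gamma> - 1/2) *
     (max (sqrt (s * t + x \<bullet> y)) \<tau>) powr (- (real CARD('d) / 2) + 1) *
     exp (- (1 / \<tau>) * (cone_dist (x, t) (y, s))\<^sup>2)"

end

theory Submission
  imports Defs "HOL-Real_Asymp.Real_Asymp"
begin

text \<open>With \<open>\<lambda> = \<gamma> + d - 1\<close>, the cone kernel at time \<open>\<tau>\<close> is the average of the (even part of the)
  Gegenbauer heat kernel \<open>H\<^sub>t(\<xi>)\<close> of index \<open>\<lambda>\<close> at time \<open>t = \<tau> / 4\<close>. Everything therefore rests on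
  \<open>H\<^sub>t(cos \<phi>) \<asymp> t powr (- \<lambda> - 1/2) * exp (- \<phi>\<^sup>2 / 4 t)\<close> away from \<open>\<phi> = \<pi>\<close> (with some loss near \<open>\<pi>\<close> for
  the upper bound), which follows from the parabolic maximum principle: \<open>H\<^sub>t\<close> is the limit of the
  polynomial solutions of the heat equation with initial values proportional to
  \<open>((1 + \<xi>) / 2) ^ N = cos (\<phi> / 2) ^ (2 N)\<close>, and these initial values compare with
  \<open>exp (- N \<phi>\<^sup>2 / 4)\<close>, i.e. with explicit Gaussian barriers at time of order \<open>1 / N\<close>. Since the barriers
  are super- or subsolutions, the comparison persists and survives the limit \<open>N \<rightarrow> \<infinity>\<close>.
  Below, \<open>l = \<lambda> - 1/2\<close> is the Jacobi parameter.\<close>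

subsection \<open>Gegenbauer polynomials\<close>

text \<open>The Gaussian s^(-(l + 1)) exp (- \<phi>^2 / (4 s)) is a subsolution on the whole
  interval, because \<phi> cot \<phi> \<le> 1. It is no supersolution: it misses by (l + 1/2) (1 -
  \<phi> cot \<phi>) / s times itself, and an error of order 1 / s cannot be absorbed by a factor
  exp (K s). A further factor exp (k - k cos \<phi>) repairs this, since its interaction with the
  Gaussian contributes - k \<phi> sin \<phi> / s, but only away from \<pi>, where the error blows up
  while the sine vanishes. Hence the sharp upper barrier lives on |\<phi>| \<le> 2 \<pi> / 3, and a
  weaker one, linear in cos \<phi>, takes over beyond. The loss is harmless: the exponent in the
  cone estimate belongs to the largest argument A + B \<ge> 0, whose angle is at most \<pi> / 2, and
  \<pi>^2 / 4 < 3. Powers of (1 + w) / 2 serve as initial data because the operator maps each to a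
  combination of two neighbours. Their moments then obey a first-order recurrence, which yields
  their mass and the sign of their coefficients; no asymptotics of Jacobi polynomials or of their
  norms are required.\<close>

definition gegen_op :: "real \<Rightarrow> real poly \<Rightarrow> real poly" where
  "gegen_op l q = [:1, 0, -1:] * pderiv (pderiv q) - smult (2 * (l + 1)) ([:0, 1:] * pderiv q)"

definition gegen_ev :: "real \<Rightarrow> nat \<Rightarrow> real" where
  "gegen_ev l n = real n * (real n + 2 * l + 1)"

definition jacobi_coeff :: "nat \<Rightarrow> real \<Rightarrow> nat \<Rightarrow> real" where
  "jacobi_coeff n l k = ((real n + l) gchoose (n - k)) * ((real n + l) gchoose k)"

definition jacobi_poly :: "nat \<Rightarrow> real \<Rightarrow> real poly" where
  "jacobi_poly n l =
     (\<Sum>k\<le>n. smult (jacobi_coeff n l k) ([:-1/2, 1/2:] ^ k * [:1/2, 1/2:] ^ (n - k)))"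

lemma poly_jacobi_poly: "poly (jacobi_poly n l) w = jacobi_P n l l w"
proof -
  have "poly [:-1/2, 1/2:] w = (w - 1) / 2" "poly [:1/2, 1/2:] w = (w + 1) / 2"
    by (simp_all add: diff_divide_distrib add_divide_distrib)
  then show ?thesis
    by (simp only: jacobi_poly_def jacobi_P_def jacobi_coeff_def poly_sum poly_smult poly_mult
          poly_power mult.assoc)
qed

lemma gegen_op_add: "gegen_op l (p + q) = gegen_op l p + gegen_op l q"
  by (simp add: gegen_op_def pderiv_add algebra_simps smult_add_right)

lemma gegen_op_smult: "gegen_op l (smult c q) = smult c (gegen_op l q)"
  by (simp add: gegen_op_def pderiv_smult smult_diff_right mult.commute del: mult_pCons_left mult_pCons_right)

lemma gegen_op_0 [simp]: "gegen_op l 0 = 0"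
  by (simp add: gegen_op_def)

lemma gegen_op_sum: "gegen_op l (\<Sum>k\<in>A. f k) = (\<Sum>k\<in>A. gegen_op l (f k))"
  by (induction A rule: infinite_finite_induct) (simp_all add: gegen_op_add)

lemma poly_gegen_op:
  "poly (gegen_op l q) w =
     (1 - w\<^sup>2) * poly (pderiv (pderiv q)) w - 2 * (l + 1) * w * poly (pderiv q) w"
  by (simp add: gegen_op_def power2_eq_square algebra_simps)

text \<open>Each binomial absorbs one factor. This ratio of consecutive coefficients is what the
  eigenvalue equation demands of neighbouring monomials.\<close>

lemma jacobi_coeff_Suc:
  assumes "k < n"
  shows "real (Suc k) * (real (Suc k) + l) * jacobi_coeff n l (Suc k)
       = (real n - real k) * (real n + l - real k) * jacobi_coeff n l k"
proof -
  obtain j where j: "n = k + Suc j"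
    using assms by (metis add_Suc_right less_natE)
  let ?a = "real n + l"
  have 1: "real (Suc k) * (?a gchoose Suc k) = (?a - real k) * (?a gchoose k)"
    using gbinomial_mult_1[of ?a k] by (simp add: algebra_simps)
  have 2: "real (Suc j) * (?a gchoose Suc j) = (?a - real j) * (?a gchoose j)"
    using gbinomial_mult_1[of ?a j] by (simp add: algebra_simps)
  have "n - k = Suc j" "n - Suc k = j" "real n - real k = real (Suc j)"
       "?a - real j = real (Suc k) + l"
    using j by auto
  then have "real (Suc k) * (real (Suc k) + l) * jacobi_coeff n l (Suc k)
      = ((?a - real j) * (?a gchoose j)) * (real (Suc k) * (?a gchoose Suc k))"
    unfolding jacobi_coeff_def by simp
  also have "\<dots> = (real (Suc j) * (?a gchoose Suc j)) * ((?a - real k) * (?a gchoose k))"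
    by (simp only: 1 2)
  also have "\<dots> = (real n - real k) * (real n + l - real k) * jacobi_coeff n l k"
    unfolding jacobi_coeff_def \<open>n - k = Suc j\<close> \<open>real n - real k = real (Suc j)\<close> by simp
  finally show ?thesis .
qed

lemma jacobi_coeff_pos:
  assumes "l \<ge> 0" "k \<le> n"
  shows "jacobi_coeff n l k > 0"
proof -
  have "(real n + l) gchoose j > 0" if "j \<le> n" for j
    unfolding gbinomial_prod_rev using assms that by (intro divide_pos_pos prod_pos) auto
  then show ?thesis
    unfolding jacobi_coeff_def using assms by simp
qed

lemma jacobi_coeff_sym: "k \<le> n \<Longrightarrow> jacobi_coeff n l (n - k) = jacobi_coeff n l k"
  by (simp add: jacobi_coeff_def)

text \<open>Since \<open>1 - w\<^sup>2 = - 4 * x * y\<close> and \<open>w = x + y\<close>, the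
  operator preserves the total degree in \<open>x\<close> and \<open>y\<close>, so the eigenvalue
  equation becomes a three-term relation between coefficients. Truncated exponents such as
  \<open>a - 1\<close> at \<open>a = 0\<close> are harmless, as their factors vanish.\<close>

lemma poly_gegen_op_monomial:
  fixes w :: real
  defines "x \<equiv> (w - 1) / 2" and "y \<equiv> (w + 1) / 2"
  shows "poly (gegen_op l ([:-1/2, 1/2:] ^ a * [:1/2, 1/2:] ^ b)) w =
     - (real a * (real a + l) * x ^ (a - 1) * y ^ (b + 1)
        + (2 * real a * real b + (l + 1) * (real a + real b)) * x ^ a * y ^ b
        + real b * (real b + l) * x ^ (a + 1) * y ^ (b - 1))"
proof -
  have w: "1 - w\<^sup>2 = - 4 * x * y" "w = x + y"
    by (simp_all add: x_def y_def field_simps power2_eq_square)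
  define P Q where "P = [:-1/2, 1/2::real:]" and "Q = [:1/2, 1/2::real:]"
  have X: "poly (P ^ i) w = x ^ i" and Y: "poly (Q ^ i) w = y ^ i" for i
    by (simp_all add: P_def Q_def x_def y_def diff_divide_distrib add_divide_distrib add.commute)
  have pd: "pderiv P = [:1/2::real:]" "pderiv Q = [:1/2::real:]"
    by (simp_all add: P_def Q_def pderiv_pCons)
  let ?T = "\<lambda>i j. P ^ i * Q ^ j"
  have d: "pderiv (?T i j) = smult (real i / 2) (?T (i - 1) j) + smult (real j / 2) (?T i (j - 1))"
    for i j
    by (simp add: pderiv_mult pderiv_power pd mult.commute)
  have T: "poly (?T i j) w = x ^ i * y ^ j" for i j
    by (simp only: poly_mult X Y)
  define x1 y1 x2 y2 where "x1 = real a * x ^ (a - 1)" and "y1 = real b * y ^ (b - 1)"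
    and "x2 = real a * (real (a - 1) * x ^ (a - 1 - 1))"
    and "y2 = real b * (real (b - 1) * y ^ (b - 1 - 1))"
  have p1: "z * (real i * z ^ (i - 1)) = real i * z ^ i" for z i
    by (cases i) auto
  have p2: "z * (real i * (real (i - 1) * z ^ (i - 1 - 1))) = (real i - 1) * (real i * z ^ (i - 1))" for z i
  proof (cases i)
    case (Suc j)
    have "z * (real i * (real (i - 1) * z ^ (i - 1 - 1))) = real i * (z * (real j * z ^ (j - 1)))"
      by (simp add: Suc mult.left_commute)
    then show ?thesis
      unfolding p1 by (simp add: Suc)
  qed auto
  have 1: "x * x1 = real a * x ^ a" "y * y1 = real b * y ^ b"
    unfolding x1_def y1_def by (rule p1)+
  have 2: "x * x2 = (real a - 1) * x1" "y * y2 = (real b - 1) * y1"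
    unfolding x1_def y1_def x2_def y2_def by (rule p2)+
  have d1: "poly (pderiv (?T a b)) w = (x1 * y ^ b + x ^ a * y1) / 2"
    by (simp only: d poly_add poly_smult T) (simp add: x1_def y1_def)
  have d2: "poly (pderiv (pderiv (?T a b))) w = (x2 * y ^ b + 2 * x1 * y1 + x ^ a * y2) / 4"
    by (simp only: d pderiv_add pderiv_smult poly_add poly_smult T)
       (simp add: x1_def y1_def x2_def y2_def algebra_simps add_divide_distrib)
  have "poly (gegen_op l (?T a b)) w =
      - ((x * x2) * (y * y ^ b) + 2 * (x * x1) * (y * y1) + (x * x ^ a) * (y * y2)
        + (l + 1) * ((x * x1) * y ^ b + x1 * (y * y ^ b) + (x * x ^ a) * y1 + x ^ a * (y * y1)))"
    unfolding poly_gegen_op w(1) d1 d2 by (subst w(2)) (simp add: field_simps)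
  also have "\<dots> = - ((real a + l) * x1 * y ^ (b + 1)
        + (2 * real a * real b + (l + 1) * (real a + real b)) * x ^ a * y ^ b
        + (real b + l) * x ^ (a + 1) * y1)"
    unfolding 1 2 by (simp add: algebra_simps)
  finally show ?thesis
    unfolding x1_def y1_def P_def Q_def by (simp add: algebra_simps)
qed

text \<open>An index shift in the two outer terms of the monomial formula, with
  \<open>jacobi_coeff_Suc\<close>, collects everything at \<open>T k\<close>. The total factor (n -
  k) (n + l - k) + 2 k (n - k) + (l + 1) n + k (k + l) does not depend on k and equals
  \<open>gegen_ev l n\<close>.\<close>

theorem gegen_op_jacobi_poly:
  "gegen_op l (jacobi_poly n l) = smult (- gegen_ev l n) (jacobi_poly n l)"
proof (rule poly_eq_poly_eq_iff[THEN iffD1], rule ext)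
  fix w :: real
  define x y where "x = (w - 1) / 2" and "y = (w + 1) / 2"
  define T where "T j = x ^ j * y ^ (n - j)" for j
  let ?A = "jacobi_coeff n l"
  have 1: "(\<Sum>k\<le>n. ?A k * (real k * (real k + l) * x ^ (k - 1) * y ^ (n - k + 1)))
      = (\<Sum>k\<le>n. (real n - real k) * (real n + l - real k) * ?A k * T k)" (is "?l1 = ?r1")
  proof (cases n)
    case (Suc n')
    have "?l1 = (\<Sum>k\<le>n'. ?A (Suc k) * (real (Suc k) * (real (Suc k) + l) * x ^ k * y ^ (n - Suc k + 1)))"
      unfolding Suc by (subst sum.atMost_Suc_shift) simp
    also have "\<dots> = (\<Sum>k\<le>n'. (real (Suc k) * (real (Suc k) + l) * ?A (Suc k)) * T k)"
      by (intro sum.cong refl) (auto simp: T_def Suc Suc_diff_le)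
    also have "\<dots> = (\<Sum>k\<le>n'. (real n - real k) * (real n + l - real k) * ?A k * T k)"
      by (intro sum.cong refl) (subst jacobi_coeff_Suc, auto simp: Suc)
    also have "\<dots> = ?r1"
      unfolding Suc by simp
    finally show ?thesis .
  qed simp
  have 2: "(\<Sum>k\<le>n. ?A k * (real (n - k) * (real (n - k) + l) * x ^ (k + 1) * y ^ (n - k - 1)))
      = (\<Sum>k\<le>n. real k * (real k + l) * ?A k * T k)" (is "?l2 = ?r2")
  proof (cases n)
    case (Suc n')
    have "?r2 = (\<Sum>k\<le>n'. (real (Suc k) * (real (Suc k) + l) * ?A (Suc k)) * T (Suc k))"
      unfolding Suc by (subst sum.atMost_Suc_shift) simp
    also have "\<dots> = (\<Sum>k\<le>n'. ?A k * (real (n - k) * (real (n - k) + l) * x ^ (k + 1) * y ^ (n - k - 1)))"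
    proof (intro sum.cong refl)
      fix k assume "k \<in> {..n'}"
      then show "(real (Suc k) * (real (Suc k) + l) * ?A (Suc k)) * T (Suc k) =
          ?A k * (real (n - k) * (real (n - k) + l) * x ^ (k + 1) * y ^ (n - k - 1))"
        by (subst jacobi_coeff_Suc) (auto simp: Suc T_def of_nat_diff algebra_simps)
    qed
    also have "\<dots> = ?l2"
      unfolding Suc by simp
    finally show ?thesis by simp
  qed simp
  have "poly (gegen_op l (jacobi_poly n l)) w =
      - (\<Sum>k\<le>n. ?A k * (real k * (real k + l) * x ^ (k - 1) * y ^ (n - k + 1)
        + (2 * real k * real (n - k) + (l + 1) * (real k + real (n - k))) * x ^ k * y ^ (n - k)
        + real (n - k) * (real (n - k) + l) * x ^ (k + 1) * y ^ (n - k - 1)))"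
    unfolding jacobi_poly_def gegen_op_sum gegen_op_smult poly_sum poly_smult poly_gegen_op_monomial
      x_def y_def by (simp only: mult_minus_right sum_negf)
  also have "\<dots> = - ((\<Sum>k\<le>n. ?A k * (real k * (real k + l) * x ^ (k - 1) * y ^ (n - k + 1)))
     + (\<Sum>k\<le>n. ?A k * ((2 * real k * real (n - k) + (l + 1) * (real k + real (n - k))) * x ^ k * y ^ (n - k)))
     + (\<Sum>k\<le>n. ?A k * (real (n - k) * (real (n - k) + l) * x ^ (k + 1) * y ^ (n - k - 1))))"
    by (simp only: sum.distrib distrib_left)
  also have "\<dots> = - (\<Sum>k\<le>n. gegen_ev l n * (?A k * T k))"
    unfolding 1 2 sum.distrib[symmetric]
    by (intro arg_cong[where f = uminus] sum.cong refl)
       (auto simp: T_def gegen_ev_def of_nat_diff algebra_simps)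
  also have "\<dots> = - (gegen_ev l n * poly (jacobi_poly n l) w)"
  proof -
    have "poly [:-1/2, 1/2:] w = x" "poly [:1/2, 1/2:] w = y"
      by (simp_all add: x_def y_def diff_divide_distrib add_divide_distrib)
    then show ?thesis
      by (simp only: jacobi_poly_def poly_sum poly_smult poly_mult poly_power T_def sum_distrib_left)
  qed
  finally show "poly (gegen_op l (jacobi_poly n l)) w =
      poly (smult (- gegen_ev l n) (jacobi_poly n l)) w"
    by simp
qed

lemma degree_jacobi_poly_le: "degree (jacobi_poly n l) \<le> n"
  unfolding jacobi_poly_def
proof (intro degree_sum_le)
  fix k assume k: "k \<in> {..n}"
  have "degree ([:-1/2, 1/2::real:] ^ k * [:1/2, 1/2:] ^ (n - k)) \<le> k + (n - k)"
    by (intro order_trans[OF degree_mult_le] add_mono order_trans[OF degree_power_le]) auto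
  with k show "degree (smult (jacobi_coeff n l k) ([:-1/2, 1/2:] ^ k * [:1/2, 1/2:] ^ (n - k))) \<le> n"
    using degree_smult_le order_trans by fastforce
qed simp

lemma coeff_jacobi_poly_pos:
  assumes "l \<ge> 0"
  shows "coeff (jacobi_poly n l) n > 0"
proof -
  have "coeff ([:-1/2, 1/2::real:] ^ k * [:1/2, 1/2:] ^ (n - k)) n = (1/2) ^ n" if "k \<le> n" for k
  proof -
    have "degree ([:-1/2, 1/2::real:] ^ k) = k" "degree ([:1/2, 1/2::real:] ^ (n - k)) = n - k"
      by (simp_all add: degree_power_eq)
    moreover have "lead_coeff ([:-1/2, 1/2::real:] ^ k) = (1/2) ^ k"
        "lead_coeff ([:1/2, 1/2::real:] ^ (n - k)) = (1/2) ^ (n - k)"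
      by (simp_all only: lead_coeff_power) simp_all
    ultimately have "coeff ([:-1/2, 1/2::real:] ^ k * [:1/2, 1/2:] ^ (n - k)) (k + (n - k))
       = (1/2) ^ k * (1/2) ^ (n - k)"
      by (metis coeff_mult_degree_sum)
    with that show ?thesis by (simp flip: power_add)
  qed
  then have "coeff (jacobi_poly n l) n = (\<Sum>k\<le>n. jacobi_coeff n l k * (1/2) ^ n)"
    by (simp add: jacobi_poly_def coeff_sum)
  also have "\<dots> > 0"
    using assms by (intro sum_pos) (auto intro!: mult_pos_pos jacobi_coeff_pos)
  finally show ?thesis .
qed

lemma poly_jacobi_poly_1: "poly (jacobi_poly n l) 1 = jacobi_coeff n l 0"
proof -
  have "poly (jacobi_poly n l) 1 = (\<Sum>k\<le>n. if k = 0 then jacobi_coeff n l 0 else 0)"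
    unfolding jacobi_poly_def poly_sum by (intro sum.cong refl) auto
  then show ?thesis by simp
qed

text \<open>Reflection exchanges the two linear factors up to sign, and the coefficients are
  symmetric. Parity is what later isolates the even degrees of the cone kernel.\<close>

lemma poly_jacobi_poly_minus: "poly (jacobi_poly n l) (- w) = (-1) ^ n * poly (jacobi_poly n l) w"
proof -
  let ?x = "(w - 1) / 2" and ?y = "(w + 1) / 2"
  have *: "poly [:-1/2, 1/2:] (-w) = - ?y" "poly [:1/2, 1/2:] (-w) = - ?x"
    "poly [:-1/2, 1/2:] w = ?x" "poly [:1/2, 1/2:] w = ?y"
    by (simp_all add: diff_divide_distrib add_divide_distrib)
  have "poly (jacobi_poly n l) (- w) =
      (\<Sum>k\<le>n. jacobi_coeff n l k * ((- ?y) ^ k * (- ?x) ^ (n - k)))"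
    by (simp only: jacobi_poly_def poly_sum poly_smult poly_mult poly_power *)
  also have "\<dots> = (\<Sum>k\<le>n. jacobi_coeff n l (n - k) * ((- ?y) ^ (n - k) * (- ?x) ^ (n - (n - k))))"
    by (rule sum.nat_diff_reindex[of _ "Suc n", symmetric, simplified lessThan_Suc_atMost, simplified])
  also have "\<dots> = (\<Sum>k\<le>n. (-1) ^ n * (jacobi_coeff n l k * (?x ^ k * ?y ^ (n - k))))"
  proof (intro sum.cong refl)
    fix k assume "k \<in> {..n}"
    then have k: "k \<le> n" by simp
    have "(- ?y) ^ (n - k) * (- ?x) ^ k = (-1) ^ (n - k) * (-1) ^ k * (?x ^ k * ?y ^ (n - k))"
      by (subst (1 2) power_minus) (simp only: mult_ac)
    also have "(-1) ^ (n - k) * (-1) ^ k = (-1 :: real) ^ n"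
      using k by (simp flip: power_add)
    finally show "jacobi_coeff n l (n - k) * ((- ?y) ^ (n - k) * (- ?x) ^ (n - (n - k))) =
       (-1) ^ n * (jacobi_coeff n l k * (?x ^ k * ?y ^ (n - k)))"
      using k by (simp add: jacobi_coeff_sym)
  qed
  also have "\<dots> = (-1) ^ n * poly (jacobi_poly n l) w"
    by (simp only: jacobi_poly_def poly_sum poly_smult poly_mult poly_power * sum_distrib_left)
  finally show ?thesis .
qed

text \<open>Normalized at the right endpoint rather than in the mean square: 1 is then also the
  supremum on the interval, and the multipliers \<open>gegen_mult\<close> tend to 1.\<close>

definition gegen_poly :: "real \<Rightarrow> nat \<Rightarrow> real poly" where
  "gegen_poly l n = smult (1 / poly (jacobi_poly n l) 1) (jacobi_poly n l)"

lemma gegen_op_gegen_poly: "gegen_op l (gegen_poly l n) = smult (- gegen_ev l n) (gegen_poly l n)"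
  by (simp add: gegen_poly_def gegen_op_smult gegen_op_jacobi_poly)

lemma jacobi_poly_1_pos: "l \<ge> 0 \<Longrightarrow> poly (jacobi_poly n l) 1 > 0"
  by (simp add: poly_jacobi_poly_1 jacobi_coeff_pos)

lemma gegen_poly_1 [simp]: "l \<ge> 0 \<Longrightarrow> poly (gegen_poly l n) 1 = 1"
  using jacobi_poly_1_pos[of l n] by (simp add: gegen_poly_def)

lemma gegen_poly_minus: "poly (gegen_poly l n) (- w) = (-1) ^ n * poly (gegen_poly l n) w"
  by (simp add: gegen_poly_def poly_jacobi_poly_minus)

lemma gegen_poly_0 [simp]: "l \<ge> 0 \<Longrightarrow> gegen_poly l 0 = 1"
  using jacobi_poly_1_pos[of l 0]
  by (auto simp: gegen_poly_def jacobi_poly_def jacobi_coeff_def one_pCons)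

lemma degree_gegen_poly_le: "degree (gegen_poly l n) \<le> n"
  unfolding gegen_poly_def using degree_jacobi_poly_le degree_smult_le order_trans by blast

lemma coeff_gegen_poly_pos: "l \<ge> 0 \<Longrightarrow> coeff (gegen_poly l n) n > 0"
  by (simp add: gegen_poly_def coeff_jacobi_poly_pos jacobi_poly_1_pos)

lemma gegen_ev_pos: "l \<ge> 0 \<Longrightarrow> n > 0 \<Longrightarrow> gegen_ev l n > 0"
  by (simp add: gegen_ev_def)

text \<open>\<open>Q\<^sup>2 + (1 - w\<^sup>2) Q'\<^sup>2 / E\<close>, with \<open>E\<close> the eigenvalue, is monotone on each half of the
  interval, because its derivative is \<open>2 (2 l + 1) w Q'\<^sup>2 / E\<close>.\<close>

lemma abs_gegen_poly_le_1:
  assumes l: "l \<ge> 0" and w: "\<bar>w\<bar> \<le> 1"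
  shows "\<bar>poly (gegen_poly l n) w\<bar> \<le> 1"
proof (cases "n = 0")
  case False
  define q where "q = gegen_poly l n"
  define E where "E = gegen_ev l n"
  have E: "E > 0" using gegen_ev_pos l False by (simp add: E_def)
  define F where "F v = (poly q v)\<^sup>2 + (1 - v\<^sup>2) * (poly (pderiv q) v)\<^sup>2 / E" for v
  have ode: "(1 - v\<^sup>2) * poly (pderiv (pderiv q)) v = 2 * (l + 1) * v * poly (pderiv q) v - E * poly q v" for v
    using arg_cong[OF gegen_op_gegen_poly[of l n], of "\<lambda>p. poly p v"]
    by (simp add: poly_gegen_op q_def E_def)
  have dF: "(F has_real_derivative 2 * (2 * l + 1) * v * (poly (pderiv q) v)\<^sup>2 / E) (at v)" for v
  proof -
    let ?q1 = "poly (pderiv q) v" and ?q2 = "poly (pderiv (pderiv q)) v"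
    have "(F has_real_derivative 2 * poly q v * ?q1 + (- 2 * v * ?q1\<^sup>2 + (1 - v\<^sup>2) * (2 * ?q1 * ?q2)) / E) (at v)"
      unfolding F_def using E
      by (auto intro!: derivative_eq_intros simp: power2_eq_square)
    also have "2 * poly q v * ?q1 + (- 2 * v * ?q1\<^sup>2 + (1 - v\<^sup>2) * (2 * ?q1 * ?q2)) / E
       = 2 * poly q v * ?q1 + (- 2 * v * ?q1\<^sup>2 + 2 * ?q1 * ((1 - v\<^sup>2) * ?q2)) / E"
      by (simp add: mult_ac)
    also have "\<dots> = 2 * (2 * l + 1) * v * ?q1\<^sup>2 / E"
      unfolding ode using E by (simp add: field_simps power2_eq_square)
    finally show ?thesis .
  qed
  have "F \<bar>w\<bar> \<le> F 1"
  proof (rule DERIV_nonneg_imp_nondecreasing[of "\<bar>w\<bar>" 1 F])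
    fix v assume "\<bar>w\<bar> \<le> v"
    then have "2 * (2 * l + 1) * v * (poly (pderiv q) v)\<^sup>2 / E \<ge> 0"
      using l E by simp
    then show "\<exists>y. (F has_real_derivative y) (at v) \<and> 0 \<le> y"
      using dF by blast
  qed (use w in simp)
  moreover have "F 1 = 1"
    using l by (simp add: F_def q_def)
  moreover have "(poly q \<bar>w\<bar>)\<^sup>2 \<le> F \<bar>w\<bar>"
  proof -
    have "(1 - \<bar>w\<bar>\<^sup>2) * (poly (pderiv q) \<bar>w\<bar>)\<^sup>2 / E \<ge> 0"
      using w E by (intro divide_nonneg_pos mult_nonneg_nonneg) (auto simp: abs_square_le_1)
    then show ?thesis unfolding F_def by linarith
  qed
  moreover have "(poly q w)\<^sup>2 = (poly q \<bar>w\<bar>)\<^sup>2"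
    by (cases "w \<ge> 0") (auto simp: q_def gegen_poly_minus power_mult_distrib abs_if
        power_mult[symmetric] mult.commute[of n])
  ultimately have "(poly q w)\<^sup>2 \<le> 1" by linarith
  then show ?thesis
    by (simp add: q_def abs_square_le_1)
qed (use l in simp)

lemma poly_gegen_expansion:
  assumes l: "l \<ge> 0" and "degree q \<le> N"
  shows "\<exists>d. q = (\<Sum>m\<le>N. smult (d m) (gegen_poly l m))"
  using assms(2)
proof (induction N arbitrary: q)
  case 0
  then have "q = [:coeff q 0:]"
    by (auto elim!: degree_eq_zeroE)
  then have "q = (\<Sum>m\<le>0. smult (coeff q 0) (gegen_poly l m))"
    using l by simp
  then show ?case by (intro exI[of _ "\<lambda>_. coeff q 0"])
next
  case (Suc N)
  let ?c = "coeff q (Suc N) / coeff (gegen_poly l (Suc N)) (Suc N)"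
  define r where "r = q - smult ?c (gegen_poly l (Suc N))"
  have "degree r \<le> N"
  proof (rule degree_le, intro allI impI)
    fix i assume i: "N < i"
    show "coeff r i = 0"
    proof (cases "i = Suc N")
      case True
      then show ?thesis
        using coeff_gegen_poly_pos[OF l, of "Suc N"] by (simp add: r_def)
    next
      case False
      with i have "Suc N < i" by simp
      then have "coeff q i = 0" "coeff (gegen_poly l (Suc N)) i = 0"
        using Suc.prems degree_gegen_poly_le[of l "Suc N"] by (auto intro: coeff_eq_0)
      then show ?thesis by (simp add: r_def)
    qed
  qed
  then obtain d where d: "r = (\<Sum>m\<le>N. smult (d m) (gegen_poly l m))"
    using Suc.IH by blast
  have "q = (\<Sum>m\<le>Suc N. smult ((d(Suc N := ?c)) m) (gegen_poly l m))"
    using d by (simp add: r_def algebra_simps)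
  then show ?case by blast
qed

subsection \<open>The measures \<open>\<Pi>\<^sub>\<nu>\<close> and orthogonality\<close>

definition Pi_wt :: "real \<Rightarrow> real \<Rightarrow> real" where
  "Pi_wt \<nu> w = (1 - w\<^sup>2) powr (\<nu> - 1/2) * indicator {-1..1} w"

lemma Pi_wt_nonneg: "Pi_wt \<nu> w \<ge> 0"
  by (simp add: Pi_wt_def)

lemma Pi_wt_borel [measurable]: "Pi_wt \<nu> \<in> borel_measurable borel"
  unfolding Pi_wt_def by measurable

lemma Pi_wt_minus: "Pi_wt \<nu> (- w) = Pi_wt \<nu> w"
  by (auto simp: Pi_wt_def indicator_def)

text \<open>The substitution t = (1 + w) / 2 turns the weight into the Beta integrand with both
  parameters \<nu> + 1/2.\<close>

lemma
  assumes "\<nu> > -1/2"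
  shows integrable_Pi_wt: "integrable lborel (Pi_wt \<nu>)"
    and integral_Pi_wt_pos: "integral\<^sup>L lborel (Pi_wt \<nu>) > 0"
proof -
  define a where "a = \<nu> + 1/2"
  have a: "a > 0" using assms by (simp add: a_def)
  define B where "B t = (if t \<in> {0..1} then t powr (a - 1) * (1 - t) powr (a - 1) else 0)" for t :: real
  have hi: "(B has_integral Beta a a) UNIV"
    unfolding B_def has_integral_restrict_UNIV by (rule has_integral_Beta_real[OF a a])
  have [measurable]: "B \<in> borel_measurable borel"
    unfolding B_def by measurable
  have "0 \<le> B t" for t
    by (simp add: B_def)
  then have nn: "integral\<^sup>N lborel B = Beta a a"
    by (intro nn_integral_has_integral_lborel[OF _ _ hi]) auto
  have Beta: "Beta a a > 0"
    unfolding Beta_def using a by (auto intro!: divide_pos_pos Gamma_real_pos mult_pos_pos)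
  have hB: "has_bochner_integral lborel B (Beta a a)"
    using nn Beta by (intro has_bochner_integral_nn_integral) (auto simp: B_def)
  then have "integrable lborel B" and IB: "integral\<^sup>L lborel B = Beta a a"
    by (auto simp: has_bochner_integral_iff)
  then have 1: "integrable lborel (\<lambda>w. B (1/2 + 1/2 * w))"
    by (intro lborel_integrable_real_affine) auto
  have 2: "integral\<^sup>L lborel B = 1/2 * (\<integral>w. B (1/2 + 1/2 * w) \<partial>lborel)"
    by (subst lborel_integral_real_affine[where c = "1/2" and t = "1/2"]) auto
  have 3: "Pi_wt \<nu> w = 4 powr (a - 1) * B (1/2 + 1/2 * w)" for w
  proof (cases "w \<in> {-1..1}")
    case True
    have "1 - w\<^sup>2 = 4 * ((1/2 + 1/2 * w) * (1 - (1/2 + 1/2 * w)))"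
      by (simp add: field_simps power2_eq_square)
    then have "(1 - w\<^sup>2) powr (a - 1) = 4 powr (a - 1) * ((1/2 + 1/2 * w) powr (a - 1) * (1 - (1/2 + 1/2 * w)) powr (a - 1))"
      using True by (simp only: powr_mult) 
    then show ?thesis using True
      by (simp add: Pi_wt_def B_def a_def)
  next
    case False
    then show ?thesis by (auto simp: Pi_wt_def B_def)
  qed
  show "integrable lborel (Pi_wt \<nu>)"
    using 1 by (simp add: 3[abs_def])
  have "integral\<^sup>L lborel (Pi_wt \<nu>) = 4 powr (a - 1) * (2 * Beta a a)"
    using IB 2 by (simp add: 3[abs_def])
  then show "integral\<^sup>L lborel (Pi_wt \<nu>) > 0" using Beta by simp
qed

lemma Pi_const_eq: "Pi_const \<nu> = 1 / integral\<^sup>L lborel (Pi_wt \<nu>)"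
  by (simp add: Pi_const_def Pi_wt_def[abs_def] set_lebesgue_integral_def mult.commute)

lemma Pi_const_pos: "\<nu> > -1/2 \<Longrightarrow> Pi_const \<nu> > 0"
  using integral_Pi_wt_pos by (simp add: Pi_const_eq)

lemma Pi_measure_density:
  "\<nu> > -1/2 \<Longrightarrow> Pi_measure \<nu> = density lborel (\<lambda>w. ennreal (Pi_const \<nu> * Pi_wt \<nu> w))"
  by (simp add: Pi_measure_def Pi_wt_def mult.assoc)

lemma sets_Pi_measure [simp, measurable_cong]: "sets (Pi_measure \<nu>) = sets borel"
  by (simp add: Pi_measure_def)

lemma space_Pi_measure [simp]: "space (Pi_measure \<nu>) = UNIV"
  by (simp add: Pi_measure_def)

lemma integral_Pi_measure:
  fixes f :: "real \<Rightarrow> real"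
  assumes \<nu>: "\<nu> > -1/2" and [measurable]: "f \<in> borel_measurable borel"
  shows "integral\<^sup>L (Pi_measure \<nu>) f = Pi_const \<nu> * (\<integral>w. Pi_wt \<nu> w * f w \<partial>lborel)"
  using Pi_const_pos[OF \<nu>] Pi_wt_nonneg[of \<nu>]
  by (simp add: Pi_measure_density[OF \<nu>] integral_real_density mult.assoc)

lemma integral_Pi_measure_half:
  fixes f :: "real \<Rightarrow> real"
  assumes "\<nu> = -1/2" and [measurable]: "f \<in> borel_measurable borel"
  shows "integral\<^sup>L (Pi_measure \<nu>) f = (f (-1) + f 1) / 2"
  using assms(1) by (simp add: Pi_measure_def integral_distr integral_uniform_count_measure)

lemma prob_Pi_measure:
  assumes "\<nu> \<ge> -1/2"
  shows "emeasure (Pi_measure \<nu>) UNIV = 1"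
proof (cases "\<nu> = -1/2")
  case True
  then show ?thesis
    by (simp add: Pi_measure_def emeasure_distr emeasure_uniform_count_measure
        space_uniform_count_measure)
next
  case False
  with assms have \<nu>: "\<nu> > -1/2" by simp
  have "emeasure (Pi_measure \<nu>) UNIV = (\<integral>\<^sup>+w. ennreal (Pi_const \<nu> * Pi_wt \<nu> w) \<partial>lborel)"
    by (simp add: Pi_measure_density[OF \<nu>] emeasure_density)
  also have "\<dots> = ennreal (\<integral>w. Pi_const \<nu> * Pi_wt \<nu> w \<partial>lborel)"
    using \<nu> Pi_const_pos[OF \<nu>] Pi_wt_nonneg[of \<nu>]
    by (intro nn_integral_eq_integral) (auto simp: integrable_Pi_wt less_imp_le)
  also have "\<dots> = 1"
    using integral_Pi_wt_pos[OF \<nu>] by (simp add: Pi_const_eq)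
  finally show ?thesis .
qed

lemma finite_measure_Pi_measure: "\<nu> \<ge> -1/2 \<Longrightarrow> finite_measure (Pi_measure \<nu>)"
  by (intro finite_measureI) (simp add: prob_Pi_measure)

lemma measure_Pi_measure [simp]: "\<nu> \<ge> -1/2 \<Longrightarrow> measure (Pi_measure \<nu>) UNIV = 1"
  by (simp add: measure_def prob_Pi_measure)

lemma AE_Pi_measure: "AE w in Pi_measure \<nu>. \<bar>w\<bar> \<le> 1"
proof (cases "\<nu> = -1/2")
  case True
  then show ?thesis
    unfolding Pi_measure_def uniform_count_measure_def
    by (simp add: AE_distr_iff AE_point_measure)
next
  case False
  then show ?thesis
    unfolding Pi_measure_def by (simp add: AE_density indicator_def abs_le_iff)
qed

lemma integrable_Pi_measure:
  fixes f :: "real \<Rightarrow> real"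
  assumes \<nu>: "\<nu> \<ge> -1/2" and [measurable]: "f \<in> borel_measurable borel"
    and "\<And>w. \<bar>w\<bar> \<le> 1 \<Longrightarrow> \<bar>f w\<bar> \<le> B"
  shows "integrable (Pi_measure \<nu>) f"
proof -
  interpret finite_measure "Pi_measure \<nu>" by (rule finite_measure_Pi_measure[OF \<nu>])
  show ?thesis
    using AE_Pi_measure[of \<nu>] assms(3)
    by (intro integrable_const_bound[of _ B]) auto
qed

lemma integral_Pi_measure_minus:
  fixes f :: "real \<Rightarrow> real"
  assumes \<nu>: "\<nu> \<ge> -1/2" and [measurable]: "f \<in> borel_measurable borel"
  shows "(\<integral>w. f (- w) \<partial>Pi_measure \<nu>) = integral\<^sup>L (Pi_measure \<nu>) f"
proof (cases "\<nu> = -1/2")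
  case True
  show ?thesis by (simp add: integral_Pi_measure_half[OF True] add.commute del: divide_minus_left)
next
  case False
  with \<nu> have \<nu>: "\<nu> > -1/2" by simp
  have "(\<integral>w. Pi_wt \<nu> w * f w \<partial>lborel) = (\<integral>w. Pi_wt \<nu> (- w) * f (- w) \<partial>lborel)"
    by (subst lborel_integral_real_affine[where c = "-1" and t = 0]) auto
  then show ?thesis
    by (simp add: integral_Pi_measure[OF \<nu>] Pi_wt_minus)
qed

lemma integrable_Pi_measure_continuous:
  fixes f :: "real \<Rightarrow> real"
  assumes \<nu>: "\<nu> \<ge> -1/2" and f: "continuous_on UNIV f"
  shows "integrable (Pi_measure \<nu>) f"
proof -
  have "compact (f ` {-1..1})"
    using f by (intro compact_continuous_image continuous_on_subset[OF f]) auto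
  then obtain B where B: "\<forall>w\<in>{-1..1}. \<bar>f w\<bar> \<le> B"
    by (auto dest!: compact_imp_bounded simp: bounded_iff)
  then show ?thesis
    using \<nu> f by (intro integrable_Pi_measure[where B = B])
      (auto intro: borel_measurable_continuous_onI simp: abs_le_iff)
qed

definition gegen_int :: "real \<Rightarrow> real poly \<Rightarrow> real" where
  "gegen_int l q = (\<integral>w. poly q w \<partial>Pi_measure (l + 1/2))"

lemma integrable_poly_Pi_measure [simp]: "\<nu> \<ge> -1/2 \<Longrightarrow> integrable (Pi_measure \<nu>) (poly q)"
  by (intro integrable_Pi_measure_continuous) (auto intro: continuous_intros)

lemma gegen_int_add: "l \<ge> 0 \<Longrightarrow> gegen_int l (p + q) = gegen_int l p + gegen_int l q"
  by (simp add: gegen_int_def)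

lemma gegen_int_diff: "l \<ge> 0 \<Longrightarrow> gegen_int l (p - q) = gegen_int l p - gegen_int l q"
  by (simp add: gegen_int_def)

lemma gegen_int_smult: "gegen_int l (smult c p) = c * gegen_int l p"
  by (simp add: gegen_int_def)

lemma gegen_int_sum: "l \<ge> 0 \<Longrightarrow> gegen_int l (\<Sum>i\<in>A. f i) = (\<Sum>i\<in>A. gegen_int l (f i))"
  by (simp add: gegen_int_def poly_sum)

lemma gegen_int_1: "l \<ge> 0 \<Longrightarrow> gegen_int l 1 = 1"
  by (simp add: gegen_int_def)

lemma gegen_int_mono:
  assumes "l \<ge> 0" "\<And>w. \<bar>w\<bar> \<le> 1 \<Longrightarrow> poly p w \<le> poly q w"
  shows "gegen_int l p \<le> gegen_int l q"
  unfolding gegen_int_def using assms AE_Pi_measure[of "l + 1/2"]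
  by (intro integral_mono_AE) auto

text \<open>Integration by parts in one piece: times the weight, the integrand is the derivative of
  (1 - w^2)^(l + 1) p, which vanishes at both endpoints because l + 1 > 0.\<close>

lemma gegen_int_stein:
  assumes l: "l \<ge> 0"
  shows "gegen_int l ([:1, 0, -1:] * pderiv p - smult (2 * (l + 1)) ([:0, 1:] * p)) = 0"
proof -
  let ?q = "[:1, 0, -1:] * pderiv p - smult (2 * (l + 1)) ([:0, 1:] * p)"
  define F where "F w = (1 - w\<^sup>2) powr (l + 1) * poly p w" for w
  define f where "f w = (1 - w\<^sup>2) powr l * poly ?q w" for w
  have "(f has_integral (F 1 - F (-1))) {-1..1}"
  proof (rule fundamental_theorem_of_calculus_interior)
    have "continuous_on {-1..1} (\<lambda>w::real. (1 - w\<^sup>2) powr (l + 1))"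
      using l by (intro continuous_on_powr') (auto intro!: continuous_intros simp: abs_square_le_1)
    then show "continuous_on {-1..1} F"
      unfolding F_def by (intro continuous_on_mult) (auto intro: continuous_intros)
  next
    fix w :: real assume w: "w \<in> {-1<..<1}"
    then have pos: "1 - w\<^sup>2 > 0" by (simp add: abs_square_less_1 abs_less_iff)
    have "(F has_real_derivative (l + 1) * (1 - w\<^sup>2) powr l * (- 2 * w) * poly p w
        + (1 - w\<^sup>2) powr (l + 1) * poly (pderiv p) w) (at w)"
      unfolding F_def using pos by (auto intro!: derivative_eq_intros)
    also have "(l + 1) * (1 - w\<^sup>2) powr l * (- 2 * w) * poly p w + (1 - w\<^sup>2) powr (l + 1) * poly (pderiv p) w = f w"
      using pos by (simp add: f_def powr_add power2_eq_square algebra_simps)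
    finally show "(F has_vector_derivative f w) (at w)"
      by (simp add: has_real_derivative_iff_has_vector_derivative)
  qed simp
  then have "(f has_integral 0) {-1..1}" by (simp add: F_def)
  then have 0: "((\<lambda>w. if w \<in> {-1..1} then f w else 0) has_integral 0) UNIV"
    unfolding has_integral_restrict_UNIV .
  have eq: "(\<lambda>w. if w \<in> {-1..1} then f w else 0) = (\<lambda>w. Pi_wt (l + 1/2) w * poly ?q w)"
    by (auto simp: f_def Pi_wt_def)
  have "integrable lborel (\<lambda>w. Pi_wt (l + 1/2) w * poly r w)" for r
  proof -
    have "integrable (density lborel (\<lambda>w. ennreal (Pi_const (l + 1/2) * Pi_wt (l + 1/2) w))) (poly r)"
      using l integrable_poly_Pi_measure[of "l + 1/2" r] by (simp add: Pi_measure_density)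
    then have "integrable lborel (\<lambda>w. Pi_const (l + 1/2) * (Pi_wt (l + 1/2) w * poly r w))"
      using l Pi_const_pos[of "l + 1/2"] Pi_wt_nonneg[of "l + 1/2"]
      by (subst (asm) integrable_real_density)
        (auto simp: mult.assoc less_imp_le intro!: borel_measurable_continuous_onI continuous_intros)
    then show ?thesis
      using l Pi_const_pos[of "l + 1/2"] by simp
  qed
  from has_integral_integral_lborel[OF this[of ?q]] 0[unfolded eq]
  have "(\<integral>w. Pi_wt (l + 1/2) w * poly ?q w \<partial>lborel) = 0"
    by (rule has_integral_unique)
  then show ?thesis
    unfolding gegen_int_def using l
    by (subst integral_Pi_measure) (auto intro!: borel_measurable_continuous_onI continuous_intros
        simp del: poly_add poly_diff poly_mult poly_smult poly_pCons)
qed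

text \<open>The difference of the two integrands is the expression of \<open>gegen_int_stein\<close>
  for the Wronskian of \<open>p\<close> and \<open>q\<close>.\<close>

lemma gegen_op_selfadjoint:
  assumes "l \<ge> 0"
  shows "gegen_int l (gegen_op l p * q) = gegen_int l (p * gegen_op l q)"
proof -
  let ?r = "pderiv p * q - p * pderiv q"
  have "gegen_op l p * q - p * gegen_op l q =
     [:1, 0, -1:] * pderiv ?r - smult (2 * (l + 1)) ([:0, 1:] * ?r)"
  proof (rule poly_eq_poly_eq_iff[THEN iffD1], rule ext)
    show "poly (gegen_op l p * q - p * gegen_op l q) w =
      poly ([:1, 0, -1:] * pderiv ?r - smult (2 * (l + 1)) ([:0, 1:] * ?r)) w" for w
      by (simp add: poly_gegen_op pderiv_diff pderiv_mult algebra_simps power2_eq_square)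
  qed
  then show ?thesis
    using gegen_int_stein[OF assms, of ?r] gegen_int_diff[OF assms] by (metis eq_iff_diff_eq_0)
qed

lemma gegen_poly_orthogonal:
  assumes l: "l \<ge> 0" and "m \<noteq> n"
  shows "gegen_int l (gegen_poly l m * gegen_poly l n) = 0"
proof -
  have "gegen_ev l m \<noteq> gegen_ev l n"
  proof
    assume "gegen_ev l m = gegen_ev l n"
    then have "(real m - real n) * (real m + real n + 2 * l + 1) = 0"
      by (simp add: gegen_ev_def algebra_simps)
    with l \<open>m \<noteq> n\<close> show False by auto
  qed
  moreover have "- gegen_ev l m * gegen_int l (gegen_poly l m * gegen_poly l n)
      = - gegen_ev l n * gegen_int l (gegen_poly l m * gegen_poly l n)"
    using gegen_op_selfadjoint[OF l, of "gegen_poly l m" "gegen_poly l n"]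
    by (simp only: gegen_op_gegen_poly gegen_int_smult mult_smult_left mult_smult_right)
  ultimately show ?thesis by simp
qed

subsection \<open>Expansion of powers of \<open>(1 + w) / 2\<close>\<close>

abbreviation half_poly :: "real poly" where
  "half_poly \<equiv> [:1/2, 1/2:]"

lemma poly_half_poly: "poly half_poly w = (1 + w) / 2"
  by (simp add: add_divide_distrib)

text \<open>The case a = 0 of the monomial formula, with \<open>x = y - 1\<close>. Only two
  consecutive powers occur, which is the reason for choosing these functions as initial
  data.\<close>

lemma gegen_op_half_power:
  "gegen_op l (half_poly ^ n) =
     smult (real n * (real n + l)) (half_poly ^ (n - 1)) - smult (gegen_ev l n) (half_poly ^ n)"
proof (rule poly_eq_poly_eq_iff[THEN iffD1], rule ext)
  fix w :: real
  define y where "y = (w + 1) / 2"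
  have y: "poly half_poly w = y" and x: "(w - 1) / 2 = y - 1"
    by (simp_all add: y_def field_simps)
  have "poly (gegen_op l (half_poly ^ n)) w =
     - ((l + 1) * real n * y ^ n + real n * (real n + l) * (y - 1) * y ^ (n - 1))"
    using poly_gegen_op_monomial[of l 0 n w] by (simp add: x flip: y_def)
  also have "\<dots> = real n * (real n + l) * y ^ (n - 1) - gegen_ev l n * y ^ n"
    by (cases n) (auto simp: gegen_ev_def algebra_simps)
  finally show "poly (gegen_op l (half_poly ^ n)) w =
     poly (smult (real n * (real n + l)) (half_poly ^ (n - 1)) - smult (gegen_ev l n) (half_poly ^ n)) w"
    by (simp only: poly_diff poly_smult poly_power y)
qed

section \<open>Moments of the initial data\<close>

definition gegen_moment :: "real \<Rightarrow> nat \<Rightarrow> nat \<Rightarrow> real" where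
  "gegen_moment l m n = gegen_int l (half_poly ^ n * gegen_poly l m)"

text \<open>Self-adjointness moves the operator from the power to the eigenpolynomial. At n = 0 the
  right-hand side vanishes through its first factor, so the truncated \<open>n - 1\<close> does not
  matter.\<close>

lemma gegen_moment_rec:
  assumes l: "l \<ge> 0"
  shows "(gegen_ev l n - gegen_ev l m) * gegen_moment l m n
       = real n * (real n + l) * gegen_moment l m (n - 1)"
proof -
  have "gegen_int l (gegen_op l (half_poly ^ n) * gegen_poly l m)
      = gegen_int l (half_poly ^ n * gegen_op l (gegen_poly l m))"
    by (rule gegen_op_selfadjoint[OF l])
  then have "real n * (real n + l) * gegen_moment l m (n - 1) - gegen_ev l n * gegen_moment l m n
      = - gegen_ev l m * gegen_moment l m n"
    by (simp only: gegen_op_half_power gegen_op_gegen_poly left_diff_distrib mult_smult_left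
          mult_smult_right gegen_int_diff[OF l] gegen_int_smult gegen_moment_def)
  then show ?thesis by (simp add: algebra_simps)
qed

lemma gegen_moment_0_0: "l \<ge> 0 \<Longrightarrow> gegen_moment l 0 0 = 1"
  by (simp add: gegen_moment_def gegen_int_1)

lemma gegen_moment_0_Suc:
  assumes l: "l \<ge> 0"
  shows "gegen_moment l 0 (Suc n) = gegen_moment l 0 n * (l + 1 + real n) / (2 * l + 2 + real n)"
proof -
  have "real (Suc n) * ((2 * l + 2 + real n) * gegen_moment l 0 (Suc n))
      = real (Suc n) * ((l + 1 + real n) * gegen_moment l 0 n)"
    using gegen_moment_rec[OF l, of "Suc n" 0] by (simp add: gegen_ev_def algebra_simps)
  then have "(2 * l + 2 + real n) * gegen_moment l 0 (Suc n) = (l + 1 + real n) * gegen_moment l 0 n"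
    by (subst (asm) mult_cancel_left) auto
  moreover have "2 * l + 2 + real n > 0" using l by auto
  ultimately show ?thesis by (simp add: field_simps)
qed

lemma gegen_moment_0_pochhammer:
  assumes l: "l \<ge> 0"
  shows "gegen_moment l 0 n = pochhammer (l + 1) n / pochhammer (2 * l + 2) n"
  by (induction n) (use l in \<open>simp_all add: gegen_moment_0_0 gegen_moment_0_Suc pochhammer_rec' mult.commute\<close>)

lemma gegen_moment_0_pos: "l \<ge> 0 \<Longrightarrow> gegen_moment l 0 n > 0"
  by (simp add: gegen_moment_0_pochhammer pochhammer_pos)

text \<open>For m = 0 the moment is a quotient of Pochhammer symbols. Its reciprocal divided by n^(l
  + 1) is a quotient of two approximants of Gamma functions and tends to Gamma (l + 1) / Gamma (2 l
  + 2) > 0, so this sequence and its inverse are both bounded.\<close>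

lemma gegen_moment_0_bounds:
  assumes l: "l \<ge> 0"
  obtains C where "C \<ge> 1" "\<And>n. n > 0 \<Longrightarrow> 1 / gegen_moment l 0 n \<le> C * real n powr (l + 1)"
    "\<And>n. n > 0 \<Longrightarrow> real n powr (l + 1) \<le> C * (1 / gegen_moment l 0 n)"
proof -
  define X where "X n = Gamma_series' (l + 1) n / Gamma_series' (2 * l + 2) n" for n
  have eq: "X n = real n powr - (l + 1) * (1 / gegen_moment l 0 n)" if "n > 0" for n
  proof -
    have "exp ((l + 1) * ln (real n)) / exp ((2 * l + 2) * ln (real n)) = real n powr - (l + 1)"
      using that by (simp add: powr_def exp_diff[symmetric] algebra_simps)
    moreover have "pochhammer (l + 1) n > 0" "pochhammer (2 * l + 2) n > 0"
      using l by (auto intro!: pochhammer_pos)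
    ultimately show ?thesis using that l
      by (simp add: X_def Gamma_series'_def gegen_moment_0_pochhammer field_simps)
  qed
  have *: "X \<longlonglongrightarrow> Gamma (l + 1) / Gamma (2 * l + 2)"
    unfolding X_def using l by (intro tendsto_divide Gamma_series'_LIMSEQ) (auto simp: Gamma_eq_zero_iff elim!: nonpos_Ints_cases)
  have pos: "Gamma (l + 1) / Gamma (2 * l + 2) > 0"
    using l by (auto intro!: divide_pos_pos Gamma_real_pos)
  have "Bseq X" using * convergentI convergent_imp_Bseq by blast
  then obtain C1 where C1: "\<And>n. \<bar>X n\<bar> \<le> C1" by (auto simp: Bseq_def)
  have "Bseq (\<lambda>n. inverse (X n))" using * pos convergentI convergent_imp_Bseq tendsto_inverse
    by (metis less_irrefl)
  then obtain C2 where C2: "\<And>n. \<bar>inverse (X n)\<bar> \<le> C2" by (auto simp: Bseq_def)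
  define C where "C = max 1 (max C1 C2)"
  show thesis
  proof (rule that[of C])
    fix n :: nat assume n: "n > 0"
    have mp: "gegen_moment l 0 n > 0" using l by (rule gegen_moment_0_pos)
    have "X n \<le> C" "inverse (X n) \<le> C"
      using abs_le_D1[OF C1[of n]] abs_le_D1[OF C2[of n]] unfolding C_def by linarith+
    with n have "real n powr - (l + 1) * (1 / gegen_moment l 0 n) \<le> C"
      "inverse (real n powr - (l + 1) * (1 / gegen_moment l 0 n)) \<le> C"
      by (simp_all only: eq)
    with mp n show "1 / gegen_moment l 0 n \<le> C * real n powr (l + 1)"
      "real n powr (l + 1) \<le> C * (1 / gegen_moment l 0 n)"
      unfolding powr_minus by (simp_all add: divide_simps mult_ac)
  qed (simp add: C_def)
qed

text \<open>With respect to \<open>Pi_measure (l + 1/2)\<close>, the function ((1 + w) / 2)^n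
  divided by its mass is a probability density concentrating at w = 1. The multiplier is the mean of
  \<open>gegen_poly l m\<close> under it.\<close>

definition gegen_mult :: "real \<Rightarrow> nat \<Rightarrow> nat \<Rightarrow> real" where
  "gegen_mult l m n = gegen_moment l m n / gegen_moment l 0 n"

lemma abs_gegen_mult_le_1:
  assumes l: "l \<ge> 0"
  shows "\<bar>gegen_mult l m n\<bar> \<le> 1"
proof -
  have *: "\<bar>poly (half_poly ^ n * gegen_poly l m) w\<bar> \<le> poly (half_poly ^ n) w" if "\<bar>w\<bar> \<le> 1" for w
  proof -
    have "(1 + w) / 2 \<ge> 0" using that by auto
    then show ?thesis
      using abs_gegen_poly_le_1[OF l that, of m]
      by (simp only: poly_mult poly_power poly_half_poly abs_mult)
        (simp add: mult_left_le)
  qed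
  have "gegen_moment l m n \<le> gegen_int l (half_poly ^ n)"
    unfolding gegen_moment_def using * by (intro gegen_int_mono[OF l]) (auto simp only: abs_le_iff)
  moreover have "gegen_int l (smult (-1) (half_poly ^ n)) \<le> gegen_moment l m n"
    unfolding gegen_moment_def
  proof (intro gegen_int_mono[OF l])
    show "poly (smult (- 1) (half_poly ^ n)) w \<le> poly (half_poly ^ n * gegen_poly l m) w"
      if "\<bar>w\<bar> \<le> 1" for w
      using *[OF that] unfolding poly_smult by linarith
  qed
  moreover have "gegen_int l (half_poly ^ n) = gegen_moment l 0 n"
    using l by (simp add: gegen_moment_def)
  ultimately show ?thesis
    using gegen_moment_0_pos[OF l, of n] by (simp only: gegen_mult_def gegen_int_smult abs_divide) (simp add: abs_le_iff)
qed

text \<open>\<open>1 - gegen_poly l m\<close> has a zero at 1, hence is at most B (1 - w) on the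
  interval. By the moment recurrence the mean of (1 - w) / 2 is (l + 1) / (2 l + 2 + n), which tends
  to 0.\<close>

lemma gegen_mult_tendsto_1:
  assumes l: "l \<ge> 0"
  shows "(\<lambda>n. gegen_mult l m n) \<longlonglongrightarrow> 1"
proof -
  let ?q = "1 - gegen_poly l m"
  have "poly ?q 1 = 0" using l by simp
  then obtain r where r: "?q = [:-1, 1:] * r"
    by (metis dvdE poly_eq_0_iff_dvd)
  have "compact (poly r ` {-1..1})"
    by (intro compact_continuous_image) (auto intro: continuous_intros)
  then obtain B where B: "\<forall>w\<in>{-1..1}. \<bar>poly r w\<bar> \<le> B"
    by (auto dest!: compact_imp_bounded simp: bounded_iff)
  let ?M = "gegen_moment l 0"
  have M: "?M n = gegen_int l (half_poly ^ n)" for n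
    using l by (simp add: gegen_moment_def)
  have ub: "1 - gegen_mult l m n \<le> 2 * B * ((l + 1) / (2 * l + 2 + real n))" for n
  proof -
    have "gegen_int l (half_poly ^ n * ?q) \<le> gegen_int l (smult (2 * B) (half_poly ^ n * (1 - half_poly)))"
    proof (intro gegen_int_mono[OF l])
      fix w :: real assume w: "\<bar>w\<bar> \<le> 1"
      have "poly ?q w = (1 - w) * (- poly r w)"
        unfolding r by (simp add: algebra_simps)
      also have "\<dots> \<le> (1 - w) * B"
        using w B by (intro mult_left_mono) (auto simp: abs_le_iff)
      finally have "poly (half_poly ^ n) w * poly ?q w \<le> poly (half_poly ^ n) w * ((1 - w) * B)"
        using w by (intro mult_left_mono) (auto simp only: poly_power poly_half_poly, simp)
      also have "(1 - w) * B = 2 * B * poly (1 - half_poly) w"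
        by (simp add: field_simps)
      finally show "poly (half_poly ^ n * ?q) w \<le> poly (smult (2 * B) (half_poly ^ n * (1 - half_poly))) w"
        by (simp only: poly_mult poly_smult mult_ac)
    qed
    also have "\<dots> = 2 * B * (?M n - ?M (Suc n))"
      by (simp only: gegen_int_smult right_diff_distrib gegen_int_diff[OF l] M mult_1_right
          power_Suc2[symmetric])
    also have "?M n - ?M (Suc n) = ?M n * ((l + 1) / (2 * l + 2 + real n))"
      using l by (simp add: gegen_moment_0_Suc field_simps)
    finally have "?M n - gegen_moment l m n \<le> 2 * B * (?M n * ((l + 1) / (2 * l + 2 + real n)))"
      unfolding gegen_moment_def[of l m]
      by (simp only: right_diff_distrib gegen_int_diff[OF l] M[symmetric] mult_1_right)
    then show ?thesis
      using gegen_moment_0_pos[OF l, of n] by (simp add: gegen_mult_def field_simps)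
  qed
  have "(\<lambda>n. 1 - 2 * B * ((l + 1) / (2 * l + 2 + real n))) \<longlonglongrightarrow> 1 - 2 * B * 0"
    by (intro tendsto_intros real_tendsto_divide_at_top[where c = "l + 1"] filterlim_tendsto_add_at_top[OF tendsto_const] filterlim_real_sequentially)
  then have lim: "(\<lambda>n. 1 - 2 * B * ((l + 1) / (2 * l + 2 + real n))) \<longlonglongrightarrow> 1"
    by simp
  show ?thesis
  proof (rule tendsto_sandwich[OF _ _ lim tendsto_const])
    show "\<forall>\<^sub>F n in sequentially. 1 - 2 * B * ((l + 1) / (2 * l + 2 + real n)) \<le> gegen_mult l m n"
      using ub by (intro always_eventually) (auto simp: algebra_simps)
    show "\<forall>\<^sub>F n in sequentially. gegen_mult l m n \<le> 1"
      using abs_gegen_mult_le_1[OF l] by (intro always_eventually) (auto simp: abs_le_iff)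
  qed
qed

text \<open>The factors in the recurrence for the moments are positive from degree \<open>m\<close> on, so a negative
  value would persist and contradict the limit 1.\<close>

lemma gegen_mult_nonneg:
  assumes l: "l \<ge> 0" and "m \<le> n"
  shows "gegen_mult l m n \<ge> 0"
proof (rule ccontr)
  assume "\<not> ?thesis"
  then have neg: "gegen_moment l m n < 0"
    using gegen_moment_0_pos[OF l, of n] by (simp add: gegen_mult_def not_le divide_less_0_iff)
  have "gegen_moment l m k < 0" if "k \<ge> n" for k
    using that
  proof (induction k rule: dec_induct)
    case (step k)
    have "gegen_ev l (Suc k) - gegen_ev l m =
        (real (Suc k) - real m) * (real (Suc k) + real m + 2 * l + 1)"
      by (simp add: gegen_ev_def algebra_simps)
    also have "\<dots> > 0" using step \<open>m \<le> n\<close> l by (intro mult_pos_pos) auto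
    finally have 1: "gegen_ev l (Suc k) - gegen_ev l m > 0" .
    have "real (Suc k) * (real (Suc k) + l) * gegen_moment l m k < 0"
      using step l by (intro mult_pos_neg mult_pos_pos) auto
    with gegen_moment_rec[OF l, of "Suc k" m]
    have "(gegen_ev l (Suc k) - gegen_ev l m) * gegen_moment l m (Suc k) < 0" by simp
    with 1 show ?case by (simp add: mult_less_0_iff)
  qed (rule neg)
  then have "\<forall>\<^sub>F k in sequentially. gegen_mult l m k \<le> 0"
    using gegen_moment_0_pos[OF l]
    by (intro eventually_sequentiallyI[of n]) (auto simp: gegen_mult_def divide_le_0_iff less_imp_le)
  then have "(1::real) \<le> 0"
    by (intro tendsto_upperbound[OF gegen_mult_tendsto_1[OF l, of m]]) auto
  then show False by simp
qed

section \<open>Positive norms and Fourier coefficients\<close>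

text \<open>The degenerate case of Cauchy-Schwarz, from nonnegativity of the square of
  \<open>q + smult s g\<close>.\<close>

lemma gegen_int_square_zero:
  assumes l: "l \<ge> 0" and "gegen_int l (q * q) = 0"
  shows "gegen_int l (q * g) = 0"
proof -
  define A where "A = gegen_int l (q * g)"
  define G where "G = gegen_int l (g * g)"
  have nn: "gegen_int l (p * p) \<ge> 0" for p
    unfolding gegen_int_def by (intro integral_nonneg_AE) auto
  have G: "G \<ge> 0" unfolding G_def by (rule nn)
  \<comment> \<open>The summand 1 keeps the denominator positive even if G = 0; the quadratic in s
    then equals - A^2 (G + 2) / (G + 1)^2.\<close>
  define s where "s = - A / (G + 1)"
  have "(q + smult s g) * (q + smult s g) = q * q + smult (2 * s) (q * g) + smult (s * s) (g * g)"
    by (rule poly_eq_poly_eq_iff[THEN iffD1], rule ext) (simp add: algebra_simps)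
  then have "0 \<le> 0 + 2 * s * A + s * s * G"
    using nn[of "q + smult s g"] assms by (simp only: gegen_int_add[OF l] gegen_int_smult A_def G_def)
  also have "\<dots> = - A\<^sup>2 * (G + 2) / (G + 1)\<^sup>2"
  proof -
    have "s * (G + 1) = - A" using G by (simp add: s_def)
    then have "(2 * s * A + s * s * G) * (G + 1)\<^sup>2 = - A\<^sup>2 * (G + 2)" by algebra
    then show ?thesis using G by (simp add: field_simps)
  qed
  finally have "A\<^sup>2 * ((G + 2) / (G + 1)\<^sup>2) \<le> 0" by simp
  moreover have "(G + 2) / (G + 1)\<^sup>2 > 0" using G by (intro divide_pos_pos) auto
  ultimately show ?thesis unfolding A_def by (metis mult_le_0_iff not_less power2_less_eq_zero_iff)
qed

definition gegen_zeta :: "real \<Rightarrow> nat \<Rightarrow> real" where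
  "gegen_zeta l m = 1 / gegen_int l (gegen_poly l m * gegen_poly l m)"

text \<open>An eigenpolynomial of norm zero would be orthogonal to every power of
  \<open>half_poly\<close>, so all its multipliers would vanish, against their limit 1.\<close>

lemma gegen_int_square_pos:
  assumes l: "l \<ge> 0"
  shows "gegen_int l (gegen_poly l m * gegen_poly l m) > 0"
proof -
  have "gegen_int l (gegen_poly l m * gegen_poly l m) \<noteq> 0"
  proof
    assume "gegen_int l (gegen_poly l m * gegen_poly l m) = 0"
    then have "gegen_mult l m n = 0" for n
      using gegen_int_square_zero[OF l] by (simp add: gegen_mult_def gegen_moment_def mult.commute)
    then show False
      using gegen_mult_tendsto_1[OF l, of m] by (simp add: LIMSEQ_const_iff)
  qed
  moreover have "gegen_int l (gegen_poly l m * gegen_poly l m) \<ge> 0"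
    unfolding gegen_int_def by (intro integral_nonneg_AE) auto
  ultimately show ?thesis by simp
qed

lemma gegen_zeta_pos: "l \<ge> 0 \<Longrightarrow> gegen_zeta l m > 0"
  by (simp add: gegen_zeta_def gegen_int_square_pos)

lemma gegen_zeta_0: "l \<ge> 0 \<Longrightarrow> gegen_zeta l 0 = 1"
  by (simp add: gegen_zeta_def gegen_int_1)

lemma zonal_Z_eq:
  assumes l: "l \<ge> 0"
  shows "zonal_Z n (l + 1/2) w = gegen_zeta l n * poly (gegen_poly l n) w"
proof -
  define c where "c = poly (jacobi_poly n l) 1"
  have c: "c > 0" unfolding c_def using l by (rule jacobi_poly_1_pos)
  have P: "jacobi_P n l l v = c * poly (gegen_poly l n) v" for v
    using c by (simp add: gegen_poly_def c_def[symmetric]) (simp add: poly_jacobi_poly)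
  have "jacobi_h n l = c * c * gegen_int l (gegen_poly l n * gegen_poly l n)"
    unfolding jacobi_h_def gegen_int_def P
    by (simp add: power_mult_distrib power2_eq_square mult_ac flip: integral_mult_right_zero)
  then show ?thesis
    using c l by (simp add: zonal_Z_def P gegen_zeta_def)
qed

text \<open>Orthogonality identifies the coefficients with moments times \<open>gegen_zeta\<close>.
  After division by the mass, only the multipliers distinguish this sum from the formal series of
  the heat kernel at time 0.\<close>

lemma half_power_expansion:
  assumes l: "l \<ge> 0"
  shows "((1 + w) / 2) ^ N / gegen_moment l 0 N =
     (\<Sum>m\<le>N. gegen_mult l m N * gegen_zeta l m * poly (gegen_poly l m) w)"
proof -
  have "degree (half_poly ^ N) \<le> N"
    by (simp add: degree_power_eq)
  then obtain d where d: "half_poly ^ N = (\<Sum>m\<le>N. smult (d m) (gegen_poly l m))"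
    using poly_gegen_expansion[OF l] by blast
  have dm: "d m = gegen_zeta l m * gegen_moment l m N" if "m \<le> N" for m
  proof -
    have "gegen_moment l m N = (\<Sum>k\<le>N. d k * gegen_int l (gegen_poly l k * gegen_poly l m))"
      unfolding gegen_moment_def d by (simp add: sum_distrib_right gegen_int_sum[OF l] gegen_int_smult)
    also have "\<dots> = (\<Sum>k\<le>N. if k = m then d m * gegen_int l (gegen_poly l m * gegen_poly l m) else 0)"
      by (intro sum.cong) (auto simp: gegen_poly_orthogonal[OF l])
    also have "\<dots> = d m / gegen_zeta l m"
      using that by (simp add: gegen_zeta_def)
    finally show ?thesis using gegen_zeta_pos[OF l, of m] by (simp add: field_simps)
  qed
  have "((1 + w) / 2) ^ N = (\<Sum>m\<le>N. d m * poly (gegen_poly l m) w)"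
    using arg_cong[OF d, of "\<lambda>p. poly p w"] by (simp only: poly_power poly_half_poly poly_sum poly_smult)
  also have "\<dots> / gegen_moment l 0 N =
      (\<Sum>m\<le>N. gegen_mult l m N * gegen_zeta l m * poly (gegen_poly l m) w)"
    unfolding sum_divide_distrib by (intro sum.cong refl) (simp add: dm gegen_mult_def)
  finally show ?thesis .
qed

subsection \<open>Maximum principle\<close>

text \<open>At the earliest time at which W is nonnegative somewhere, the intermediate value theorem
  in time excludes positive values, so W has maximum 0 there; a negative time derivative would make
  W positive slightly earlier. Touching at the boundary of X is left to \<open>touch\<close>, so
  that each application can treat its endpoints in its own way.\<close>

lemma first_touching_time:
  fixes W :: "real \<Rightarrow> real \<Rightarrow> real"
  assumes X: "compact X" and cont: "continuous_on ({0..T} \<times> X) (\<lambda>(t, x). W t x)"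
    and init: "\<And>x. x \<in> X \<Longrightarrow> W 0 x < 0"
    and touch: "\<And>t x. 0 < t \<Longrightarrow> t \<le> T \<Longrightarrow> x \<in> X \<Longrightarrow> W t x = 0 \<Longrightarrow> (\<forall>z\<in>X. W t z \<le> 0) \<Longrightarrow>
       \<exists>D<0. ((\<lambda>s. W s x) has_real_derivative D) (at t)"
    and tx: "0 \<le> t" "t \<le> T" "x \<in> X"
  shows "W t x < 0"
proof (rule ccontr)
  assume "\<not> W t x < 0"
  define S where "S = {q \<in> {0..T} \<times> X. (case q of (t, x) \<Rightarrow> W t x) \<ge> 0}"
  have "(t, x) \<in> S" using tx \<open>\<not> W t x < 0\<close> by (auto simp: S_def)
  have cX: "compact ({0..T} \<times> X)" using X by (intro compact_Times) auto
  have "closedin (top_of_set ({0..T} \<times> X)) S"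
  proof -
    have "closedin (top_of_set ({0..T} \<times> X)) (({0..T} \<times> X) \<inter> (\<lambda>(t, x). W t x) -` {0..})"
      by (intro continuous_closedin_preimage cont) auto
    also have "({0..T} \<times> X) \<inter> (\<lambda>(t, x). W t x) -` {0..} = S"
      by (auto simp: S_def)
    finally show ?thesis .
  qed
  then have "compact S" using cX closedin_compact by blast
  then obtain q where q: "q \<in> S" "\<And>r. r \<in> S \<Longrightarrow> fst q \<le> fst r"
    using continuous_attains_inf[of S fst] \<open>(t, x) \<in> S\<close> continuous_on_fst[OF continuous_on_id]
    by blast
  obtain t' x' where q': "q = (t', x')" by (cases q)
  have t': "0 \<le> t'" "t' \<le> T" "x' \<in> X" "W t' x' \<ge> 0"
    using q by (auto simp: S_def q')
  have min: "W s z < 0" if "0 \<le> s" "s < t'" "z \<in> X" for s z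
    using q(2)[of "(s, z)"] that t' by (force simp: S_def q')
  have "t' > 0" using t' init[of x'] by (cases "t' = 0") auto
  have le0: "W t' z \<le> 0" if "z \<in> X" for z
  proof (rule ccontr)
    assume "\<not> W t' z \<le> 0"
    have "continuous_on {0..t'} (\<lambda>s. case (s, z) of (t, x) \<Rightarrow> W t x)"
      using t' that by (intro continuous_on_compose2[OF cont]) (auto intro!: continuous_intros)
    then have "continuous_on {0..t'} (\<lambda>s. W s z)" by simp
    moreover have "W 0 z \<le> 0" "0 \<le> W t' z"
      using init[OF that] \<open>\<not> W t' z \<le> 0\<close> by auto
    ultimately obtain s where "0 \<le> s" "s \<le> t'" "W s z = 0"
      using IVT'[of "\<lambda>s. W s z" 0 0 t'] t'(1) by blast
    with min[of s z] that \<open>\<not> W t' z \<le> 0\<close> show False by (cases "s = t'") auto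
  qed
  with t' have "W t' x' = 0" by (intro antisym) auto
  with touch[OF \<open>t' > 0\<close> t'(2,3)] le0 obtain D where D: "D < 0"
    "((\<lambda>s. W s x') has_real_derivative D) (at t')" by blast
  from DERIV_neg_dec_left[OF D(2,1)] obtain d where d: "d > 0"
    "\<And>h. 0 < h \<Longrightarrow> h < d \<Longrightarrow> W t' x' < W (t' - h) x'" by blast
  define h where "h = min (d / 2) (t' / 2)"
  have "0 < h" "h < d" "0 \<le> t' - h" "t' - h < t'"
    using \<open>d > 0\<close> \<open>t' > 0\<close> by (auto simp: h_def min_def)
  with d(2)[of h] min[of "t' - h" x'] t' \<open>W t' x' = 0\<close> show False by auto
qed

section \<open>The Gegenbauer operator at a maximum\<close>

lemma local_max_derivs:
  fixes f f' :: "real \<Rightarrow> real"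
  assumes f: "\<And>x. (f has_real_derivative f' x) (at x)"
    and f': "(f' has_real_derivative D) (at x0)"
    and "d > 0" and max: "\<And>y. \<bar>x0 - y\<bar> < d \<Longrightarrow> f y \<le> f x0"
  shows "f' x0 = 0" "D \<le> 0"
proof -
  show 0: "f' x0 = 0"
    using DERIV_local_max[OF f \<open>d > 0\<close>] max by auto
  show "D \<le> 0"
  proof (rule ccontr)
    assume "\<not> D \<le> 0"
    then obtain e where e: "e > 0" "\<And>h. 0 < h \<Longrightarrow> h < e \<Longrightarrow> f' x0 < f' (x0 + h)"
      using DERIV_pos_inc_right[OF f'] by auto
    define h where "h = min (e / 2) (d / 2)"
    have h: "0 < h" "h < e" "h < d" using e \<open>d > 0\<close> by (auto simp: h_def min_def)
    obtain z where z: "x0 < z" "z < x0 + h" "f (x0 + h) - f x0 = (x0 + h - x0) * f' z"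
      using MVT2[of x0 "x0 + h" f f'] f h by auto
    have "f' z > 0" using e(2)[of "z - x0"] z h 0 by auto
    with h have "h * f' z > 0" by (intro mult_pos_pos) auto
    with z have "f (x0 + h) > f x0" by simp
    moreover have "f (x0 + h) \<le> f x0" using h by (intro max) auto
    ultimately show False by simp
  qed
qed

text \<open>At w = 1 and w = -1 the second-order coefficient vanishes and the one-sided slope gives
  the first-order term the right sign. The degenerate endpoints therefore need no boundary
  condition.\<close>

lemma max_gegen_interval:
  fixes f f' :: "real \<Rightarrow> real"
  assumes f: "\<And>x. (f has_real_derivative f' x) (at x)"
    and f': "(f' has_real_derivative D) (at x0)"
    and x0: "\<bar>x0\<bar> \<le> 1" and max: "\<And>y. \<bar>y\<bar> \<le> 1 \<Longrightarrow> f y \<le> f x0" and "c \<ge> 0"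
  shows "(1 - x0\<^sup>2) * D - c * x0 * f' x0 \<le> 0"
proof -
  consider "x0 = 1" | "x0 = -1" | "\<bar>x0\<bar> < 1" using x0 by fastforce
  then show ?thesis
  proof cases
    case 1
    have "f' 1 \<ge> 0"
    proof (rule ccontr)
      assume "\<not> f' 1 \<ge> 0"
      then obtain d where d: "d > 0" "\<And>h. 0 < h \<Longrightarrow> h < d \<Longrightarrow> f 1 < f (1 - h)"
        using DERIV_neg_dec_left[OF f] by (metis not_le)
      define h where "h = min (d / 2) 1"
      have "0 < h" "h < d" "\<bar>1 - h\<bar> \<le> 1" using d(1) by (auto simp: h_def min_def)
      with d(2)[of h] max[of "1 - h"] 1 show False by auto
    qed
    with 1 \<open>c \<ge> 0\<close> show ?thesis by simp
  next
    case 2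
    have "f' (-1) \<le> 0"
    proof (rule ccontr)
      assume "\<not> f' (-1) \<le> 0"
      then obtain d where d: "d > 0" "\<And>h. 0 < h \<Longrightarrow> h < d \<Longrightarrow> f (-1) < f (-1 + h)"
        using DERIV_pos_inc_right[OF f] by (metis not_le)
      define h where "h = min (d / 2) 1"
      have "0 < h" "h < d" "\<bar>-1 + h\<bar> \<le> 1" using d(1) by (auto simp: h_def min_def)
      with d(2)[of h] max[of "-1 + h"] 2 show False by auto
    qed
    with 2 \<open>c \<ge> 0\<close> show ?thesis by (simp add: mult_nonneg_nonpos)
  next
    case 3
    have "f' x0 = 0" "D \<le> 0"
      using local_max_derivs[OF f f', of "1 - \<bar>x0\<bar>"] 3 max by auto
    then show ?thesis using 3 by (simp add: mult_nonneg_nonpos abs_square_le_1)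
  qed
qed

text \<open>In the variable \<open>w = cos \<phi>\<close> the Gegenbauer operator is \<open>u'' + (2 l + 1) cot \<phi> u'\<close>, with the
  limit \<open>(2 l + 2) u''\<close> at \<open>\<phi> = 0\<close>.\<close>

lemma local_max_gegen_cos:
  fixes S S' :: "real \<Rightarrow> real"
  assumes l: "l \<ge> 0"
    and S: "\<And>x. (S has_real_derivative S' x) (at x)"
    and S': "(S' has_real_derivative S'') (at \<phi>)"
    and "d > 0" and max: "\<And>y. \<bar>\<phi> - y\<bar> < d \<Longrightarrow> poly P (cos y) - S y \<le> poly P (cos \<phi>) - S \<phi>"
    and \<phi>: "\<bar>\<phi>\<bar> < pi"
  shows "poly (gegen_op l P) (cos \<phi>) \<le>
    (if \<phi> = 0 then (2 * l + 2) * S'' else S'' + (2 * l + 1) * (cos \<phi> / sin \<phi>) * S' \<phi>)"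
proof -
  let ?P1 = "poly (pderiv P)" and ?P2 = "poly (pderiv (pderiv P))"
  have d1: "((\<lambda>y. poly P (cos y) - S y) has_real_derivative (- sin y * ?P1 (cos y) - S' y)) (at y)" for y
    by (rule derivative_eq_intros S DERIV_chain2[OF poly_DERIV] refl | simp)+
  have d2: "((\<lambda>y. - sin y * ?P1 (cos y) - S' y) has_real_derivative
     (- cos \<phi> * ?P1 (cos \<phi>) + (sin \<phi>)\<^sup>2 * ?P2 (cos \<phi>) - S'')) (at \<phi>)"
    by (rule derivative_eq_intros S' DERIV_chain2[OF poly_DERIV] refl | simp add: power2_eq_square)+
  note m = local_max_derivs[OF d1 d2 \<open>d > 0\<close> max]
  have op: "poly (gegen_op l P) (cos \<phi>) = (sin \<phi>)\<^sup>2 * ?P2 (cos \<phi>) - 2 * (l + 1) * cos \<phi> * ?P1 (cos \<phi>)"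
    by (simp add: poly_gegen_op sin_squared_eq)
  show ?thesis
  proof (cases "\<phi> = 0")
    case True
    have "- ?P1 1 \<le> S''" using m(2) True by simp
    then have "(2 * l + 2) * (- ?P1 1) \<le> (2 * l + 2) * S''"
      using l by (intro mult_left_mono) auto
    then show ?thesis unfolding op using True by (simp add: algebra_simps)
  next
    case False
    have s: "sin \<phi> \<noteq> 0" using False \<phi> by (simp add: sin_zero_pi_iff)
    have "S' \<phi> = - sin \<phi> * ?P1 (cos \<phi>)" using m(1) by simp
    then have c: "(2 * l + 1) * (cos \<phi> / sin \<phi>) * S' \<phi> = (2 * l + 1) * (- cos \<phi> * ?P1 (cos \<phi>))"
      using s by simp
    show ?thesis
      using m(2) False unfolding op c by (simp add: algebra_simps)
  qed
qed

section \<open>Trigonometric inequalities\<close>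

lemma sin_ge_x_cos:
  fixes x :: real
  assumes "0 \<le> x" "x \<le> pi"
  shows "x * cos x \<le> sin x"
proof -
  have "(\<lambda>x. sin x - x * cos x) 0 \<le> (\<lambda>x. sin x - x * cos x) x"
  proof (rule DERIV_nonneg_imp_nondecreasing[OF \<open>0 \<le> x\<close>])
    fix y assume "0 \<le> y" "y \<le> x"
    then show "\<exists>D. ((\<lambda>x. sin x - x * cos x) has_real_derivative D) (at y) \<and> 0 \<le> D"
      using assms by (intro exI[of _ "y * sin y"]) (auto intro!: derivative_eq_intros mult_nonneg_nonneg sin_ge_zero)
  qed
  then show ?thesis by simp
qed

lemma x_cot_le_1:
  fixes x :: real
  assumes "\<bar>x\<bar> < pi" "x \<noteq> 0"
  shows "x * (cos x / sin x) \<le> 1"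
proof -
  have *: "y * (cos y / sin y) \<le> 1" if "0 < y" "y < pi" for y :: real
    using sin_ge_x_cos[of y] sin_gt_zero[of y] that by (simp add: divide_simps)
  show ?thesis using *[of x] *[of "-x"] assms by (cases "x > 0") auto
qed

text \<open>The product cos y exp (y^2 / 2) decreases, by the preceding inequality. With x = \<phi>
  / 2 this places the initial data below a Gaussian at time 1 / N.\<close>

lemma cos_le_exp:
  fixes x :: real
  assumes "\<bar>x\<bar> \<le> pi / 2"
  shows "cos x \<le> exp (- x\<^sup>2 / 2)"
proof -
  have *: "cos y \<le> exp (- y\<^sup>2 / 2)" if "0 \<le> y" "y \<le> pi / 2" for y :: real
  proof -
    have "(\<lambda>y. cos y * exp (y\<^sup>2 / 2)) 0 \<ge> (\<lambda>y. cos y * exp (y\<^sup>2 / 2)) y"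
    proof (rule DERIV_nonpos_imp_nonincreasing[OF \<open>0 \<le> y\<close>])
      fix z assume "0 \<le> z" "z \<le> y"
      then have "z * cos z - sin z \<le> 0" using sin_ge_x_cos[of z] that by auto
      then have "exp (z\<^sup>2 / 2) * (z * cos z - sin z) \<le> 0" by (simp add: mult_nonneg_nonpos)
      moreover have "((\<lambda>y. cos y * exp (y\<^sup>2 / 2)) has_real_derivative exp (z\<^sup>2 / 2) * (z * cos z - sin z)) (at z)"
        by (auto intro!: derivative_eq_intros simp: algebra_simps)
      ultimately show "\<exists>D. ((\<lambda>y. cos y * exp (y\<^sup>2 / 2)) has_real_derivative D) (at z) \<and> D \<le> 0" by blast
    qed
    then show ?thesis by (simp add: exp_minus field_simps)
  qed
  show ?thesis using *[of "\<bar>x\<bar>"] assms by simp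
qed

text \<open>Twice the exponent of the upper bound. The loss only moves the starting time of the
  lower barrier from 1 / N to 1 / (2 N).\<close>

lemma exp_le_cos:
  fixes x :: real
  assumes "\<bar>x\<bar> \<le> 1"
  shows "exp (- x\<^sup>2) \<le> cos x"
proof -
  have x2: "0 \<le> x\<^sup>2" "x\<^sup>2 \<le> 1" using assms by (auto simp: abs_square_le_1)
  have "exp (- x\<^sup>2) \<le> 1 / (1 + x\<^sup>2)"
    using exp_ge_add_one_self[of "x\<^sup>2"] x2 by (simp add: exp_minus field_simps add_pos_nonneg)
  also have "\<dots> \<le> 1 - x\<^sup>2 / 2"
  proof -
    have "0 \<le> x\<^sup>2 * (1 - x\<^sup>2)" using x2 by (intro mult_nonneg_nonneg) auto
    then show ?thesis using x2 by (subst pos_divide_le_eq) (auto simp: algebra_simps add_pos_nonneg)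
  qed
  also have "\<dots> \<le> cos x"
  proof -
    have "\<bar>sin (x / 2)\<bar> \<le> \<bar>x / 2\<bar>" by (rule abs_sin_x_le_abs_x)
    then have "(sin (x / 2))\<^sup>2 \<le> (x / 2)\<^sup>2" by (rule abs_le_square_iff[THEN iffD1])
    moreover have "cos x = 1 - 2 * (sin (x / 2))\<^sup>2"
      using cos_double_sin[of "x / 2"] by simp
    ultimately show ?thesis by (simp add: power_divide)
  qed
  finally show ?thesis .
qed

lemma sin_ge_cubic:
  fixes y :: real
  assumes y: "0 \<le> y"
  shows "y - y ^ 3 / 6 \<le> sin y"
proof -
  have "(\<lambda>y. sin y - (y - y ^ 3 / 6)) 0 \<le> (\<lambda>y. sin y - (y - y ^ 3 / 6)) y"
  proof (rule DERIV_nonneg_imp_nondecreasing[of 0 y "\<lambda>y. sin y - (y - y ^ 3 / 6)"])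
    fix z :: real assume "0 \<le> z" "z \<le> y"
    have "\<bar>sin (z / 2)\<bar> \<le> \<bar>z / 2\<bar>" by (rule abs_sin_x_le_abs_x)
    then have "(sin (z / 2))\<^sup>2 \<le> (z / 2)\<^sup>2" by (rule abs_le_square_iff[THEN iffD1])
    then have "cos z - 1 + z\<^sup>2 / 2 \<ge> 0"
      using cos_double_sin[of "z / 2"] by (simp add: power_divide)
    then show "\<exists>D. ((\<lambda>y. sin y - (y - y ^ 3 / 6)) has_real_derivative D) (at z) \<and> 0 \<le> D"
      by (intro exI[of _ "cos z - 1 + z\<^sup>2 / 2"]) (auto intro!: derivative_eq_intros simp: power2_eq_square)
  qed (use y in simp)
  then show ?thesis by simp
qed

text \<open>The left side is the error of the Gaussian as a supersolution, the right side what a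
  factor exp (k - k cos x) can compensate. No constant works up to \<pi>, where the left side blows
  up.\<close>

lemma one_minus_x_cot_le:
  fixes x :: real
  assumes "\<bar>x\<bar> \<le> 2 * pi / 3" "x \<noteq> 0"
  shows "1 - x * (cos x / sin x) \<le> 8 * (x * sin x)"
proof -
  have *: "1 - y * (cos y / sin y) \<le> 8 * (y * sin y)" if y: "0 < y" "y \<le> 2 * pi / 3" for y :: real
  proof -
    \<comment> \<open>The constants: y < 2.14 gives y^2 / 6 \<le> 0.78, so the cubic bound yields
      sin y \<ge> 0.22 y, and 8 times 0.22^2 exceeds 1/3, the coefficient in sin y - y cos y \<le>
      y^3 / 3.\<close>
    have pi: "pi < 3.2" using pi_approx by simp
    have "y < 2.14" using y pi by simp
    then have "y\<^sup>2 \<le> 2.14\<^sup>2" using y by (intro power_mono) auto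
    then have y2: "y\<^sup>2 / 6 \<le> 3 / 4 + 0.03" by (simp add: power2_eq_square)
    have s3: "y - y ^ 3 / 6 \<le> sin y" using y by (intro sin_ge_cubic) auto
    have "y * (1 - y\<^sup>2 / 6) \<ge> y * (1 / 4 - 0.03)"
      using y2 y by (intro mult_left_mono) auto
    then have s1: "sin y \<ge> 0.22 * y"
      using s3 by (simp add: power2_eq_square power3_eq_cube algebra_simps)
    have s2: "sin y - y * cos y \<le> y ^ 3 / 3"
    proof -
      have "(\<lambda>y. y ^ 3 / 3 - (sin y - y * cos y)) 0 \<le> (\<lambda>y. y ^ 3 / 3 - (sin y - y * cos y)) y"
      proof (rule DERIV_nonneg_imp_nondecreasing[of 0 y "\<lambda>y. y ^ 3 / 3 - (sin y - y * cos y)"])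
        fix z :: real assume "0 \<le> z" "z \<le> y"
        then have "z * (z - sin z) \<ge> 0" using sin_x_le_x[of z] by simp
        then show "\<exists>D. ((\<lambda>y. y ^ 3 / 3 - (sin y - y * cos y)) has_real_derivative D) (at z) \<and> 0 \<le> D"
          by (intro exI[of _ "z * (z - sin z)"])
            (auto intro!: derivative_eq_intros simp: power2_eq_square algebra_simps)
      qed (use y in simp)
      then show ?thesis by simp
    qed
    have sp: "sin y > 0" using s1 y by auto
    have "(0.22 * y)\<^sup>2 \<le> (sin y)\<^sup>2" using s1 y by (intro power_mono) auto
    then have "121 / 2500 * y\<^sup>2 \<le> (sin y)\<^sup>2" by (simp add: power_mult_distrib power2_eq_square)
    then have "y\<^sup>2 / 3 \<le> 8 * (sin y)\<^sup>2" using zero_le_power2[of y] by linarith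
    then have "y * (y\<^sup>2 / 3) \<le> y * (8 * (sin y)\<^sup>2)" using y by (intro mult_left_mono) auto
    then have "y ^ 3 / 3 \<le> 8 * (y * sin y) * sin y"
      by (simp add: power2_eq_square power3_eq_cube mult_ac)
    with s2 have "(sin y - y * cos y) / sin y \<le> 8 * (y * sin y)"
      unfolding pos_divide_le_eq[OF sp] by linarith
    then show ?thesis using sp by (simp add: diff_divide_distrib)
  qed
  show ?thesis using *[of x] *[of "-x"] assms by (cases "x > 0") auto
qed

subsection \<open>Barriers\<close>

definition approx_sol :: "real \<Rightarrow> nat \<Rightarrow> real \<Rightarrow> real poly" where
  "approx_sol l N t = (\<Sum>m\<le>N. smult (gegen_mult l m N * gegen_zeta l m * exp (- t * gegen_ev l m))
     (gegen_poly l m))"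

lemma poly_approx_sol:
  "poly (approx_sol l N t) w = (\<Sum>m\<le>N. gegen_mult l m N *
     (exp (- t * gegen_ev l m) * (gegen_zeta l m * poly (gegen_poly l m) w)))"
  by (simp add: approx_sol_def poly_sum mult_ac)

lemma poly_approx_sol_0:
  "l \<ge> 0 \<Longrightarrow> poly (approx_sol l N 0) w = ((1 + w) / 2) ^ N / gegen_moment l 0 N"
  by (simp add: half_power_expansion poly_approx_sol mult.assoc)

lemma approx_sol_heat_equation:
  "((\<lambda>t. poly (approx_sol l N t) w) has_real_derivative poly (gegen_op l (approx_sol l N t)) w) (at t)"
proof -
  have "poly (gegen_op l (approx_sol l N t)) w = (\<Sum>m\<le>N. gegen_mult l m N *
     (exp (- t * gegen_ev l m) * (- gegen_ev l m) * (gegen_zeta l m * poly (gegen_poly l m) w)))"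
    by (simp add: approx_sol_def gegen_op_sum gegen_op_smult gegen_op_gegen_poly poly_sum mult_ac
          flip: sum_negf)
  then show ?thesis
    unfolding poly_approx_sol by (auto intro!: derivative_eq_intros simp: mult_ac)
qed

lemma continuous_on_approx_sol:
  assumes "continuous_on S f" "continuous_on S g"
  shows "continuous_on S (\<lambda>x. poly (approx_sol l N (f x)) (g x))"
  unfolding poly_approx_sol using assms by (intro continuous_intros)

text \<open>Kept as one exponential so that every derivative is a multiple of the barrier itself.
  Here \<open>s\<close> is the shifted time, \<open>b\<close> a quarter of the squared angle or a
  substitute for it, \<open>a\<close> the logarithm of the prefactor (possibly depending on
  position), and \<open>K\<close> the slack that absorbs bounded errors.\<close>

definition heat_barrier :: "real \<Rightarrow> real \<Rightarrow> real \<Rightarrow> real \<Rightarrow> real \<Rightarrow> real" where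
  "heat_barrier p K a b s = exp (a - p * ln s + K * s - b / s)"

lemma heat_barrier_pos [simp]: "heat_barrier p K a b s > 0"
  by (simp add: heat_barrier_def)

lemma DERIV_heat_barrier:
  assumes "r + c > 0"
  shows "((\<lambda>r. heat_barrier p K a b (r + c)) has_real_derivative
     heat_barrier p K a b (r + c) * (- p / (r + c) + K + b / (r + c)\<^sup>2)) (at r)"
proof -
  have "((\<lambda>r. a - p * ln (r + c) + K * (r + c) - b / (r + c)) has_real_derivative
     (- p / (r + c) + K + b / (r + c)\<^sup>2)) (at r)"
    using assms by (auto intro!: derivative_eq_intros simp: power2_eq_square)
  from DERIV_fun_exp[OF this] show ?thesis
    unfolding heat_barrier_def by simp
qed

lemma continuous_on_heat_barrier:
  fixes f g h :: "'a :: topological_space \<Rightarrow> real"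
  assumes "continuous_on S f" "continuous_on S g" "continuous_on S h" "\<And>x. x \<in> S \<Longrightarrow> h x > 0"
  shows "continuous_on S (\<lambda>x. heat_barrier p K (f x) (g x) (h x))"
  unfolding heat_barrier_def using assms by (intro continuous_intros) (auto simp: less_imp_neq[symmetric])

context
  fixes l C :: real
  assumes l: "l \<ge> 0" and C: "C \<ge> 1"
    and moment_le: "\<And>n. n > 0 \<Longrightarrow> 1 / gegen_moment l 0 n \<le> C * real n powr (l + 1)"
    and moment_ge: "\<And>n. n > 0 \<Longrightarrow> real n powr (l + 1) \<le> C * (1 / gegen_moment l 0 n)"
begin

text \<open>At time 1 / N the factor s^(-(l + 1)) is N^(l + 1), the size of the reciprocal mass, and
  exp (- e / s) is the N-th power of exp (- e).\<close>

lemma approx_sol_0_le: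
  assumes "N > 0" "0 \<le> y" "(1 + w) / 2 = y" "y \<le> exp (- e)"
  shows "poly (approx_sol l N 0) w \<le> heat_barrier (l + 1) 0 (ln C) e (1 / real N)"
proof -
  have "y ^ N \<le> exp (- e) ^ N" using assms by (intro power_mono) auto
  also have "\<dots> = exp (- e * real N)" by (simp add: exp_of_nat_mult[symmetric] mult.commute)
  finally have "y ^ N \<le> exp (- e * real N)" .
  then have "1 / gegen_moment l 0 N * y ^ N \<le> C * real N powr (l + 1) * exp (- e * real N)"
    using moment_le[OF \<open>N > 0\<close>] gegen_moment_0_pos[OF l, of N] assms C by (intro mult_mono) auto
  also have "\<dots> = heat_barrier (l + 1) 0 (ln C) e (1 / real N)"
    using C \<open>N > 0\<close> by (simp add: heat_barrier_def powr_def exp_diff exp_add ln_div exp_minus field_simps)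
  finally show ?thesis using l assms by (simp add: poly_approx_sol_0)
qed

text \<open>The exponent (1 - w) / 2 = sin^2 (\<phi> / 2) is smaller than \<phi>^2 / 4 but linear in
  w, so no cotangent appears and the barrier works up to w = -1. It supplies summability of the
  kernel and the lateral boundary values for the sharp bound.\<close>

lemma approx_sol_crude_bound:
  assumes K: "K \<ge> (l + 1)\<^sup>2 + 1" and N: "N > 0" and "t \<ge> 0" "\<bar>w\<bar> \<le> 1"
  shows "poly (approx_sol l N t) w < heat_barrier (l + 1) K (ln (C + 1)) ((1 - w) / 2) (t + 1 / real N)"
proof -
  define G where "G t w = heat_barrier (l + 1) K (ln (C + 1)) ((1 - w) / 2) (t + 1 / real N)" for t w
  have N0: "1 / real N > 0" using N by simp
  have "K > 0" using K by (smt (verit) zero_le_power2)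
  have "poly (approx_sol l N t) w - G t w < 0"
  proof (rule first_touching_time[where T = t and X = "{-1..1}" and W = "\<lambda>t w. poly (approx_sol l N t) w - G t w"])
    show "continuous_on ({0..t} \<times> {- 1..1}) (\<lambda>(t, w). poly (approx_sol l N t) w - G t w)"
      unfolding G_def case_prod_unfold using N0
      by (intro continuous_intros continuous_on_approx_sol continuous_on_heat_barrier) (auto intro: add_nonneg_pos)
  next
    fix x :: real assume x: "x \<in> {-1..1}"
    have "(1 + x) / 2 \<le> exp (- ((1 - x) / 2))"
      using exp_ge_add_one_self[of "- ((1 - x) / 2)"] by (simp add: field_simps)
    then have "poly (approx_sol l N 0) x \<le> heat_barrier (l + 1) 0 (ln C) ((1 - x) / 2) (1 / real N)"
      using N x by (intro approx_sol_0_le[where y = "(1 + x) / 2"]) auto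
    also have "\<dots> < G 0 x"
    proof -
      have "ln C < ln (C + 1)" "K * (1 / real N) > 0" using C mult_pos_pos[OF \<open>K > 0\<close> N0] by auto
      then show ?thesis by (simp add: G_def heat_barrier_def)
    qed
    finally show "poly (approx_sol l N 0) x - G 0 x < 0" by simp
  next
    fix r x assume r: "0 < r" "x \<in> {-1..1}" and eq: "poly (approx_sol l N r) x - G r x = 0"
      and max: "\<forall>z\<in>{-1..1}. poly (approx_sol l N r) z - G r z \<le> 0"
    define P where "P = approx_sol l N r"
    define s where "s = r + 1 / real N"
    have s: "s > 0" using add_pos_pos[OF r(1) N0] by (simp add: s_def)
    define E where "E = G r x"
    have "E > 0" by (simp add: E_def G_def)
    have d1: "((\<lambda>w. poly P w - G r w) has_real_derivative
       (poly (pderiv P) w - G r w / (2 * s))) (at w)" for w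
      unfolding G_def s_def[symmetric] heat_barrier_def using s by (auto intro!: derivative_eq_intros)
    have d2: "((\<lambda>w. poly (pderiv P) w - G r w / (2 * s)) has_real_derivative
       (poly (pderiv (pderiv P)) x - E / (2 * s) / (2 * s))) (at x)"
      unfolding E_def G_def s_def[symmetric] heat_barrier_def using s by (auto intro!: derivative_eq_intros)
    have "(1 - x\<^sup>2) * (poly (pderiv (pderiv P)) x - E / (2 * s) / (2 * s))
        - 2 * (l + 1) * x * (poly (pderiv P) x - E / (2 * s)) \<le> 0"
      using max_gegen_interval[OF d1 d2, of "2 * (l + 1)"] r max eq l
      by (auto simp: abs_le_iff P_def E_def)
    then have Lu: "poly (gegen_op l P) x \<le> E * ((1 - x\<^sup>2) / (4 * s\<^sup>2) - (l + 1) * x / s)"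
      using s by (simp add: poly_gegen_op field_simps power2_eq_square)
    have "((\<lambda>r. poly (approx_sol l N r) x - G r x) has_real_derivative
       (poly (gegen_op l P) x - E * (- (l + 1) / s + K + (1 - x) / (2 * s\<^sup>2)))) (at r)"
    proof -
      have "(1 - x) / 2 / s\<^sup>2 = (1 - x) / (2 * s\<^sup>2)" by simp
      then show ?thesis
        using DERIV_diff[OF approx_sol_heat_equation DERIV_heat_barrier[of r "1 / real N" "l + 1" K "ln (C + 1)" "(1 - x) / 2"]] s
        unfolding P_def E_def G_def s_def by simp
    qed
    moreover have "poly (gegen_op l P) x - E * (- (l + 1) / s + K + (1 - x) / (2 * s\<^sup>2)) < 0"
    proof -
      \<comment> \<open>The square completes in (1 - x) / (2 s): this is the origin of the lower
        bound on \<open>K\<close>.\<close>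
      have "(1 - x\<^sup>2) / (4 * s\<^sup>2) - (l + 1) * x / s - (- (l + 1) / s + K + (1 - x) / (2 * s\<^sup>2))
         = (l + 1)\<^sup>2 - K - ((1 - x) / (2 * s) - (l + 1))\<^sup>2"
        using s by (simp add: field_simps power2_eq_square)
      also have "\<dots> < 0" using K by (smt (verit) zero_le_power2)
      finally have "E * ((1 - x\<^sup>2) / (4 * s\<^sup>2) - (l + 1) * x / s - (- (l + 1) / s + K + (1 - x) / (2 * s\<^sup>2))) < 0"
        using \<open>E > 0\<close> by (simp add: mult_pos_neg)
      with Lu show ?thesis by (simp add: right_diff_distrib)
    qed
    ultimately show "\<exists>D<0. ((\<lambda>r. poly (approx_sol l N r) x - G r x) has_real_derivative D) (at r)"
      by blast
  qed (use assms in \<open>auto simp: abs_le_iff\<close>)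
  then show ?thesis by (simp add: G_def)
qed

text \<open>Differentiating exp (k - k cos y) against the Gaussian yields - k y sin y / s, which
  with k = 8 (l + 1/2) dominates the error (l + 1/2) (1 - y cot y) / s; the remaining terms in k are
  bounded and go into \<open>K\<close>. The second summand, constant in space, matches the crude
  bound at the ends of the interval and keeps touching points away from them.\<close>

lemma approx_sol_upper_bound:
  defines "k \<equiv> 8 * (l + 1/2)"
  assumes K: "K \<ge> (l + 1)\<^sup>2 + (2 * l + 2) * k + k\<^sup>2 + 1" and N: "N > 0" and "t \<ge> 0"
    and \<phi>: "\<bar>\<phi>\<bar> \<le> 2 * pi / 3"
  shows "poly (approx_sol l N t) (cos \<phi>) <
    heat_barrier (l + 1) K (ln (C + 1) + k - k * cos \<phi>) (\<phi>\<^sup>2 / 4) (t + 1 / real N)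
    + heat_barrier (l + 1) K (ln (C + 1)) (3 / 4) (t + 1 / real N)"
proof -
  define G where "G t y = heat_barrier (l + 1) K (ln (C + 1) + k - k * cos y) (y\<^sup>2 / 4) (t + 1 / real N)" for t y
  define H where "H t = heat_barrier (l + 1) K (ln (C + 1)) (3 / 4) (t + 1 / real N)" for t
  have Gpos: "G t y > 0" "H t > 0" for t y
    by (simp_all add: G_def H_def)
  have N0: "1 / real N > 0" using N by simp
  have k: "k > 0" using l by (simp add: k_def)
  have K': "K > (l + 1)\<^sup>2" and K'': "K > (2 * l + 2) * k + k\<^sup>2" and K1: "K \<ge> (l + 1)\<^sup>2 + 1"
    using K l k zero_le_power2[of "l + 1"] zero_le_power2[of k] mult_nonneg_nonneg[of "2 * l + 2" k] by linarith+
  have "K > 0" using K' zero_le_power2[of "l + 1"] by linarith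
  let ?b = "2 * pi / 3"
  have c120: "cos ?b = - 1 / 2" by (simp add: cos_120)
  have "poly (approx_sol l N t) (cos \<phi>) - (G t \<phi> + H t) < 0"
  proof (rule first_touching_time[where T = t and X = "{-?b..?b}"
        and W = "\<lambda>t y. poly (approx_sol l N t) (cos y) - (G t y + H t)"])
    show "continuous_on ({0..t} \<times> {-?b..?b}) (\<lambda>(t, y). poly (approx_sol l N t) (cos y) - (G t y + H t))"
      unfolding G_def H_def case_prod_unfold using N0
      by (intro continuous_intros continuous_on_approx_sol continuous_on_heat_barrier) (auto intro: add_nonneg_pos)
  next
    fix y :: real assume y: "y \<in> {-?b..?b}"
    have y2: "\<bar>y / 2\<bar> \<le> pi / 2" using y pi_gt_zero by auto
    then have "cos (y / 2) \<ge> 0" by (intro cos_ge_zero) auto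
    moreover have "cos (y / 2) \<le> exp (- (y / 2)\<^sup>2 / 2)" using y2 by (rule cos_le_exp)
    ultimately have "(cos (y / 2))\<^sup>2 \<le> (exp (- (y / 2)\<^sup>2 / 2))\<^sup>2" by (intro power_mono)
    also have "\<dots> = exp (- (y\<^sup>2 / 4))"
      by (simp add: power_divide flip: exp_double)
    finally have "(cos (y / 2))\<^sup>2 \<le> exp (- (y\<^sup>2 / 4))" .
    moreover have "(1 + cos y) / 2 = (cos (y / 2))\<^sup>2"
      using cos_double_cos[of "y / 2"] by simp
    ultimately have "poly (approx_sol l N 0) (cos y) \<le> heat_barrier (l + 1) 0 (ln C) (y\<^sup>2 / 4) (1 / real N)"
      using N by (intro approx_sol_0_le[where y = "(cos (y / 2))\<^sup>2"]) auto
    also have "\<dots> < G 0 y"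
    proof -
      have "ln C < ln (C + 1)" "K * (1 / real N) > 0" "k * cos y \<le> k * 1"
        using C k mult_pos_pos[OF \<open>K > 0\<close> N0] by (auto intro!: mult_left_mono)
      then show ?thesis by (simp add: G_def heat_barrier_def)
    qed
    also have "\<dots> \<le> G 0 y + H 0" using Gpos(2)[of 0] by simp
    finally show "poly (approx_sol l N 0) (cos y) - (G 0 y + H 0) < 0" by simp
  next
    fix r y assume r: "0 < r" "y \<in> {-?b..?b}"
      and eq: "poly (approx_sol l N r) (cos y) - (G r y + H r) = 0"
      and max: "\<forall>z\<in>{-?b..?b}. poly (approx_sol l N r) (cos z) - (G r z + H r) \<le> 0"
    define P where "P = approx_sol l N r"
    define s where "s = r + 1 / real N"
    have s: "s > 0" using add_pos_pos[OF r(1) N0] by (simp add: s_def)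
    \<comment> \<open>There the cosine is -1/2 and the crude barrier is exactly \<open>H r\<close>,
      so touching would make \<open>G r y\<close> negative.\<close>
    have "\<bar>y\<bar> \<noteq> ?b"
    proof
      assume "\<bar>y\<bar> = ?b"
      then have "cos y = - 1 / 2" using c120 by (metis cos_abs_real)
      then have "poly (approx_sol l N r) (cos y) < H r"
        using approx_sol_crude_bound[OF K1 N, of r "cos y"] r by (simp add: H_def)
      then show False using eq Gpos(1)[of r y] by linarith
    qed
    then have y: "\<bar>y\<bar> < ?b" using r by auto
    define E where "E = G r y"
    define F where "F = H r"
    have "E > 0" "F > 0" by (simp_all add: E_def F_def Gpos)
    define S' where "S' z = G r z * (k * sin z - z / (2 * s))" for z
    define S'' where "S'' = E * ((k * cos y - 1 / (2 * s)) + (k * sin y - y / (2 * s))\<^sup>2)"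
    have d1: "((\<lambda>z. G r z + H r) has_real_derivative S' z) (at z)" for z
      unfolding G_def S'_def s_def[symmetric] heat_barrier_def using s by (auto intro!: derivative_eq_intros)
    have d0: "((\<lambda>z. G r z) has_real_derivative S' z) (at z)" for z
      using DERIV_diff[OF d1[of z] DERIV_const[of "H r"]] by simp
    have d2: "(S' has_real_derivative S'') (at y)"
    proof -
      have "((\<lambda>z. k * sin z - z / (2 * s)) has_real_derivative (k * cos y - 1 / (2 * s))) (at y)"
        using s by (auto intro!: derivative_eq_intros)
      from DERIV_mult[OF d0[of y] this] show ?thesis
        unfolding S'_def[abs_def] S''_def E_def by (simp add: algebra_simps power2_eq_square)
    qed
    have Lu: "poly (gegen_op l P) (cos y) \<le>
        (if y = 0 then (2 * l + 2) * S'' else S'' + (2 * l + 1) * (cos y / sin y) * S' y)"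
    proof (rule local_max_gegen_cos[OF l d1 d2])
      show "?b - \<bar>y\<bar> > 0" using y by simp
      show "poly P (cos z) - (G r z + H r) \<le> poly P (cos y) - (G r y + H r)"
        if "\<bar>y - z\<bar> < ?b - \<bar>y\<bar>" for z
      proof -
        have "z \<in> {-?b..?b}" using that by auto
        with max eq show ?thesis by (simp add: P_def)
      qed
      show "\<bar>y\<bar> < pi" using y pi_gt_zero by linarith
    qed
    have "((\<lambda>r. poly (approx_sol l N r) (cos y) - (G r y + H r)) has_real_derivative
       (poly (gegen_op l P) (cos y) - (E * (- (l + 1) / s + K + y\<^sup>2 / (4 * s\<^sup>2))
          + F * (- (l + 1) / s + K + 3 / (4 * s\<^sup>2))))) (at r)"
      using DERIV_diff[OF approx_sol_heat_equation DERIV_add[OF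
          DERIV_heat_barrier[of r "1 / real N" "l + 1" K "ln (C + 1) + k - k * cos y" "y\<^sup>2 / 4"]
          DERIV_heat_barrier[of r "1 / real N" "l + 1" K "ln (C + 1)" "3 / 4"]]] s
      unfolding P_def E_def F_def G_def H_def s_def by simp
    moreover have neg: "- (l + 1) / s = - ((l + 1) / s)" by (simp only: minus_divide_left)
    moreover have "poly (gegen_op l P) (cos y) < E * (- (l + 1) / s + K + y\<^sup>2 / (4 * s\<^sup>2))"
    proof (cases "y = 0")
      case True
      have "(2 * l + 2) * S'' = E * ((2 * l + 2) * k - (l + 1) / s)"
        using s True by (simp add: S''_def field_simps)
      also have "\<dots> < E * (- (l + 1) / s + K)"
        using \<open>E > 0\<close> K'' zero_le_power2[of k] unfolding neg
        by (intro mult_strict_left_mono) linarith+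
      finally show ?thesis using Lu True by simp
    next
      case False
      have "(l + 1/2) * (1 - y * (cos y / sin y)) \<le> (l + 1/2) * (8 * (y * sin y))"
        using one_minus_x_cot_le[of y] y False l by (intro mult_left_mono) auto
      then have "((l + 1/2) * (1 - y * (cos y / sin y)) - k * (y * sin y)) / s \<le> 0"
      proof (intro divide_nonpos_pos)
        have "k * (y * sin y) = (l + 1/2) * (8 * (y * sin y))" by (simp only: k_def mult_ac)
        with \<open>(l + 1/2) * (1 - y * (cos y / sin y)) \<le> (l + 1/2) * (8 * (y * sin y))\<close>
        show "(l + 1/2) * (1 - y * (cos y / sin y)) - k * (y * sin y) \<le> 0" by linarith
      qed (rule s)
      moreover have "sin y \<noteq> 0" using False y by (simp add: sin_zero_pi_iff)
      then have "S'' + (2 * l + 1) * (cos y / sin y) * S' y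
         = E * ((2 * l + 2) * k * cos y + k\<^sup>2 * (sin y)\<^sup>2 - (l + 1) / s + y\<^sup>2 / (4 * s\<^sup>2)
            + ((l + 1/2) * (1 - y * (cos y / sin y)) - k * (y * sin y)) / s)"
        using s unfolding S''_def S'_def E_def[symmetric]
        by (simp add: field_simps power2_eq_square)
      moreover have "(2 * l + 2) * k * cos y + k\<^sup>2 * (sin y)\<^sup>2 < K"
      proof -
        have "(2 * l + 2) * k * cos y \<le> (2 * l + 2) * k * 1"
          using l k by (intro mult_left_mono) auto
        moreover have "k\<^sup>2 * (sin y)\<^sup>2 \<le> k\<^sup>2 * 1"
          by (intro mult_left_mono) (auto simp: abs_square_le_1)
        ultimately show ?thesis using K'' by linarith
      qed
      ultimately have "S'' + (2 * l + 1) * (cos y / sin y) * S' y < E * (- (l + 1) / s + K + y\<^sup>2 / (4 * s\<^sup>2))"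
        using \<open>E > 0\<close> unfolding neg by (simp only:) (intro mult_strict_left_mono, linarith+)
      then show ?thesis using Lu False by simp
    qed
    \<comment> \<open>The spatially constant summand is a strict supersolution as soon as it
      increases in time; a completed square shows this.\<close>
    moreover have "F * (- (l + 1) / s + K + 3 / (4 * s\<^sup>2)) > 0"
    proof -
      have "(- (l + 1) / s + K + 3 / (4 * s\<^sup>2)) = (K - (l + 1)\<^sup>2) + ((l + 1) - 1 / (2 * s))\<^sup>2 + 2 / (4 * s\<^sup>2)"
        using s by (simp add: field_simps power2_eq_square)
      also have "\<dots> > 0" using s K' by (intro add_pos_pos add_pos_nonneg) auto
      finally show ?thesis using \<open>F > 0\<close> by simp
    qed
    ultimately show "\<exists>D<0. ((\<lambda>r. poly (approx_sol l N r) (cos y) - (G r y + H r)) has_real_derivative D) (at r)"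
      by (smt (verit))
  qed (use assms in \<open>auto simp: abs_le_iff\<close>)
  then show ?thesis by (simp add: G_def H_def)
qed


text \<open>The kink of \<open>\<phi>\<^sup>2\<close> at \<open>\<phi> = \<pi>\<close> cannot be a touching point from below, since the barrier has
  negative slope there while the solution, being a function of \<open>cos \<phi>\<close>, has slope 0.\<close>

lemma approx_sol_lower_bound:
  assumes N: "N > 0" and "t \<ge> 0" and \<phi>: "\<bar>\<phi>\<bar> \<le> pi"
  shows "heat_barrier (l + 1) (-1) (- ln C - (l + 1) * ln 2) (\<phi>\<^sup>2 / 4) (t + 1 / (2 * real N))
    < poly (approx_sol l N t) (cos \<phi>) + real N powr (l + 1) * exp (- 2 * real N)"
proof -
  define G where "G t y = heat_barrier (l + 1) (-1) (- ln C - (l + 1) * ln 2) (y\<^sup>2 / 4) (t + 1 / (2 * real N))" for t y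
  define \<epsilon> where "\<epsilon> = real N powr (l + 1) * exp (- 2 * real N)"
  have \<epsilon>: "\<epsilon> \<ge> 0" by (simp add: \<epsilon>_def)
  have N0: "1 / (2 * real N) > 0" using N by simp
  have Gpos: "G t y > 0" for t y by (simp add: G_def)
  have "G t \<phi> - poly (approx_sol l N t) (cos \<phi>) - \<epsilon> < 0"
  proof (rule first_touching_time[where T = t and X = "{-pi..pi}"
        and W = "\<lambda>t y. G t y - poly (approx_sol l N t) (cos y) - \<epsilon>"])
    show "continuous_on ({0..t} \<times> {-pi..pi}) (\<lambda>(t, y). G t y - poly (approx_sol l N t) (cos y) - \<epsilon>)"
      unfolding G_def case_prod_unfold using N0
      by (intro continuous_intros continuous_on_approx_sol continuous_on_heat_barrier) (auto intro: add_nonneg_pos)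
  next
    fix y :: real assume y: "y \<in> {-pi..pi}"
    define D where "D = real N powr (l + 1) / C"
    have D: "D > 0" "D \<le> real N powr (l + 1)" using C N by (auto simp: D_def divide_le_eq mult_le_cancel_left1)
    have "G 0 y = D * exp (- (y\<^sup>2 / 2 * real N)) * exp (- (1 / (2 * real N)))"
    proof -
      \<comment> \<open>The starting time 1 / (2 N) contributes (2 N)^(l + 1); the summand - (l + 1)
        ln 2 in the prefactor removes the excess power of 2.\<close>
      have h: "ln (1 / (2 * real N)) = - ln 2 - ln (real N)" using N by (simp add: ln_div ln_mult)
      have "G 0 y = exp (- ln C + (l + 1) * ln (real N) - y\<^sup>2 / 2 * real N - 1 / (2 * real N))"
        by (simp only: G_def heat_barrier_def add_0 h) (simp add: algebra_simps)
      also have "\<dots> = D * exp (- (y\<^sup>2 / 2 * real N)) * exp (- (1 / (2 * real N)))"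
      proof -
        have "D = exp (- ln C + (l + 1) * ln (real N))"
          using C N by (simp add: D_def powr_def exp_diff)
        then show ?thesis by (simp flip: exp_add)
      qed
      finally show ?thesis .
    qed
    also have "\<dots> < D * exp (- (y\<^sup>2 / 2 * real N)) * 1"
      using D N by (intro mult_strict_left_mono) auto
    also have "D * exp (- (y\<^sup>2 / 2 * real N)) \<le> poly (approx_sol l N 0) (cos y) + \<epsilon>"
    proof -
      have eq: "poly (approx_sol l N 0) (cos y) = 1 / gegen_moment l 0 N * (cos (y / 2))\<^sup>2 ^ N"
        using cos_double_cos[of "y / 2"] l by (simp add: poly_approx_sol_0)
      have D': "D \<le> 1 / gegen_moment l 0 N"
        using moment_ge[OF N] C by (simp add: D_def field_simps)
      show ?thesis
      proof (cases "\<bar>y\<bar> \<le> 2")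
        case True
        then have "exp (- (y / 2)\<^sup>2) \<le> cos (y / 2)" by (intro exp_le_cos) auto
        then have "exp (- (y / 2)\<^sup>2) ^ 2 \<le> (cos (y / 2))\<^sup>2" by (intro power_mono) auto
        also have "exp (- (y / 2)\<^sup>2) ^ 2 = exp (- (y\<^sup>2 / 2))"
          by (simp add: power_divide flip: exp_double)
        finally have "exp (- (y\<^sup>2 / 2)) ^ N \<le> (cos (y / 2))\<^sup>2 ^ N" by (intro power_mono) auto
        moreover have "exp (- (y\<^sup>2 / 2)) ^ N = exp (- (y\<^sup>2 / 2 * real N))"
          by (simp add: exp_of_nat_mult[symmetric] mult.commute)
        ultimately have "D * exp (- (y\<^sup>2 / 2 * real N)) \<le> 1 / gegen_moment l 0 N * (cos (y / 2))\<^sup>2 ^ N"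
          using D D' gegen_moment_0_pos[OF l, of N] by (intro mult_mono) auto
        then show ?thesis using \<epsilon> eq by simp
      next
        case False
        then have "2\<^sup>2 \<le> \<bar>y\<bar>\<^sup>2" by (intro power_mono) auto
        then have "2 * real N \<le> y\<^sup>2 / 2 * real N" by (intro mult_right_mono) auto
        then have "D * exp (- (y\<^sup>2 / 2 * real N)) \<le> \<epsilon>"
          unfolding \<epsilon>_def using D by (intro mult_mono) auto
        moreover have "poly (approx_sol l N 0) (cos y) \<ge> 0"
          unfolding eq using gegen_moment_0_pos[OF l, of N] by auto
        ultimately show ?thesis by simp
      qed
    qed
    finally show "G 0 y - poly (approx_sol l N 0) (cos y) - \<epsilon> < 0" by simp
  next
    fix r y assume r: "0 < r" "y \<in> {-pi..pi}"
      and eq: "G r y - poly (approx_sol l N r) (cos y) - \<epsilon> = 0"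
      and max: "\<forall>z\<in>{-pi..pi}. G r z - poly (approx_sol l N r) (cos z) - \<epsilon> \<le> 0"
    \<comment> \<open>The sign change turns contact from below into a maximum, so that
      \<open>local_max_gegen_cos\<close> applies.\<close>
    define P where "P = smult (-1) (approx_sol l N r)"
    define s where "s = r + 1 / (2 * real N)"
    have s: "s > 0" using add_pos_pos[OF r(1) N0] by (simp add: s_def)
    define S' where "S' z = G r z * (- z / (2 * s))" for z
    define E where "E = G r y"
    have "E > 0" by (simp add: E_def Gpos)
    have d0: "((\<lambda>z. G r z) has_real_derivative S' z) (at z)" for z
      unfolding G_def S'_def s_def[symmetric] heat_barrier_def using s by (auto intro!: derivative_eq_intros)
    have y: "\<bar>y\<bar> \<noteq> pi"
    proof
      assume ypi: "\<bar>y\<bar> = pi"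
      have d: "((\<lambda>z. G r z - poly (approx_sol l N r) (cos z)) has_real_derivative S' pi) (at pi)"
        by (rule derivative_eq_intros d0 DERIV_chain2[OF poly_DERIV] refl | simp)+
      have "S' pi < 0" using s Gpos[of r pi] pi_gt_zero by (simp add: S'_def mult_neg_pos divide_neg_pos mult_pos_neg)
      then obtain e where e: "e > 0" "\<And>h. 0 < h \<Longrightarrow> h < e \<Longrightarrow>
          G r pi - poly (approx_sol l N r) (cos pi) < G r (pi - h) - poly (approx_sol l N r) (cos (pi - h))"
        using DERIV_neg_dec_left[OF d] by blast
      define h where "h = min (e / 2) pi"
      have h: "0 < h" "h < e" "pi - h \<in> {-pi..pi}" using e(1) pi_gt_zero by (auto simp: h_def min_def)
      have "G r pi - poly (approx_sol l N r) (cos pi) = \<epsilon>"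
      proof -
        have "y = pi \<or> y = - pi" using ypi by linarith
        then show ?thesis using eq by (auto simp: G_def)
      qed
      moreover have "G r (pi - h) - poly (approx_sol l N r) (cos (pi - h)) - \<epsilon> \<le> 0"
        using max h(3) by blast
      ultimately show False using e(2)[OF h(1,2)] by linarith
    qed
    define S'' where "S'' = E * (- 1 / (2 * s) + (y / (2 * s))\<^sup>2)"
    have d1: "((\<lambda>z. - G r z) has_real_derivative - S' z) (at z)" for z
      using DERIV_minus[OF d0[of z]] by simp
    have d2: "((\<lambda>z. - S' z) has_real_derivative - S'') (at y)"
    proof -
      have "((\<lambda>z. - z / (2 * s)) has_real_derivative (- 1 / (2 * s))) (at y)"
        using s by (auto intro!: derivative_eq_intros)
      from DERIV_minus[OF DERIV_mult[OF d0[of y] this]] show ?thesis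
        unfolding S'_def[abs_def] S''_def E_def by (simp add: algebra_simps power2_eq_square)
    qed
    have "poly (gegen_op l P) (cos y) \<le>
        (if y = 0 then (2 * l + 2) * (- S'') else (- S'') + (2 * l + 1) * (cos y / sin y) * (- S' y))"
    proof (rule local_max_gegen_cos[OF l d1 d2])
      show "pi - \<bar>y\<bar> > 0" using y r by auto
      show "poly P (cos z) - (- G r z) \<le> poly P (cos y) - (- G r y)"
        if "\<bar>y - z\<bar> < pi - \<bar>y\<bar>" for z
      proof -
        have "z \<in> {-pi..pi}" using that by auto
        with max eq show ?thesis by (simp add: P_def)
      qed
      show "\<bar>y\<bar> < pi" using y r by auto
    qed
    then have Lu: "poly (gegen_op l (approx_sol l N r)) (cos y) \<ge>
        (if y = 0 then (2 * l + 2) * S'' else S'' + (2 * l + 1) * (cos y / sin y) * S' y)"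
      unfolding P_def gegen_op_smult by (simp split: if_splits)
    have "((\<lambda>r. G r y - poly (approx_sol l N r) (cos y) - \<epsilon>) has_real_derivative
       (E * (- (l + 1) / s + (-1) + y\<^sup>2 / (4 * s\<^sup>2)) - poly (gegen_op l (approx_sol l N r)) (cos y))) (at r)"
      using DERIV_diff[OF DERIV_diff[OF
          DERIV_heat_barrier[of r "1 / (2 * real N)" "l + 1" "-1" "- ln C - (l + 1) * ln 2" "y\<^sup>2 / 4"]
          approx_sol_heat_equation] DERIV_const] s
      unfolding E_def G_def s_def by simp
    moreover have "(if y = 0 then (2 * l + 2) * S'' else S'' + (2 * l + 1) * (cos y / sin y) * S' y)
        > E * (- (l + 1) / s + (-1) + y\<^sup>2 / (4 * s\<^sup>2))"
    proof (cases "y = 0")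
      case True
      have "(2 * l + 2) * S'' = E * (- (l + 1) / s)"
        using s True by (simp add: S''_def field_simps)
      with True \<open>E > 0\<close> show ?thesis by (simp add: algebra_simps)
    next
      case False
      have yp: "\<bar>y\<bar> < pi" using y r by auto
      have "sin y \<noteq> 0" using False yp by (simp add: sin_zero_pi_iff)
      then have "S'' + (2 * l + 1) * (cos y / sin y) * S' y
         = E * (- (l + 1) / s + y\<^sup>2 / (4 * s\<^sup>2) + (l + 1/2) * (1 - y * (cos y / sin y)) / s)"
        using s unfolding S''_def S'_def E_def[symmetric]
        by (simp add: field_simps power2_eq_square)
      \<comment> \<open>Here the error has the favourable sign on all of (-\<pi>, \<pi>), so no
        correcting factor is needed; K = -1 merely makes the inequality strict.\<close>
      moreover have "(l + 1/2) * (1 - y * (cos y / sin y)) / s \<ge> 0"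
        using x_cot_le_1[OF yp False] l s by (intro divide_nonneg_pos mult_nonneg_nonneg) auto
      then have "E * (- (l + 1) / s + (-1) + y\<^sup>2 / (4 * s\<^sup>2)) <
         E * (- (l + 1) / s + y\<^sup>2 / (4 * s\<^sup>2) + (l + 1/2) * (1 - y * (cos y / sin y)) / s)"
        using \<open>E > 0\<close> by (intro mult_strict_left_mono) linarith+
      ultimately show ?thesis using False by simp
    qed
    ultimately show "\<exists>D<0. ((\<lambda>r. G r y - poly (approx_sol l N r) (cos y) - \<epsilon>) has_real_derivative D) (at r)"
      using Lu less_le_trans diff_less_0_iff_less by blast
  qed (use assms in \<open>auto simp: abs_le_iff\<close>)
  then show ?thesis by (simp add: G_def \<epsilon>_def)
qed

end

subsection \<open>The Gegenbauer heat kernel\<close>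

definition gegen_heat :: "real \<Rightarrow> real \<Rightarrow> real \<Rightarrow> real" where
  "gegen_heat l t w = (\<Sum>m. exp (- t * gegen_ev l m) * (gegen_zeta l m * poly (gegen_poly l m) w))"

lemma heat_barrier_eq:
  "s > 0 \<Longrightarrow> heat_barrier p K a b s = exp a * exp (K * s) * s powr - p * exp (- b / s)"
  by (simp add: heat_barrier_def powr_def flip: exp_add)

lemma heat_barrier_tendsto:
  assumes "t > 0" "c > 0"
  shows "(\<lambda>N. heat_barrier p K a b (t + 1 / (c * real N))) \<longlonglongrightarrow> heat_barrier p K a b t"
proof -
  have "(\<lambda>N. 1 / (c * real N)) \<longlonglongrightarrow> 0"
    using assms by (intro real_tendsto_divide_at_top[OF tendsto_const]
        filterlim_tendsto_pos_mult_at_top[OF tendsto_const] filterlim_real_sequentially)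
  then have "(\<lambda>N. t + 1 / (c * real N)) \<longlonglongrightarrow> t"
    using tendsto_add[OF tendsto_const[of t]] by fastforce
  then show ?thesis
    unfolding heat_barrier_def using assms by (intro tendsto_intros) auto
qed

text \<open>At w = 1 all terms of the approximate solution are nonnegative, because
  \<open>gegen_mult l m N \<ge> 0\<close> for m \<le> N. Hence any fixed partial sum, weighted by
  the multipliers, lies below the barrier, and N may tend to infinity. This replaces growth
  estimates for \<open>gegen_zeta\<close>.\<close>

lemma summable_gegen_heat:
  assumes l: "l \<ge> 0" and t: "t > 0"
  shows "summable (\<lambda>m. exp (- t * gegen_ev l m) * gegen_zeta l m)"
proof -
  obtain C where C: "C \<ge> 1" "\<And>n. n > 0 \<Longrightarrow> 1 / gegen_moment l 0 n \<le> C * real n powr (l + 1)"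
    "\<And>n. n > 0 \<Longrightarrow> real n powr (l + 1) \<le> C * (1 / gegen_moment l 0 n)"
    using gegen_moment_0_bounds[OF l] by blast
  define K where "K = (l + 1)\<^sup>2 + 1"
  let ?f = "\<lambda>m. exp (- t * gegen_ev l m) * gegen_zeta l m"
  have nn: "?f m \<ge> 0" for m using gegen_zeta_pos[OF l, of m] by simp
  have bound: "(\<Sum>m\<le>M. ?f m) \<le> heat_barrier (l + 1) K (ln (C + 1)) 0 t" for M
  proof (rule LIMSEQ_le)
    show "(\<lambda>N. \<Sum>m\<le>M. gegen_mult l m N * ?f m) \<longlonglongrightarrow> (\<Sum>m\<le>M. ?f m)"
      using gegen_mult_tendsto_1[OF l] by (auto intro!: tendsto_eq_intros)
    show "(\<lambda>N. heat_barrier (l + 1) K (ln (C + 1)) 0 (t + 1 / (1 * real N)))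
        \<longlonglongrightarrow> heat_barrier (l + 1) K (ln (C + 1)) 0 t"
      using t by (intro heat_barrier_tendsto) auto
    have "(\<Sum>m\<le>M. gegen_mult l m N * ?f m) \<le> heat_barrier (l + 1) K (ln (C + 1)) 0 (t + 1 / (1 * real N))"
      if "N \<ge> Suc M" for N
    proof -
      have "(\<Sum>m\<le>M. gegen_mult l m N * ?f m) \<le> (\<Sum>m\<le>N. gegen_mult l m N * ?f m)"
        using that nn gegen_mult_nonneg[OF l] by (intro sum_mono2) auto
      also have "\<dots> = poly (approx_sol l N t) 1"
        using l by (simp add: poly_approx_sol)
      also have "\<dots> < heat_barrier (l + 1) K (ln (C + 1)) ((1 - 1) / 2) (t + 1 / real N)"
        using that t by (intro approx_sol_crude_bound[OF l C]) (auto simp: K_def)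
      finally show ?thesis by simp
    qed
    then show "\<exists>N0. \<forall>N\<ge>N0. (\<Sum>m\<le>M. gegen_mult l m N * ?f m) \<le> heat_barrier (l + 1) K (ln (C + 1)) 0 (t + 1 / (1 * real N))"
      by blast
  qed
  show ?thesis
  proof (rule summableI_nonneg_bounded[OF nn])
    show "sum ?f {..<n} \<le> heat_barrier (l + 1) K (ln (C + 1)) 0 t" for n
      using bound[of n] sum_mono2[of "{..n}" "{..<n}" ?f] nn by fastforce
  qed
qed

lemma summable_gegen_heat_abs:
  assumes l: "l \<ge> 0" and t: "t > 0" and w: "\<bar>w\<bar> \<le> 1"
  shows "summable (\<lambda>m. \<bar>exp (- t * gegen_ev l m) * (gegen_zeta l m * poly (gegen_poly l m) w)\<bar>)"
proof (rule summable_comparison_test'[OF summable_gegen_heat[OF l t]])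
  show "norm \<bar>exp (- t * gegen_ev l m) * (gegen_zeta l m * poly (gegen_poly l m) w)\<bar>
      \<le> exp (- t * gegen_ev l m) * gegen_zeta l m" for m
    using gegen_zeta_pos[OF l, of m] abs_gegen_poly_le_1[OF l w, of m]
    by (simp add: abs_mult mult_left_le)
qed

text \<open>Dominated convergence for series: the multipliers are bounded by 1 and tend to 1, and
  the series at w = 1 is a summable majorant.\<close>

lemma approx_sol_tendsto:
  assumes l: "l \<ge> 0" and t: "t > 0" and w: "\<bar>w\<bar> \<le> 1"
  shows "(\<lambda>N. poly (approx_sol l N t) w) \<longlonglongrightarrow> gegen_heat l t w"
proof -
  define b where "b m = exp (- t * gegen_ev l m) * (gegen_zeta l m * poly (gegen_poly l m) w)" for m
  define a where "a m N = (if m \<le> N then gegen_mult l m N * b m else 0)" for m N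
  have b: "\<bar>b m\<bar> \<le> exp (- t * gegen_ev l m) * gegen_zeta l m" for m
    using gegen_zeta_pos[OF l, of m] abs_gegen_poly_le_1[OF l w, of m]
    by (simp add: b_def abs_mult mult_left_le)
  have "(\<lambda>N. suminf (\<lambda>m. a m N)) \<longlonglongrightarrow> suminf b"
  proof (rule tannerys_theorem[THEN conjunct2, THEN conjunct2])
    show "(\<lambda>N. a m N) \<longlonglongrightarrow> b m" for m
    proof (rule Lim_transform_eventually)
      show "(\<lambda>N. gegen_mult l m N * b m) \<longlonglongrightarrow> b m"
        using gegen_mult_tendsto_1[OF l, of m] by (auto intro!: tendsto_eq_intros)
      show "\<forall>\<^sub>F N in sequentially. gegen_mult l m N * b m = a m N"
        using eventually_ge_at_top[of m] by eventually_elim (simp add: a_def)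
    qed
    have "norm (a m N) \<le> exp (- t * gegen_ev l m) * gegen_zeta l m" for m N
    proof -
      have "\<bar>gegen_mult l m N\<bar> * \<bar>b m\<bar> \<le> 1 * (exp (- t * gegen_ev l m) * gegen_zeta l m)"
        using b abs_gegen_mult_le_1[OF l] by (intro mult_mono) auto
      then show ?thesis
        using gegen_zeta_pos[OF l, of m] by (simp add: a_def abs_mult)
    qed
    then show "\<forall>\<^sub>F (m, N) in sequentially \<times>\<^sub>F sequentially. norm (a m N) \<le> exp (- t * gegen_ev l m) * gegen_zeta l m"
      by (intro always_eventually) auto
  qed (use summable_gegen_heat[OF l t] in auto)
  moreover have "suminf (\<lambda>m. a m N) = poly (approx_sol l N t) w" for N
  proof -
    have "suminf (\<lambda>m. a m N) = (\<Sum>m\<le>N. a m N)"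
      by (intro suminf_finite) (auto simp: a_def)
    then show ?thesis by (simp add: a_def b_def poly_approx_sol)
  qed
  moreover have "suminf b = gegen_heat l t w"
    unfolding gegen_heat_def b_def ..
  ultimately show ?thesis by simp
qed

text \<open>The limit of the barriers: the crude one for w \<le> -1/2, where (1 - w) / 2 \<ge> 3/4,
  and the sharp one otherwise.\<close>

lemma gegen_heat_upper_raw:
  assumes l: "l \<ge> 0"
  obtains C where "C \<ge> 1" "\<And>t w. 0 < t \<Longrightarrow> t \<le> 1 \<Longrightarrow> \<bar>w\<bar> \<le> 1 \<Longrightarrow>
    gegen_heat l t w \<le> C * t powr - (l + 1) * (exp (- (arccos w)\<^sup>2 / (4 * t)) + exp (- 3 / (4 * t)))"
proof -
  obtain C where C: "C \<ge> 1" "\<And>n. n > 0 \<Longrightarrow> 1 / gegen_moment l 0 n \<le> C * real n powr (l + 1)"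
    "\<And>n. n > 0 \<Longrightarrow> real n powr (l + 1) \<le> C * (1 / gegen_moment l 0 n)"
    using gegen_moment_0_bounds[OF l] by blast
  define k where "k = 8 * (l + 1/2)"
  define K where "K = (l + 1)\<^sup>2 + (2 * l + 2) * k + k\<^sup>2 + 1"
  have k: "k \<ge> 0" using l by (simp add: k_def)
  have K: "K \<ge> (l + 1)\<^sup>2 + 1" "K \<ge> 0"
    using l k by (auto simp: K_def)
  \<comment> \<open>For t \<le> 1 the factor exp (K t) is at most exp K, and k - k w is at most 2
    k.\<close>
  define D where "D = exp (ln (C + 1) + 2 * k) * exp K"
  have hb: "heat_barrier (l + 1) K a b t \<le> D * t powr - (l + 1) * exp (- b' / (4 * t))"
    if "0 < t" "t \<le> 1" "a \<le> ln (C + 1) + 2 * k" "b \<ge> b' / 4" for a b b' t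
  proof -
    have "- b / t \<le> - (b' / 4) / t" using that by (intro divide_right_mono) auto
    moreover have "K * t \<le> K" using K that by (simp add: mult_left_le)
    ultimately have "exp a * exp (K * t) * t powr - (l + 1) * exp (- b / t) \<le> D * t powr - (l + 1) * exp (- b' / (4 * t))"
      unfolding D_def using that by (intro mult_mono) auto
    then show ?thesis using that by (simp add: heat_barrier_eq)
  qed
  have crude: "gegen_heat l t w \<le> D * t powr - (l + 1) * exp (- 3 / (4 * t))"
    if "0 < t" "t \<le> 1" "\<bar>w\<bar> \<le> 1" "w \<le> - 1/2" for t w
  proof -
    have "gegen_heat l t w \<le> heat_barrier (l + 1) K (ln (C + 1)) ((1 - w) / 2) t"
    proof (rule LIMSEQ_le[OF approx_sol_tendsto heat_barrier_tendsto])
      show "\<exists>N0. \<forall>N\<ge>N0. poly (approx_sol l N t) w \<le> heat_barrier (l + 1) K (ln (C + 1)) ((1 - w) / 2) (t + 1 / (1 * real N))"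
        using approx_sol_crude_bound[OF l C K(1)] that by (intro exI[of _ 1]) (auto intro: less_imp_le)
    qed (use l that in auto)
    also have "\<dots> \<le> D * t powr - (l + 1) * exp (- 3 / (4 * t))"
      using that k by (intro hb) auto
    finally show ?thesis .
  qed
  have fine: "gegen_heat l t w \<le> D * t powr - (l + 1) * (exp (- (arccos w)\<^sup>2 / (4 * t)) + exp (- 3 / (4 * t)))"
    if "0 < t" "t \<le> 1" "\<bar>w\<bar> \<le> 1" "w \<ge> - 1/2" for t w
  proof -
    have "arccos w \<le> arccos (- 1/2)" using that by (intro arccos_le_arccos) auto
    also have "arccos (- 1/2) = 2 * pi / 3"
      using arccos_cos[of "2 * pi / 3"] pi_gt_zero by (simp add: cos_120)
    finally have \<phi>: "\<bar>arccos w\<bar> \<le> 2 * pi / 3" using that arccos_lbound[of w] by auto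
    have cw: "cos (arccos w) = w" using that by (intro cos_arccos) auto
    have "gegen_heat l t w \<le> heat_barrier (l + 1) K (ln (C + 1) + k - k * w) ((arccos w)\<^sup>2 / 4) t
        + heat_barrier (l + 1) K (ln (C + 1)) (3 / 4) t"
    proof (rule LIMSEQ_le[OF approx_sol_tendsto tendsto_add[OF heat_barrier_tendsto heat_barrier_tendsto]])
      show "\<exists>N0. \<forall>N\<ge>N0. poly (approx_sol l N t) w \<le>
           heat_barrier (l + 1) K (ln (C + 1) + k - k * w) ((arccos w)\<^sup>2 / 4) (t + 1 / (1 * real N))
           + heat_barrier (l + 1) K (ln (C + 1)) (3 / 4) (t + 1 / (1 * real N))"
        using approx_sol_upper_bound[OF l C, folded k_def, of K _ t "arccos w"] that \<phi>
        by (intro exI[of _ 1]) (auto intro!: less_imp_le simp: cw K_def)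
    qed (use l that in auto)
    also have "\<dots> \<le> D * t powr - (l + 1) * exp (- (arccos w)\<^sup>2 / (4 * t)) + D * t powr - (l + 1) * exp (- 3 / (4 * t))"
    proof (intro add_mono hb)
      have "k * (- 1) \<le> k * w" using k that by (intro mult_left_mono) auto
      then show "ln (C + 1) + k - k * w \<le> ln (C + 1) + 2 * k" by simp
    qed (use that k in auto)
    finally show ?thesis by (simp add: distrib_left)
  qed
  show thesis
  proof (rule that[of "max 1 D"])
    fix t w :: real assume tw: "0 < t" "t \<le> 1" "\<bar>w\<bar> \<le> 1"
    let ?e = "t powr - (l + 1) * (exp (- (arccos w)\<^sup>2 / (4 * t)) + exp (- 3 / (4 * t)))"
    have "D > 0" by (simp add: D_def)
    have "gegen_heat l t w \<le> D * ?e"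
    proof (cases "w \<ge> - 1/2")
      case True
      then show ?thesis using fine[OF tw] by (simp add: mult.assoc)
    next
      case False
      then have "gegen_heat l t w \<le> D * t powr - (l + 1) * exp (- 3 / (4 * t))"
        using tw by (intro crude) auto
      also have "\<dots> \<le> D * t powr - (l + 1) * (exp (- (arccos w)\<^sup>2 / (4 * t)) + exp (- 3 / (4 * t)))"
        using \<open>D > 0\<close> by (intro mult_left_mono) auto
      finally show ?thesis by (simp add: mult.assoc)
    qed
    also have "\<dots> \<le> max 1 D * ?e"
      by (intro mult_right_mono) auto
    finally show "gegen_heat l t w \<le> max 1 D * t powr - (l + 1) * (exp (- (arccos w)\<^sup>2 / (4 * t)) + exp (- 3 / (4 * t)))"
      by (simp add: mult.assoc)
  qed simp
qed

lemma gegen_heat_lower_raw: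
  assumes l: "l \<ge> 0"
  obtains c where "c > 0" "\<And>t w. 0 < t \<Longrightarrow> \<bar>w\<bar> \<le> 1 \<Longrightarrow>
    gegen_heat l t w \<ge> c * exp (- t) * t powr - (l + 1) * exp (- (arccos w)\<^sup>2 / (4 * t))"
proof -
  obtain C where C: "C \<ge> 1" "\<And>n. n > 0 \<Longrightarrow> 1 / gegen_moment l 0 n \<le> C * real n powr (l + 1)"
    "\<And>n. n > 0 \<Longrightarrow> real n powr (l + 1) \<le> C * (1 / gegen_moment l 0 n)"
    using gegen_moment_0_bounds[OF l] by blast
  define c where "c = exp (- ln C - (l + 1) * ln 2)"
  show thesis
  proof (rule that[of c])
    fix t w :: real assume tw: "0 < t" "\<bar>w\<bar> \<le> 1"
    have cw: "cos (arccos w) = w" using tw by (intro cos_arccos) auto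
    have \<phi>: "\<bar>arccos w\<bar> \<le> pi" using tw arccos_lbound[of w] arccos_ubound[of w] by auto
    have lim0: "(\<lambda>N. real N powr (l + 1) * exp (- 2 * real N)) \<longlonglongrightarrow> 0"
      by real_asymp
    have "heat_barrier (l + 1) (-1) (- ln C - (l + 1) * ln 2) ((arccos w)\<^sup>2 / 4) t \<le> gegen_heat l t w + 0"
    proof (rule LIMSEQ_le[OF heat_barrier_tendsto tendsto_add[OF approx_sol_tendsto lim0]])
      show "\<exists>N0. \<forall>N\<ge>N0. heat_barrier (l + 1) (- 1) (- ln C - (l + 1) * ln 2) ((arccos w)\<^sup>2 / 4) (t + 1 / (2 * real N))
          \<le> poly (approx_sol l N t) w + real N powr (l + 1) * exp (- 2 * real N)"
        using approx_sol_lower_bound[OF l C, of _ t "arccos w"] tw \<phi>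
        by (intro exI[of _ 1]) (auto intro!: less_imp_le simp: cw)
    qed (use l tw in auto)
    then show "gegen_heat l t w \<ge> c * exp (- t) * t powr - (l + 1) * exp (- (arccos w)\<^sup>2 / (4 * t))"
      using tw by (simp add: heat_barrier_eq c_def)
  qed (simp add: c_def)
qed

text \<open>The terms of the series change sign; positivity is read off from the Gaussian lower
  bound.\<close>

lemma gegen_heat_nonneg:
  assumes "l \<ge> 0" "t > 0" "\<bar>w\<bar> \<le> 1"
  shows "gegen_heat l t w \<ge> 0"
proof -
  obtain c where "c > 0" "\<And>t w. 0 < t \<Longrightarrow> \<bar>w\<bar> \<le> 1 \<Longrightarrow>
    gegen_heat l t w \<ge> c * exp (- t) * t powr - (l + 1) * exp (- (arccos w)\<^sup>2 / (4 * t))"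
    using gegen_heat_lower_raw[OF assms(1)] by blast
  moreover from this(1) have "c * exp (- t) * t powr - (l + 1) * exp (- (arccos w)\<^sup>2 / (4 * t)) \<ge> 0"
    by simp
  ultimately show ?thesis using assms by (meson order_trans)
qed

text \<open>The eigenvalues of positive degree are at least 1, so the kernel differs from its
  constant term 1 by at most exp (1 - t) B. This gives the upper bound for all t \<ge> 1, but a
  lower bound only for late times; in between, the Gaussian lower bound is used on a compact range
  of t.\<close>

lemma gegen_heat_large_time:
  assumes l: "l \<ge> 0"
  obtains C where "C \<ge> 1" "\<And>t w. 1 \<le> t \<Longrightarrow> \<bar>w\<bar> \<le> 1 \<Longrightarrow> 1 / C \<le> gegen_heat l t w \<and> gegen_heat l t w \<le> C"
proof -
  define b where "b m = exp (- gegen_ev l (Suc m)) * gegen_zeta l (Suc m)" for m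
  have sb: "summable b"
    using summable_Suc_iff[THEN iffD2, OF summable_gegen_heat[OF l zero_less_one]] by (simp add: b_def[abs_def])
  have b: "b m \<ge> 0" for m using gegen_zeta_pos[OF l, of "Suc m"] by (simp add: b_def)
  define B where "B = suminf b"
  have B: "B \<ge> 0" using suminf_nonneg[OF sb b] by (simp add: B_def)
  have close: "\<bar>gegen_heat l t w - 1\<bar> \<le> exp (1 - t) * B" if tw: "1 \<le> t" "\<bar>w\<bar> \<le> 1" for t w
  proof -
    define f where "f m = exp (- t * gegen_ev l m) * (gegen_zeta l m * poly (gegen_poly l m) w)" for m
    have sf: "summable (\<lambda>m. \<bar>f m\<bar>)"
      unfolding f_def using tw by (intro summable_gegen_heat_abs[OF l]) auto
    have "f 0 = 1" using l by (simp add: f_def gegen_ev_def gegen_zeta_0)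
    then have "gegen_heat l t w = (\<Sum>m. f (Suc m)) + 1"
      using suminf_split_head[OF summable_rabs_cancel[OF sf]] by (simp add: gegen_heat_def f_def)
    moreover have "\<bar>\<Sum>m. f (Suc m)\<bar> \<le> (\<Sum>m. \<bar>f (Suc m)\<bar>)"
      using sf by (intro summable_rabs) (simp add: summable_Suc_iff[of "\<lambda>m. \<bar>f m\<bar>"])
    moreover have "\<bar>f (Suc m)\<bar> \<le> exp (1 - t) * b m" for m
    proof -
      have "gegen_ev l (Suc m) \<ge> 1 * 1"
        unfolding gegen_ev_def using l by (intro mult_mono) auto
      then have "(t - 1) * 1 \<le> (t - 1) * gegen_ev l (Suc m)"
        using tw by (intro mult_left_mono) auto
      then have "exp (- t * gegen_ev l (Suc m)) \<le> exp (1 - t) * exp (- gegen_ev l (Suc m))"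
        unfolding exp_add[symmetric] by (simp add: algebra_simps)
      then have "exp (- t * gegen_ev l (Suc m)) * (gegen_zeta l (Suc m) * \<bar>poly (gegen_poly l (Suc m)) w\<bar>)
          \<le> exp (1 - t) * exp (- gegen_ev l (Suc m)) * (gegen_zeta l (Suc m) * 1)"
        using gegen_zeta_pos[OF l, of "Suc m"] abs_gegen_poly_le_1[OF l tw(2), of "Suc m"]
        by (intro mult_mono mult_nonneg_nonneg) auto
      then show ?thesis
        using gegen_zeta_pos[OF l, of "Suc m"] by (simp add: f_def b_def abs_mult mult.assoc)
    qed
    then have "(\<Sum>m. \<bar>f (Suc m)\<bar>) \<le> (\<Sum>m. exp (1 - t) * b m)"
      using sf sb by (intro suminf_le summable_mult) (auto simp: summable_Suc_iff[of "\<lambda>m. \<bar>f m\<bar>"])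
    moreover have "(\<Sum>m. exp (1 - t) * b m) = exp (1 - t) * B"
      using sb by (simp add: B_def suminf_mult)
    ultimately show ?thesis by linarith
  qed
  obtain c where c: "c > 0" "\<And>t w. 0 < t \<Longrightarrow> \<bar>w\<bar> \<le> 1 \<Longrightarrow>
    gegen_heat l t w \<ge> c * exp (- t) * t powr - (l + 1) * exp (- (arccos w)\<^sup>2 / (4 * t))"
    using gegen_heat_lower_raw[OF l] by blast
  \<comment> \<open>Chosen so that exp (1 - T) (B + 1) = 1/2; using B + 1 avoids the logarithm of
    0.\<close>
  define T where "T = 1 + ln (2 * (B + 1))"
  have T: "T \<ge> 1" using B by (simp add: T_def)
  define c' where "c' = c * exp (- T) * T powr - (l + 1) * exp (- pi\<^sup>2 / 4)"
  have c': "c' > 0" using c T by (simp add: c'_def)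
  have lower: "gegen_heat l t w \<ge> min (1/2) c'" if tw: "1 \<le> t" "\<bar>w\<bar> \<le> 1" for t w
  proof (cases "t \<le> T")
    case True
    have a: "0 \<le> arccos w" "arccos w \<le> pi" using tw by (auto intro!: arccos_lbound arccos_ubound)
    have "(arccos w)\<^sup>2 / (4 * t) \<le> pi\<^sup>2 / 4"
      using a tw by (intro frac_le power_mono) auto
    then have "c' \<le> c * exp (- t) * t powr - (l + 1) * exp (- (arccos w)\<^sup>2 / (4 * t))"
      unfolding c'_def using c True tw l by (intro mult_mono powr_mono2') auto
    also have "\<dots> \<le> gegen_heat l t w" using c tw by auto
    finally show ?thesis by simp
  next
    case False
    then have "exp (1 - t) * B \<le> exp (1 - T) * (B + 1)" using B by (intro mult_mono) auto
    also have "exp (1 - T) = 1 / (2 * (B + 1))"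
      using B by (simp add: T_def exp_minus divide_inverse)
    also have "1 / (2 * (B + 1)) * (B + 1) = 1 / 2" using B by (simp add: field_simps)
    finally show ?thesis using close[OF tw] by linarith
  qed
  have upper: "gegen_heat l t w \<le> 1 + B" if tw: "1 \<le> t" "\<bar>w\<bar> \<le> 1" for t w
  proof -
    have "exp (1 - t) * B \<le> 1 * B" using B tw by (intro mult_right_mono) auto
    then show ?thesis using close[OF tw] by linarith
  qed
  define m where "m = min (1/2) c'"
  have m: "m > 0" "m \<le> 1 / 2" using c' by (auto simp: m_def)
  define C where "C = max (1 + B) (1 / m)"
  show thesis
  proof (rule that[of C])
    show C1: "C \<ge> 1" using B unfolding C_def by linarith
    fix t w :: real assume tw: "1 \<le> t" "\<bar>w\<bar> \<le> 1"
    have "1 / m \<le> C" by (simp add: C_def)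
    then have "1 / C \<le> m" using m C1 by (simp add: field_simps)
    moreover have "1 + B \<le> C" by (simp add: C_def)
    ultimately show "1 / C \<le> gegen_heat l t w \<and> gegen_heat l t w \<le> C"
      using lower[OF tw, folded m_def] upper[OF tw] by linarith
  qed
qed

section \<open>From Gaussians in the angle to exponentials in its cosine\<close>

text \<open>The function y^2 + 2 cos y increases for y \<ge> 0. A bound linear in the cosine is
  wanted because \<xi> - w later splits into one summand per integration variable.\<close>

lemma arccos_square_ge:
  assumes "-1 \<le> w" "w \<le> \<xi>" "\<xi> \<le> 1"
  shows "(arccos w)\<^sup>2 \<ge> (arccos \<xi>)\<^sup>2 + 2 * (\<xi> - w)"
proof -
  let ?f = "\<lambda>y. y\<^sup>2 + 2 * cos y"
  have "?f (arccos \<xi>) \<le> ?f (arccos w)"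
  proof (rule DERIV_nonneg_imp_nondecreasing[of _ _ ?f])
    show "arccos \<xi> \<le> arccos w" using assms by (intro arccos_le_arccos) auto
    fix y assume y: "arccos \<xi> \<le> y"
    then have "0 \<le> y" using arccos_lbound[of \<xi>] assms by simp
    then have "2 * y - 2 * sin y \<ge> 0" using sin_x_le_x[of y] by simp
    then show "\<exists>D. (?f has_real_derivative D) (at y) \<and> 0 \<le> D"
      by (intro exI[of _ "2 * y - 2 * sin y"]) (auto intro!: derivative_eq_intros)
  qed
  then show ?thesis using assms by simp
qed

text \<open>The converse direction requires y \<le> 2 sin y. Nonnegative w keeps the angle below
  \<pi> / 2, where y^2 < 3 and the cubic bound for the sine suffices.\<close>

lemma arccos_square_le:
  assumes "0 \<le> w" "w \<le> \<xi>" "\<xi> \<le> 1"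
  shows "(arccos w)\<^sup>2 \<le> (arccos \<xi>)\<^sup>2 + 4 * (\<xi> - w)"
proof -
  let ?f = "\<lambda>y. y\<^sup>2 + 4 * cos y"
  have "?f (arccos w) \<le> ?f (arccos \<xi>)"
  proof (rule DERIV_nonpos_imp_nonincreasing[of _ _ ?f])
    show "arccos \<xi> \<le> arccos w" using assms by (intro arccos_le_arccos) auto
    fix y assume y: "arccos \<xi> \<le> y" "y \<le> arccos w"
    then have y0: "0 \<le> y" "y \<le> pi / 2"
      using arccos_lbound[of \<xi>] arccos_le_pi2[of w] assms by auto
    have "y\<^sup>2 \<le> (1.58)\<^sup>2" using y0 pi_approx by (intro power_mono) auto
    then have "y * (y\<^sup>2 / 6) \<le> y * (1 / 2)" using y0 by (intro mult_left_mono) (auto simp: power2_eq_square)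
    then have "y \<le> 2 * sin y"
      using sin_ge_cubic[OF y0(1)] by (simp add: power2_eq_square power3_eq_cube)
    then have "2 * y - 4 * sin y \<le> 0" by simp
    then show "\<exists>D. (?f has_real_derivative D) (at y) \<and> D \<le> 0"
      by (intro exI[of _ "2 * y - 4 * sin y"]) (auto intro!: derivative_eq_intros)
  qed
  then show ?thesis using assms by (simp add: algebra_simps)
qed

text \<open>The term exp (- 3 / (4 t)) has to be absorbed as well. As \<xi> \<ge> 0, the squared
  angle of \<xi> is at most 5/2, which leaves room 1/2 below 3; since \<xi> - w \<le> 2, a quarter
  of \<xi> - w fits into it. This is the origin of the 16.\<close>

lemma gegen_heat_upper:
  assumes l: "l \<ge> 0"
  obtains C where "C \<ge> 1" "\<And>t w \<xi>. 0 < t \<Longrightarrow> t \<le> 1 \<Longrightarrow> -1 \<le> w \<Longrightarrow> w \<le> \<xi> \<Longrightarrow> 0 \<le> \<xi> \<Longrightarrow> \<xi> \<le> 1 \<Longrightarrow>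
    gegen_heat l t w \<le> C * t powr - (l + 1) * exp (- (arccos \<xi>)\<^sup>2 / (4 * t)) * exp (- (\<xi> - w) / (16 * t))"
proof -
  obtain C where C: "C \<ge> 1" "\<And>t w. 0 < t \<Longrightarrow> t \<le> 1 \<Longrightarrow> \<bar>w\<bar> \<le> 1 \<Longrightarrow>
    gegen_heat l t w \<le> C * t powr - (l + 1) * (exp (- (arccos w)\<^sup>2 / (4 * t)) + exp (- 3 / (4 * t)))"
    using gegen_heat_upper_raw[OF l] by blast
  show thesis
  proof (rule that[of "2 * C"])
    fix t w \<xi> :: real
    assume A: "0 < t" "t \<le> 1" "-1 \<le> w" "w \<le> \<xi>" "0 \<le> \<xi>" "\<xi> \<le> 1"
    let ?e = "exp (- ((arccos \<xi>)\<^sup>2 + (\<xi> - w) / 4) / (4 * t))"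
    have "arccos \<xi> \<le> pi / 2" "0 \<le> arccos \<xi>"
      using arccos_le_pi2[of \<xi>] arccos_lbound[of \<xi>] A by auto
    then have "(arccos \<xi>)\<^sup>2 \<le> (pi / 2)\<^sup>2" by (intro power_mono)
    also have "\<dots> \<le> (1.58)\<^sup>2" using pi_approx by (intro power_mono) auto
    also have "\<dots> \<le> 5 / 2" by (simp add: power2_eq_square)
    finally have "(arccos \<xi>)\<^sup>2 \<le> 5 / 2" .
    moreover have "(\<xi> - w) / 4 \<le> 1 / 2" using A by simp
    ultimately have "- 3 \<le> - ((arccos \<xi>)\<^sup>2 + (\<xi> - w) / 4)" by linarith
    then have 1: "exp (- 3 / (4 * t)) \<le> ?e"
      unfolding exp_le_cancel_iff using A by (intro divide_right_mono) auto
    have 2: "exp (- (arccos w)\<^sup>2 / (4 * t)) \<le> ?e"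
    proof -
      have "(\<xi> - w) / 4 \<le> 2 * (\<xi> - w)" using A by simp
      then have "- (arccos w)\<^sup>2 \<le> - ((arccos \<xi>)\<^sup>2 + (\<xi> - w) / 4)"
        using arccos_square_ge[of w \<xi>] A by linarith
      then show ?thesis
        unfolding exp_le_cancel_iff using A by (intro divide_right_mono) auto
    qed
    have "gegen_heat l t w \<le> C * t powr - (l + 1) * (exp (- (arccos w)\<^sup>2 / (4 * t)) + exp (- 3 / (4 * t)))"
      using A by (intro C) auto
    also have "\<dots> \<le> C * t powr - (l + 1) * (?e + ?e)"
      using 1 2 C A by (intro mult_left_mono add_mono) auto
    also have "?e = exp (- (arccos \<xi>)\<^sup>2 / (4 * t)) * exp (- (\<xi> - w) / (16 * t))"
      using A by (simp add: field_simps flip: exp_add)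
    finally show "gegen_heat l t w \<le>
        2 * C * t powr - (l + 1) * exp (- (arccos \<xi>)\<^sup>2 / (4 * t)) * exp (- (\<xi> - w) / (16 * t))"
      by (simp add: mult_ac)
  qed (use C in simp)
qed

lemma gegen_heat_lower:
  assumes l: "l \<ge> 0"
  obtains c where "c > 0" "\<And>t w \<xi>. 0 < t \<Longrightarrow> t \<le> 1 \<Longrightarrow> 0 \<le> w \<Longrightarrow> w \<le> \<xi> \<Longrightarrow> \<xi> \<le> 1 \<Longrightarrow>
    gegen_heat l t w \<ge> c * t powr - (l + 1) * exp (- (arccos \<xi>)\<^sup>2 / (4 * t)) * exp (- ((\<xi> - w) / t))"
proof -
  obtain c where c: "c > 0" "\<And>t w. 0 < t \<Longrightarrow> \<bar>w\<bar> \<le> 1 \<Longrightarrow>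
    gegen_heat l t w \<ge> c * exp (- t) * t powr - (l + 1) * exp (- (arccos w)\<^sup>2 / (4 * t))"
    using gegen_heat_lower_raw[OF l] by blast
  show thesis
  proof (rule that[of "c * exp (- 1)"])
    fix t w \<xi> :: real
    assume A: "0 < t" "t \<le> 1" "0 \<le> w" "w \<le> \<xi>" "\<xi> \<le> 1"
    have "exp (- (arccos \<xi>)\<^sup>2 / (4 * t)) * exp (- ((\<xi> - w) / t))
        = exp (- ((arccos \<xi>)\<^sup>2 + 4 * (\<xi> - w)) / (4 * t))"
      using A by (simp add: field_simps flip: exp_add)
    also have "\<dots> \<le> exp (- (arccos w)\<^sup>2 / (4 * t))"
      unfolding exp_le_cancel_iff using arccos_square_le[of w \<xi>] A by (intro divide_right_mono) auto
    finally have "c * exp (- 1) * t powr - (l + 1) * (exp (- (arccos \<xi>)\<^sup>2 / (4 * t)) * exp (- ((\<xi> - w) / t)))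
        \<le> c * exp (- t) * t powr - (l + 1) * exp (- (arccos w)\<^sup>2 / (4 * t))"
      using c A by (intro mult_mono) auto
    also have "\<dots> \<le> gegen_heat l t w" using A by (intro c) auto
    finally show "gegen_heat l t w \<ge>
       c * exp (- 1) * t powr - (l + 1) * exp (- (arccos \<xi>)\<^sup>2 / (4 * t)) * exp (- ((\<xi> - w) / t))"
      by (simp add: mult.assoc)
  qed (use c in simp)
qed

subsection \<open>Exponential integrals against \<open>\<Pi>\<^sub>\<nu>\<close>\<close>

lemma integrable_Pi_wt_mult:
  fixes f :: "real \<Rightarrow> real"
  assumes \<nu>: "\<nu> > -1/2" and [measurable]: "f \<in> borel_measurable borel"
    and "\<And>w. \<bar>w\<bar> \<le> 1 \<Longrightarrow> \<bar>f w\<bar> \<le> 1"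
  shows "integrable lborel (\<lambda>w. Pi_wt \<nu> w * f w)"
proof (rule Bochner_Integration.integrable_bound[OF integrable_Pi_wt[OF \<nu>]])
  show "AE w in lborel. norm (Pi_wt \<nu> w * f w) \<le> norm (Pi_wt \<nu> w)"
  proof (intro AE_I2)
    fix w :: real
    show "norm (Pi_wt \<nu> w * f w) \<le> norm (Pi_wt \<nu> w)"
    proof (cases "\<bar>w\<bar> \<le> 1")
      case True
      then show ?thesis
        using assms(3)[of w] Pi_wt_nonneg[of \<nu> w] by (simp add: abs_mult mult_left_le)
    next
      case False
      then have "Pi_wt \<nu> w = 0" by (auto simp: Pi_wt_def indicator_def)
      then show ?thesis by simp
    qed
  qed
qed simp

lemma powr_two_bounds:
  fixes v a :: real
  assumes "0 \<le> v" "v \<le> 1"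
  shows "(1 + v) powr a \<le> max 1 (2 powr a)" "min 1 (2 powr a) \<le> (1 + v) powr a"
proof -
  have "(1 + v) powr a \<le> max 1 (2 powr a) \<and> min 1 (2 powr a) \<le> (1 + v) powr a"
  proof (cases "a \<ge> 0")
    case True
    then have "(1 + v) powr a \<le> 2 powr a" using assms by (intro powr_mono2) auto
    moreover have "1 \<le> (1 + v) powr a" using True assms by (intro ge_one_powr_ge_zero) auto
    ultimately show ?thesis by (simp add: max_def min_def)
  next
    case False
    then have "2 powr a \<le> (1 + v) powr a" using assms by (intro powr_mono2') auto
    moreover have "(1 + v) powr a \<le> 1 powr a" using False assms by (intro powr_mono2') auto
    ultimately show ?thesis by (simp add: max_def min_def)
  qed
  then show "(1 + v) powr a \<le> max 1 (2 powr a)" "min 1 (2 powr a) \<le> (1 + v) powr a" by auto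
qed

lemma Pi_wt_factor:
  "\<bar>v\<bar> \<le> 1 \<Longrightarrow> Pi_wt \<nu> v = (1 - v) powr (\<nu> - 1/2) * (1 + v) powr (\<nu> - 1/2)"
proof -
  assume v: "\<bar>v\<bar> \<le> 1"
  have "1 - v\<^sup>2 = (1 - v) * (1 + v)" by (simp add: algebra_simps power2_eq_square)
  then have "(1 - v\<^sup>2) powr (\<nu> - 1/2) = (1 - v) powr (\<nu> - 1/2) * (1 + v) powr (\<nu> - 1/2)"
    by (simp only: powr_mult)
  then show ?thesis using v by (simp add: Pi_wt_def abs_le_iff)
qed

lemma integral_affine_reflect:
  fixes B :: "real \<Rightarrow> real"
  assumes "\<kappa> > 0" and nn: "\<And>t. B t \<ge> 0" and [measurable]: "B \<in> borel_measurable borel"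
    and B: "(B has_integral I) UNIV"
  shows "integrable lborel (\<lambda>v. B (\<kappa> * (1 - v)))" "(\<integral>v. B (\<kappa> * (1 - v)) \<partial>lborel) = I / \<kappa>"
proof -
  have "integral\<^sup>N lborel B = I"
    using nn by (intro nn_integral_has_integral_lborel[OF _ _ B]) auto
  moreover have "I \<ge> 0" using has_integral_nonneg[OF B] nn by simp
  ultimately have "has_bochner_integral lborel B I"
    using nn by (intro has_bochner_integral_nn_integral) auto
  then have iB: "integrable lborel B" and IB: "integral\<^sup>L lborel B = I"
    by (auto simp: has_bochner_integral_iff)
  have eq: "\<kappa> + (- \<kappa>) * v = \<kappa> * (1 - v)" for v by (simp add: algebra_simps)
  show "integrable lborel (\<lambda>v. B (\<kappa> * (1 - v)))"
  proof -
    have "integrable lborel (\<lambda>v. B (\<kappa> + (- \<kappa>) * v))"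
      using assms(1) by (intro lborel_integrable_real_affine[OF iB]) auto
    then show ?thesis unfolding eq .
  qed
  show "(\<integral>v. B (\<kappa> * (1 - v)) \<partial>lborel) = I / \<kappa>"
  proof -
    have "I = \<bar>- \<kappa>\<bar> *\<^sub>R (\<integral>v. B (\<kappa> + (- \<kappa>) * v) \<partial>lborel)"
      unfolding IB[symmetric] using assms(1) by (intro lborel_integral_real_affine) auto
    then have "I = \<kappa> * (\<integral>v. B (\<kappa> * (1 - v)) \<partial>lborel)"
      unfolding eq using assms(1) by simp
    then show ?thesis using assms(1) by (metis nonzero_mult_div_cancel_left less_irrefl)
  qed
qed

text \<open>With a = \<nu> + 1/2, the weight behaves like (1 - v)^(a - 1) near v = 1, and t =
  \<kappa> (1 - v) gives a Gamma integral times \<kappa>^(-a). The half v < 0 contributes at most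
  exp (- \<kappa>). For \<kappa> \<le> 1, or for the two-point measure with a = 0, the trivial bound
  1 is enough.\<close>

lemma integral_exp_Pi_measure_upper:
  assumes \<nu>: "\<nu> \<ge> -1/2"
  obtains C where "C > 0" "\<And>\<kappa>. \<kappa> \<ge> 0 \<Longrightarrow>
    (\<integral>v. exp (- (\<kappa> * (1 - v))) \<partial>Pi_measure \<nu>) \<le> C * (max 1 \<kappa>) powr - (\<nu> + 1/2)"
proof -
  have le1: "(\<integral>v. exp (- (\<kappa> * (1 - v))) \<partial>Pi_measure \<nu>) \<le> 1" if "\<kappa> \<ge> 0" for \<kappa>
  proof -
    have "(\<integral>v. exp (- (\<kappa> * (1 - v))) \<partial>Pi_measure \<nu>) \<le> (\<integral>v. 1 \<partial>Pi_measure \<nu>)"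
      using AE_Pi_measure[of \<nu>] that
      by (intro integral_mono_AE integrable_Pi_measure_continuous[OF \<nu>]) (auto intro!: continuous_intros)
    then show ?thesis using \<nu> by simp
  qed
  show thesis
  proof (cases "\<nu> = -1/2")
    case True
    show thesis by (rule that[of 1]) (use le1 True in auto)
  next
    case False
    with \<nu> have \<nu>: "\<nu> > -1/2" by simp
    define a where "a = \<nu> + 1/2"
    have a: "a > 0" using \<nu> by (simp add: a_def)
    \<comment> \<open>The Gamma integrand extended by zero, so that the substitution runs over the
      whole line.\<close>
    define B where "B t = (if t \<in> {0..} then t powr (a - 1) / exp t else 0)" for t :: real
    have B: "(B has_integral Gamma a) UNIV"
      unfolding B_def has_integral_restrict_UNIV by (rule Gamma_integral_real[OF a])
    have Bnn: "B t \<ge> 0" for t by (simp add: B_def)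
    have [measurable]: "B \<in> borel_measurable borel" unfolding B_def by measurable
    define D where "D = max 1 (2 powr (a - 1))"
    define C where "C = 1 + Pi_const \<nu> * D * Gamma a + a powr a"
    have cp: "Pi_const \<nu> > 0" by (rule Pi_const_pos[OF \<nu>])
    have D: "D \<ge> 1" by (simp add: D_def)
    have G: "Gamma a > 0" using a by (rule Gamma_real_pos)
    show thesis
    proof (rule that[of C])
      have "Pi_const \<nu> * D * Gamma a > 0" using cp D G by (intro mult_pos_pos) auto
      then show "C > 0" unfolding C_def using powr_ge_zero[of a a] by linarith
      fix \<kappa> :: real assume \<kappa>: "\<kappa> \<ge> 0"
      show "(\<integral>v. exp (- (\<kappa> * (1 - v))) \<partial>Pi_measure \<nu>) \<le> C * (max 1 \<kappa>) powr - (\<nu> + 1/2)"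
      proof (cases "\<kappa> \<le> 1")
        case True
        have "C \<ge> 1" unfolding C_def using powr_ge_zero[of a a] \<open>Pi_const \<nu> * D * Gamma a > 0\<close> by linarith
        then show ?thesis using le1[OF \<kappa>] True by (simp add: max_absorb1)
      next
        case False
        then have \<kappa>: "\<kappa> > 1" by simp
        note refl = integral_affine_reflect[of \<kappa> B "Gamma a", OF _ Bnn _ B]
        have i1: "integrable lborel (\<lambda>v. Pi_wt \<nu> v * exp (- (\<kappa> * (1 - v))))"
          using \<kappa> by (intro integrable_Pi_wt_mult[OF \<nu>]) auto
        have "(\<integral>v. Pi_wt \<nu> v * exp (- (\<kappa> * (1 - v))) \<partial>lborel)
          \<le> (\<integral>v. D * \<kappa> powr (1 - a) * B (\<kappa> * (1 - v)) + exp (- \<kappa>) * Pi_wt \<nu> v \<partial>lborel)"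
        proof (rule integral_mono[OF i1])
          show "integrable lborel (\<lambda>v. D * \<kappa> powr (1 - a) * B (\<kappa> * (1 - v)) + exp (- \<kappa>) * Pi_wt \<nu> v)"
            using refl(1) \<kappa> integrable_Pi_wt[OF \<nu>] by auto
          fix v :: real
          consider "\<bar>v\<bar> > 1" | "-1 \<le> v" "v < 0" | "0 \<le> v" "v \<le> 1" by linarith
          then show "Pi_wt \<nu> v * exp (- (\<kappa> * (1 - v))) \<le> D * \<kappa> powr (1 - a) * B (\<kappa> * (1 - v)) + exp (- \<kappa>) * Pi_wt \<nu> v"
          proof cases
            case 1
            then have "Pi_wt \<nu> v = 0" by (auto simp: Pi_wt_def indicator_def)
            then show ?thesis using Bnn D by simp
          next
            case 2
            have "\<kappa> * 1 \<le> \<kappa> * (1 - v)" using 2 \<kappa> by (intro mult_left_mono) auto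
            then have "Pi_wt \<nu> v * exp (- (\<kappa> * (1 - v))) \<le> Pi_wt \<nu> v * exp (- \<kappa>)"
              by (intro mult_left_mono Pi_wt_nonneg) auto
            moreover have "0 \<le> D * \<kappa> powr (1 - a) * B (\<kappa> * (1 - v))" using Bnn D by simp
            ultimately show ?thesis by (simp add: mult.commute)
          next
            case 3
            have "\<kappa> powr (1 - a) * \<kappa> powr (a - 1) = 1" using \<kappa> by (simp flip: powr_add)
            then have "D * \<kappa> powr (1 - a) * B (\<kappa> * (1 - v)) = D * ((1 - v) powr (a - 1) * exp (- (\<kappa> * (1 - v))))"
              using 3 \<kappa> by (simp add: B_def powr_mult exp_minus divide_inverse mult_ac)
            moreover have "Pi_wt \<nu> v * exp (- (\<kappa> * (1 - v))) = (1 + v) powr (a - 1) * ((1 - v) powr (a - 1) * exp (- (\<kappa> * (1 - v))))"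
              using 3 Pi_wt_factor[of v \<nu>] by (simp add: a_def mult_ac)
            moreover have "\<dots> \<le> D * ((1 - v) powr (a - 1) * exp (- (\<kappa> * (1 - v))))"
              unfolding D_def using 3 by (intro mult_right_mono powr_two_bounds) auto
            moreover have "exp (- \<kappa>) * Pi_wt \<nu> v \<ge> 0" using Pi_wt_nonneg by simp
            ultimately show ?thesis by linarith
          qed
        qed
        also have "\<dots> = D * \<kappa> powr (1 - a) * (Gamma a / \<kappa>) + exp (- \<kappa>) * integral\<^sup>L lborel (Pi_wt \<nu>)"
          using refl \<kappa> integrable_Pi_wt[OF \<nu>] by simp
        finally have "(\<integral>v. exp (- (\<kappa> * (1 - v))) \<partial>Pi_measure \<nu>)
           \<le> Pi_const \<nu> * (D * \<kappa> powr (1 - a) * (Gamma a / \<kappa>) + exp (- \<kappa>) * integral\<^sup>L lborel (Pi_wt \<nu>))"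
          using cp by (subst integral_Pi_measure[OF \<nu>]) auto
        also have "\<dots> = Pi_const \<nu> * D * Gamma a * \<kappa> powr - a + exp (- \<kappa>)"
        proof -
          have 1: "\<kappa> powr (1 - a) / \<kappa> = \<kappa> powr - a" using \<kappa> by (simp add: powr_diff powr_minus field_simps)
          have 2: "Pi_const \<nu> * integral\<^sup>L lborel (Pi_wt \<nu>) = 1"
            using integral_Pi_wt_pos[OF \<nu>] by (simp add: Pi_const_eq)
          have "Pi_const \<nu> * (D * \<kappa> powr (1 - a) * (Gamma a / \<kappa>) + exp (- \<kappa>) * integral\<^sup>L lborel (Pi_wt \<nu>))
             = Pi_const \<nu> * D * Gamma a * (\<kappa> powr (1 - a) / \<kappa>) + exp (- \<kappa>) * (Pi_const \<nu> * integral\<^sup>L lborel (Pi_wt \<nu>))"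
            by (simp add: algebra_simps)
          then show ?thesis unfolding 1 2 by simp
        qed
        \<comment> \<open>This is x \<le> exp x at x = \<kappa> / a, raised to the power a.\<close>
        also have "exp (- \<kappa>) \<le> a powr a * \<kappa> powr - a"
        proof -
          have "\<kappa> / a \<le> exp (\<kappa> / a)" using exp_ge_add_one_self[of "\<kappa> / a"] by linarith
          then have "(\<kappa> / a) powr a \<le> exp (\<kappa> / a) powr a" using a \<kappa> by (intro powr_mono2) auto
          also have "\<dots> = exp \<kappa>" using a by (simp add: powr_def)
          finally have "\<kappa> powr a \<le> a powr a * exp \<kappa>" using a \<kappa> by (simp add: powr_divide field_simps)
          then show ?thesis using \<kappa> by (simp add: powr_minus exp_minus field_simps)
        qed
        finally have "(\<integral>v. exp (- (\<kappa> * (1 - v))) \<partial>Pi_measure \<nu>) \<le> (Pi_const \<nu> * D * Gamma a + a powr a) * \<kappa> powr - a"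
          by (simp add: distrib_right)
        also have "\<dots> \<le> C * \<kappa> powr - a"
          by (intro mult_right_mono) (auto simp: C_def)
        finally show ?thesis using \<kappa> by (simp add: a_def max_def)
      qed
    qed
  qed
qed

text \<open>Only the window 1 - v \<le> 1 / \<mu> is kept, where the exponential is at least exp
  (-1). Since \<mu> = max 1 \<kappa> \<ge> 1, the window lies in v \<ge> 0, as needed because the
  pointwise lower bound is only used for nonnegative variables. For the two-point measure the atom
  at 1 gives 1/2.\<close>

lemma integral_exp_Pi_measure_lower:
  assumes \<nu>: "\<nu> \<ge> -1/2"
  obtains c where "c > 0" "\<And>\<kappa>. \<kappa> \<ge> 0 \<Longrightarrow>
    c * (max 1 \<kappa>) powr - (\<nu> + 1/2) \<le> (\<integral>v. indicator {0..} v * exp (- (\<kappa> * (1 - v))) \<partial>Pi_measure \<nu>)"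
proof (cases "\<nu> = -1/2")
  case True
  show thesis
  proof (rule that[of "1/2"])
    show "1/2 * (max 1 \<kappa>) powr - (\<nu> + 1/2) \<le> (\<integral>v. indicator {0..} v * exp (- (\<kappa> * (1 - v))) \<partial>Pi_measure \<nu>)"
      if "\<kappa> \<ge> 0" for \<kappa>
      by (subst integral_Pi_measure_half[OF True]) (auto simp: True)
  qed simp
next
  case False
  with \<nu> have \<nu>: "\<nu> > -1/2" by simp
  define a where "a = \<nu> + 1/2"
  have a: "a > 0" using \<nu> by (simp add: a_def)
  define B where "B t = (if t \<in> {0..1} then t powr (a - 1) else 0)" for t :: real
  have B: "(B has_integral (1 / a)) UNIV"
    unfolding B_def has_integral_restrict_UNIV using has_integral_powr_from_0[of "a - 1" 1] a by simp
  have Bnn: "B t \<ge> 0" for t by (simp add: B_def)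
  have [measurable]: "B \<in> borel_measurable borel" unfolding B_def by measurable
  define d where "d = min 1 (2 powr (a - 1))"
  have d: "d > 0" by (simp add: d_def)
  define c where "c = Pi_const \<nu> * (d * exp (-1) / a)"
  have cp: "Pi_const \<nu> > 0" by (rule Pi_const_pos[OF \<nu>])
  show thesis
  proof (rule that[of c])
    show "c > 0" unfolding c_def using cp d a by simp
    fix \<kappa> :: real assume \<kappa>: "\<kappa> \<ge> 0"
    define \<mu> where "\<mu> = max 1 \<kappa>"
    have \<mu>: "\<mu> \<ge> 1" "\<kappa> \<le> \<mu>" by (auto simp: \<mu>_def)
    note refl = integral_affine_reflect[of \<mu> B "1 / a", OF _ Bnn _ B]
    have "c * \<mu> powr - a = Pi_const \<nu> * (d * exp (-1) * \<mu> powr (1 - a) * (1 / a / \<mu>))"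
      using \<mu> by (simp add: c_def powr_diff powr_minus field_simps)
    also have "\<dots> = Pi_const \<nu> * (\<integral>v. d * exp (-1) * \<mu> powr (1 - a) * B (\<mu> * (1 - v)) \<partial>lborel)"
      using refl \<mu> by simp
    also have "\<dots> \<le> Pi_const \<nu> * (\<integral>v. Pi_wt \<nu> v * (indicator {0..} v * exp (- (\<kappa> * (1 - v)))) \<partial>lborel)"
    proof (intro mult_left_mono integral_mono)
      show "integrable lborel (\<lambda>v. d * exp (-1) * \<mu> powr (1 - a) * B (\<mu> * (1 - v)))"
        using refl(1) \<mu> by auto
      show "integrable lborel (\<lambda>v. Pi_wt \<nu> v * (indicator {0..} v * exp (- (\<kappa> * (1 - v)))))"
        using \<kappa> by (intro integrable_Pi_wt_mult[OF \<nu>]) (auto simp: indicator_def)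
      fix v :: real
      show "d * exp (-1) * \<mu> powr (1 - a) * B (\<mu> * (1 - v)) \<le> Pi_wt \<nu> v * (indicator {0..} v * exp (- (\<kappa> * (1 - v))))"
      proof (cases "\<mu> * (1 - v) \<in> {0..1}")
        case True
        then have v1: "v \<le> 1" using \<mu> by (simp add: zero_le_mult_iff)
        have "1 - v \<le> \<mu> * (1 - v)" using \<mu> v1 by (simp add: mult_le_cancel_right1)
        with True have v0: "0 \<le> v" by simp
        have "\<kappa> * (1 - v) \<le> \<mu> * (1 - v)" using \<mu> v1 by (intro mult_right_mono) auto
        with True have "exp (-1) \<le> exp (- (\<kappa> * (1 - v)))" by simp
        moreover have "d \<le> (1 + v) powr (a - 1)"
          unfolding d_def using v0 v1 by (intro powr_two_bounds) auto
        ultimately have "(d * exp (-1)) * (1 - v) powr (a - 1) \<le>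
            ((1 + v) powr (a - 1) * exp (- (\<kappa> * (1 - v)))) * (1 - v) powr (a - 1)"
          using d by (intro mult_right_mono mult_mono) auto
        also have "\<dots> = Pi_wt \<nu> v * (indicator {0..} v * exp (- (\<kappa> * (1 - v))))"
          using v0 v1 Pi_wt_factor[of v \<nu>] by (simp add: a_def mult_ac)
        finally have "d * exp (-1) * (1 - v) powr (a - 1) \<le> Pi_wt \<nu> v * (indicator {0..} v * exp (- (\<kappa> * (1 - v))))" .
        moreover have "\<mu> powr (1 - a) * B (\<mu> * (1 - v)) = (1 - v) powr (a - 1)"
        proof -
          have "\<mu> powr (1 - a) * \<mu> powr (a - 1) = 1" using \<mu> by (simp flip: powr_add)
          then show ?thesis using True \<mu> v1 by (simp add: B_def powr_mult flip: mult.assoc)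
        qed
        ultimately show ?thesis by (simp add: mult.assoc)
      next
        case False
        then have "B (\<mu> * (1 - v)) = 0" by (auto simp: B_def)
        then show ?thesis using Pi_wt_nonneg by simp
      qed
    qed (use cp in simp)
    also have "\<dots> = (\<integral>v. indicator {0..} v * exp (- (\<kappa> * (1 - v))) \<partial>Pi_measure \<nu>)"
      by (subst integral_Pi_measure[OF \<nu>]) auto
    finally show "c * (max 1 \<kappa>) powr - (\<nu> + 1/2) \<le> (\<integral>v. indicator {0..} v * exp (- (\<kappa> * (1 - v))) \<partial>Pi_measure \<nu>)"
      by (simp add: a_def \<mu>_def)
  qed
qed

subsection \<open>Averages over the product measure\<close>

definition even_heat :: "real \<Rightarrow> real \<Rightarrow> real \<Rightarrow> real" where
  "even_heat l t w =
     (\<Sum>n. exp (- t * gegen_ev l (2 * n)) * (gegen_zeta l (2 * n) * poly (gegen_poly l (2 * n)) w))"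

text \<open>Odd degrees cancel under w to -w. Bounds for the full kernel at both signs thus pass to
  the even part.\<close>

lemma even_heat_eq:
  assumes l: "l \<ge> 0" and t: "t > 0" and w: "\<bar>w\<bar> \<le> 1"
  shows "even_heat l t w = (gegen_heat l t w + gegen_heat l t (- w)) / 2"
proof -
  define f where "f m w = exp (- t * gegen_ev l m) * (gegen_zeta l m * poly (gegen_poly l m) w)" for m w
  have s: "summable (\<lambda>m. f m w)" if "\<bar>w\<bar> \<le> 1" for w
    using summable_rabs_cancel[OF summable_gegen_heat_abs[OF l t that]] by (simp add: f_def)
  have f_minus: "f m (- w) = (-1) ^ m * f m w" for m
    by (simp add: f_def gegen_poly_minus mult_ac)
  have "gegen_heat l t w + gegen_heat l t (- w) = (\<Sum>m. f m w + f m (- w))"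
    using suminf_add[OF s s, of w "- w"] w by (simp add: gegen_heat_def f_def)
  also have "\<dots> = (\<Sum>n. f (2 * n) w + f (2 * n) (- w))"
  proof (rule suminf_mono_reindex[symmetric])
    show "strict_mono (\<lambda>n::nat. 2 * n)" by (simp add: strict_mono_def)
    fix m :: nat assume "m \<notin> range (\<lambda>n. 2 * n)"
    then have "odd m" by (auto elim!: evenE)
    then show "f m w + f m (- w) = 0" by (simp add: f_minus)
  qed
  also have "\<dots> = (\<Sum>n. 2 * f (2 * n) w)"
    by (simp add: f_minus)
  also have "\<dots> = 2 * even_heat l t w"
  proof -
    have "summable (\<lambda>n. if even n then f n w else 0)"
      using summable_rabs_cancel summable_comparison_test'[OF summable_gegen_heat_abs[OF l t w], of 0 "\<lambda>n. if even n then f n w else 0"]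
      by (auto simp: f_def)
    then have "summable (\<lambda>n. if even (2 * n) then f (2 * n) w else 0)"
      by (subst summable_mono_reindex[of "\<lambda>n. 2 * n" "\<lambda>n. if even n then f n w else 0"])
        (auto simp: strict_mono_def elim!: evenE)
    then have "summable (\<lambda>n. f (2 * n) w)" by simp
    then show ?thesis by (simp add: suminf_mult even_heat_def f_def)
  qed
  finally show ?thesis by simp
qed

lemma convex_comb_bounds:
  assumes "A \<ge> 0" "B \<ge> 0" "A + B \<le> (1::real)" "\<bar>x\<bar> \<le> 1" "\<bar>y\<bar> \<le> 1"
  shows "\<bar>x * A + y * B\<bar> \<le> A + B" "\<bar>x * A + y * B\<bar> \<le> 1"
proof -
  have "\<bar>x * A + y * B\<bar> \<le> \<bar>x\<bar> * A + \<bar>y\<bar> * B"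
    using assms abs_triangle_ineq[of "x * A" "y * B"] by (simp add: abs_mult)
  also have "\<dots> \<le> 1 * A + 1 * B" using assms by (intro add_mono mult_right_mono) auto
  finally show "\<bar>x * A + y * B\<bar> \<le> A + B" by simp
  then show "\<bar>x * A + y * B\<bar> \<le> 1" using assms by simp
qed

context
  fixes \<nu>1 \<nu>2 l :: real and M :: "(real \<times> real) measure"
  assumes \<nu>: "\<nu>1 \<ge> -1/2" "\<nu>2 \<ge> -1/2" and l: "l \<ge> 0"
  defines "M \<equiv> Pi_measure \<nu>1 \<Otimes>\<^sub>M Pi_measure \<nu>2"
begin

interpretation P1: finite_measure "Pi_measure \<nu>1"
  by (rule finite_measure_Pi_measure[OF \<nu>(1)])

interpretation P2: finite_measure "Pi_measure \<nu>2"
  by (rule finite_measure_Pi_measure[OF \<nu>(2)])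

interpretation P: pair_sigma_finite "Pi_measure \<nu>1" "Pi_measure \<nu>2" ..

interpretation M: finite_measure M
  unfolding M_def by (rule finite_measure_pair_measure) unfold_locales

lemma sets_M [measurable_cong]: "sets M = sets (borel \<Otimes>\<^sub>M borel)"
  unfolding M_def by (intro sets_pair_measure_cong) auto

lemma AE_M: "AE z in M. \<bar>fst z\<bar> \<le> 1 \<and> \<bar>snd z\<bar> \<le> 1"
  unfolding M_def
proof (rule P.AE_pair_measure)
  show "{z \<in> space (Pi_measure \<nu>1 \<Otimes>\<^sub>M Pi_measure \<nu>2). \<bar>fst z\<bar> \<le> 1 \<and> \<bar>snd z\<bar> \<le> 1}
      \<in> sets (Pi_measure \<nu>1 \<Otimes>\<^sub>M Pi_measure \<nu>2)"
    by measurable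
  show "AE x in Pi_measure \<nu>1. AE y in Pi_measure \<nu>2. \<bar>fst (x, y)\<bar> \<le> 1 \<and> \<bar>snd (x, y)\<bar> \<le> 1"
    using AE_Pi_measure[of \<nu>1]
  proof eventually_elim
    case (elim x)
    with AE_Pi_measure[of \<nu>2] show ?case by simp
  qed
qed

lemma measure_M: "measure M UNIV = 1"
proof -
  have "emeasure M (UNIV \<times> UNIV) = emeasure (Pi_measure \<nu>1) UNIV * emeasure (Pi_measure \<nu>2) UNIV"
    unfolding M_def by (rule P2.emeasure_pair_measure_Times) auto
  then show ?thesis
    by (simp add: measure_def prob_Pi_measure[OF \<nu>(1)] prob_Pi_measure[OF \<nu>(2)])
qed

lemma space_M: "space M = UNIV"
  by (simp add: M_def space_pair_measure)

lemma integrable_M: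
  fixes f :: "real \<times> real \<Rightarrow> real"
  assumes [measurable]: "f \<in> borel_measurable (borel \<Otimes>\<^sub>M borel)"
    and "\<And>x y. \<bar>x\<bar> \<le> 1 \<Longrightarrow> \<bar>y\<bar> \<le> 1 \<Longrightarrow> \<bar>f (x, y)\<bar> \<le> B"
  shows "integrable M f"
proof (rule M.integrable_const_bound)
  show "AE z in M. norm (f z) \<le> B"
    using AE_M
  proof eventually_elim
    case (elim z)
    then show ?case using assms(2)[of "fst z" "snd z"] by simp
  qed
qed measurable

lemma integral_M_product:
  fixes g h :: "real \<Rightarrow> real"
  assumes [measurable]: "g \<in> borel_measurable borel" "h \<in> borel_measurable borel"
    and "\<And>x. \<bar>x\<bar> \<le> 1 \<Longrightarrow> \<bar>g x\<bar> \<le> 1" "\<And>x. \<bar>x\<bar> \<le> 1 \<Longrightarrow> \<bar>h x\<bar> \<le> 1"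
  shows "integrable M (\<lambda>z. g (fst z) * h (snd z))"
    "(\<integral>z. g (fst z) * h (snd z) \<partial>M) = integral\<^sup>L (Pi_measure \<nu>1) g * integral\<^sup>L (Pi_measure \<nu>2) h"
proof -
  show i: "integrable M (\<lambda>z. g (fst z) * h (snd z))"
  proof (rule integrable_M)
    fix x y :: real assume "\<bar>x\<bar> \<le> 1" "\<bar>y\<bar> \<le> 1"
    then have "\<bar>g x\<bar> * \<bar>h y\<bar> \<le> 1 * 1" using assms(3,4) by (intro mult_mono) auto
    then show "\<bar>g (fst (x, y)) * h (snd (x, y))\<bar> \<le> 1 * 1" by (simp add: abs_mult)
  qed measurable
  have "(\<integral>z. g (fst z) * h (snd z) \<partial>M) = (\<integral>x. \<integral>y. g x * h y \<partial>Pi_measure \<nu>2 \<partial>Pi_measure \<nu>1)"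
    using P.integral_fst'[OF i[unfolded M_def]] by (simp add: M_def)
  then show "(\<integral>z. g (fst z) * h (snd z) \<partial>M) = integral\<^sup>L (Pi_measure \<nu>1) g * integral\<^sup>L (Pi_measure \<nu>2) h"
    by simp
qed

text \<open>The series at w = 1 is the majorant. Domination holds only almost everywhere, since
  \<open>M\<close> is a measure on the whole plane and the polynomials are controlled only on the
  square that carries it.\<close>

lemma even_heat_exchange:
  assumes t: "t > 0" and AB: "A \<ge> 0" "B \<ge> 0" "A + B \<le> 1"
  shows "integrable M (\<lambda>z. even_heat l t (fst z * A + snd z * B))"
    "(\<Sum>n. \<integral>z. exp (- t * gegen_ev l (2 * n)) * (gegen_zeta l (2 * n) *
        poly (gegen_poly l (2 * n)) (fst z * A + snd z * B)) \<partial>M)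
      = (\<integral>z. even_heat l t (fst z * A + snd z * B) \<partial>M)"
proof -
  define b where "b n = exp (- t * gegen_ev l (2 * n)) * gegen_zeta l (2 * n)" for n
  define f where "f n z = exp (- t * gegen_ev l (2 * n)) * (gegen_zeta l (2 * n) *
        poly (gegen_poly l (2 * n)) (fst z * A + snd z * B))" for n and z :: "real \<times> real"
  have bn: "b n \<ge> 0" for n using gegen_zeta_pos[OF l, of "2 * n"] by (simp add: b_def)
  have sb: "summable b"
  proof -
    let ?c = "\<lambda>m. exp (- t * gegen_ev l m) * gegen_zeta l m"
    have cn: "?c m \<ge> 0" for m using gegen_zeta_pos[OF l, of m] by simp
    have "summable (\<lambda>m. if even m then ?c m else 0)"
      by (rule summable_comparison_test'[OF summable_gegen_heat[OF l t], of 0]) (use cn in auto)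
    then have "summable (\<lambda>n. if even (2 * n) then ?c (2 * n) else 0)"
      by (subst summable_mono_reindex[of "\<lambda>n. 2 * n" "\<lambda>m. if even m then ?c m else 0"])
        (auto simp: strict_mono_def elim!: evenE)
    then show ?thesis by (simp add: b_def[abs_def])
  qed
  have fb: "\<bar>f n (x, y)\<bar> \<le> b n" if "\<bar>x\<bar> \<le> 1" "\<bar>y\<bar> \<le> 1" for n x y
    using abs_gegen_poly_le_1[OF l convex_comb_bounds(2)[OF AB that], of "2 * n"] gegen_zeta_pos[OF l, of "2 * n"]
    by (simp add: f_def b_def abs_mult mult_left_le)
  have fm [measurable]: "f n \<in> borel_measurable (borel \<Otimes>\<^sub>M borel)" for n
  proof -
    have "continuous_on UNIV (f n)" unfolding f_def by (intro continuous_intros)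
    then show ?thesis unfolding borel_prod by (rule borel_measurable_continuous_onI)
  qed
  have fi: "integrable M (f n)" for n
    using fb by (intro integrable_M[where B = "b n"]) auto
  have ae: "AE z in M. summable (\<lambda>n. norm (f n z))"
    using AE_M
  proof eventually_elim
    case (elim z)
    then show ?case
      using fb[of "fst z" "snd z"] by (intro summable_comparison_test'[OF sb, of 0]) auto
  qed
  have si: "summable (\<lambda>n. \<integral>z. norm (f n z) \<partial>M)"
  proof (rule summable_comparison_test'[OF sb, of 0])
    fix n
    have "(\<integral>z. norm (f n z) \<partial>M) \<le> (\<integral>z. b n \<partial>M)"
    proof (rule integral_mono_AE)
      show "AE z in M. norm (f n z) \<le> b n"
        using AE_M
      proof eventually_elim
        case (elim z)
        then show ?case using fb[of "fst z" "snd z"] by auto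
      qed
    qed (use fi in auto)
    then show "norm (\<integral>z. norm (f n z) \<partial>M) \<le> b n"
      using measure_M space_M by (simp add: integral_nonneg_AE)
  qed
  have e: "even_heat l t (fst z * A + snd z * B) = (\<Sum>n. f n z)" for z
    by (simp add: even_heat_def f_def)
  show "integrable M (\<lambda>z. even_heat l t (fst z * A + snd z * B))"
    unfolding e by (rule integrable_suminf[OF fi ae si])
  show "(\<Sum>n. \<integral>z. exp (- t * gegen_ev l (2 * n)) * (gegen_zeta l (2 * n) *
        poly (gegen_poly l (2 * n)) (fst z * A + snd z * B)) \<partial>M)
      = (\<integral>z. even_heat l t (fst z * A + snd z * B) \<partial>M)"
    unfolding e using integral_suminf[OF fi ae si] by (simp add: f_def)
qed

text \<open>For \<xi> = A + B and w = x A + y B one has \<xi> - w = A (1 - x) + B (1 - y), so the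
  pointwise bound is a product and the average factorizes into two exponential integrals. The
  reflected half of the even kernel has the same integral by symmetry of the measures.\<close>

lemma integral_even_heat_upper:
  obtains C where "C > 0" "\<And>t A B. 0 < t \<Longrightarrow> t \<le> 1 \<Longrightarrow> A \<ge> 0 \<Longrightarrow> B \<ge> 0 \<Longrightarrow> A + B \<le> 1 \<Longrightarrow>
    (\<integral>z. even_heat l t (fst z * A + snd z * B) \<partial>M) \<le>
      C * t powr - (l + 1) * exp (- (arccos (A + B))\<^sup>2 / (4 * t)) *
      ((max 1 (A / (16 * t))) powr - (\<nu>1 + 1/2) * (max 1 (B / (16 * t))) powr - (\<nu>2 + 1/2))"
proof -
  obtain C where C: "C \<ge> 1" "\<And>t w \<xi>. 0 < t \<Longrightarrow> t \<le> 1 \<Longrightarrow> -1 \<le> w \<Longrightarrow> w \<le> \<xi> \<Longrightarrow> 0 \<le> \<xi> \<Longrightarrow> \<xi> \<le> 1 \<Longrightarrow>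
    gegen_heat l t w \<le> C * t powr - (l + 1) * exp (- (arccos \<xi>)\<^sup>2 / (4 * t)) * exp (- (\<xi> - w) / (16 * t))"
    using gegen_heat_upper[OF l] by blast
  obtain C1 where C1: "C1 > 0" "\<And>\<kappa>. \<kappa> \<ge> 0 \<Longrightarrow>
    (\<integral>v. exp (- (\<kappa> * (1 - v))) \<partial>Pi_measure \<nu>1) \<le> C1 * (max 1 \<kappa>) powr - (\<nu>1 + 1/2)"
    using integral_exp_Pi_measure_upper[OF \<nu>(1)] by blast
  obtain C2 where C2: "C2 > 0" "\<And>\<kappa>. \<kappa> \<ge> 0 \<Longrightarrow>
    (\<integral>v. exp (- (\<kappa> * (1 - v))) \<partial>Pi_measure \<nu>2) \<le> C2 * (max 1 \<kappa>) powr - (\<nu>2 + 1/2)"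
    using integral_exp_Pi_measure_upper[OF \<nu>(2)] by blast
  show thesis
  proof (rule that[of "C * (C1 * C2)"])
    fix t A B :: real
    assume t: "0 < t" "t \<le> 1" and AB: "A \<ge> 0" "B \<ge> 0" "A + B \<le> 1"
    define k1 k2 where "k1 = A / (16 * t)" and "k2 = B / (16 * t)"
    have k: "k1 \<ge> 0" "k2 \<ge> 0" using t AB by (auto simp: k1_def k2_def)
    define D where "D = C * t powr - (l + 1) * exp (- (arccos (A + B))\<^sup>2 / (4 * t))"
    have D: "D \<ge> 0" using C by (simp add: D_def)
    define g where "g \<kappa> v = exp (- (\<kappa> * (1 - v)))" for \<kappa> v :: real
    have gm [measurable]: "g \<kappa> \<in> borel_measurable borel" "(\<lambda>v. g \<kappa> (- v)) \<in> borel_measurable borel" for \<kappa>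
      unfolding g_def by measurable
    have g1: "\<bar>g \<kappa> v\<bar> \<le> 1" if "\<bar>v\<bar> \<le> 1" "\<kappa> \<ge> 0" for \<kappa> v using that by (simp add: g_def)
    have H: "gegen_heat l t (x * A + y * B) \<le> D * (g k1 x * g k2 y)" if "\<bar>x\<bar> \<le> 1" "\<bar>y\<bar> \<le> 1" for x y
    proof -
      note cb = convex_comb_bounds[OF AB that]
      have "gegen_heat l t (x * A + y * B) \<le> D * exp (- (A + B - (x * A + y * B)) / (16 * t))"
        unfolding D_def using cb t AB by (intro C) (auto simp: abs_le_iff)
      also have "exp (- (A + B - (x * A + y * B)) / (16 * t)) = g k1 x * g k2 y"
        unfolding g_def k1_def k2_def exp_add[symmetric] using t by (simp add: field_simps)
      finally show ?thesis .
    qed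
    have ub: "AE z in M. even_heat l t (fst z * A + snd z * B) \<le>
      D / 2 * (g k1 (fst z) * g k2 (snd z)) + D / 2 * (g k1 (- fst z) * g k2 (- snd z))"
      using AE_M
    proof eventually_elim
      case (elim z)
      have "even_heat l t (fst z * A + snd z * B) =
          (gegen_heat l t (fst z * A + snd z * B) + gegen_heat l t (- fst z * A + - snd z * B)) / 2"
        using even_heat_eq[OF l t(1) convex_comb_bounds(2)[OF AB, of "fst z" "snd z"]] elim by simp
      also have "\<dots> \<le> (D * (g k1 (fst z) * g k2 (snd z)) + D * (g k1 (- fst z) * g k2 (- snd z))) / 2"
        using elim by (intro divide_right_mono add_mono H) auto
      finally show ?case by (simp add: add_divide_distrib)
    qed
    have p1: "integrable M (\<lambda>z. g k1 (fst z) * g k2 (snd z))"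
      "(\<integral>z. g k1 (fst z) * g k2 (snd z) \<partial>M) = integral\<^sup>L (Pi_measure \<nu>1) (g k1) * integral\<^sup>L (Pi_measure \<nu>2) (g k2)"
      by (intro integral_M_product[of "g k1" "g k2"] gm g1 k; assumption)+
    have p2: "integrable M (\<lambda>z. g k1 (- fst z) * g k2 (- snd z))"
      "(\<integral>z. g k1 (- fst z) * g k2 (- snd z) \<partial>M) =
         (\<integral>v. g k1 (- v) \<partial>Pi_measure \<nu>1) * (\<integral>v. g k2 (- v) \<partial>Pi_measure \<nu>2)"
      by (intro integral_M_product[of "\<lambda>v. g k1 (- v)" "\<lambda>v. g k2 (- v)"] gm g1 k; simp)+
    have "(\<integral>z. even_heat l t (fst z * A + snd z * B) \<partial>M) \<le>
        (\<integral>z. D / 2 * (g k1 (fst z) * g k2 (snd z)) + D / 2 * (g k1 (- fst z) * g k2 (- snd z)) \<partial>M)"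
      using p1 p2 by (intro integral_mono_AE[OF even_heat_exchange(1)[OF t(1) AB] _ ub]) auto
    also have "\<dots> = D * (integral\<^sup>L (Pi_measure \<nu>1) (g k1) * integral\<^sup>L (Pi_measure \<nu>2) (g k2))"
      using p1 p2 integral_Pi_measure_minus[OF \<nu>(1) gm(1)] integral_Pi_measure_minus[OF \<nu>(2) gm(1)] by simp
    also have "\<dots> \<le> D * ((C1 * (max 1 k1) powr - (\<nu>1 + 1/2)) * (C2 * (max 1 k2) powr - (\<nu>2 + 1/2)))"
      using C1 C2 k D unfolding g_def
      by (intro mult_left_mono mult_mono) (auto intro!: integral_nonneg_AE)
    finally show "(\<integral>z. even_heat l t (fst z * A + snd z * B) \<partial>M) \<le>
      C * (C1 * C2) * t powr - (l + 1) * exp (- (arccos (A + B))\<^sup>2 / (4 * t)) *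
      ((max 1 (A / (16 * t))) powr - (\<nu>1 + 1/2) * (max 1 (B / (16 * t))) powr - (\<nu>2 + 1/2))"
      by (simp add: D_def k1_def k2_def mult_ac)
  qed (use C C1 C2 in simp)
qed

text \<open>The same factorization on the quadrant of nonnegative variables, where w \<ge> 0.
  Elsewhere, and for the reflected half, nonnegativity of the kernel suffices; dropping that half
  costs the factor 1/2.\<close>

lemma integral_even_heat_lower:
  obtains c where "c > 0" "\<And>t A B. 0 < t \<Longrightarrow> t \<le> 1 \<Longrightarrow> A \<ge> 0 \<Longrightarrow> B \<ge> 0 \<Longrightarrow> A + B \<le> 1 \<Longrightarrow>
    (\<integral>z. even_heat l t (fst z * A + snd z * B) \<partial>M) \<ge>
      c * t powr - (l + 1) * exp (- (arccos (A + B))\<^sup>2 / (4 * t)) *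
      ((max 1 (A / t)) powr - (\<nu>1 + 1/2) * (max 1 (B / t)) powr - (\<nu>2 + 1/2))"
proof -
  obtain c where c: "c > 0" "\<And>t w \<xi>. 0 < t \<Longrightarrow> t \<le> 1 \<Longrightarrow> 0 \<le> w \<Longrightarrow> w \<le> \<xi> \<Longrightarrow> \<xi> \<le> 1 \<Longrightarrow>
    gegen_heat l t w \<ge> c * t powr - (l + 1) * exp (- (arccos \<xi>)\<^sup>2 / (4 * t)) * exp (- ((\<xi> - w) / t))"
    using gegen_heat_lower[OF l] by blast
  obtain c1 where c1: "c1 > 0" "\<And>\<kappa>. \<kappa> \<ge> 0 \<Longrightarrow>
    c1 * (max 1 \<kappa>) powr - (\<nu>1 + 1/2) \<le> (\<integral>v. indicator {0..} v * exp (- (\<kappa> * (1 - v))) \<partial>Pi_measure \<nu>1)"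
    using integral_exp_Pi_measure_lower[OF \<nu>(1)] by blast
  obtain c2 where c2: "c2 > 0" "\<And>\<kappa>. \<kappa> \<ge> 0 \<Longrightarrow>
    c2 * (max 1 \<kappa>) powr - (\<nu>2 + 1/2) \<le> (\<integral>v. indicator {0..} v * exp (- (\<kappa> * (1 - v))) \<partial>Pi_measure \<nu>2)"
    using integral_exp_Pi_measure_lower[OF \<nu>(2)] by blast
  show thesis
  proof (rule that[of "c / 2 * (c1 * c2)"])
    fix t A B :: real
    assume t: "0 < t" "t \<le> 1" and AB: "A \<ge> 0" "B \<ge> 0" "A + B \<le> 1"
    define k1 k2 where "k1 = A / t" and "k2 = B / t"
    have k: "k1 \<ge> 0" "k2 \<ge> 0" using t AB by (auto simp: k1_def k2_def)
    define D where "D = c / 2 * t powr - (l + 1) * exp (- (arccos (A + B))\<^sup>2 / (4 * t))"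
    have D: "D \<ge> 0" using c by (simp add: D_def)
    define g where "g \<kappa> v = indicator {0..} v * exp (- (\<kappa> * (1 - v)))" for \<kappa> v :: real
    have gm [measurable]: "g \<kappa> \<in> borel_measurable borel" for \<kappa>
      unfolding g_def by measurable
    have g1: "\<bar>g \<kappa> v\<bar> \<le> 1" if "\<bar>v\<bar> \<le> 1" "\<kappa> \<ge> 0" for \<kappa> v using that by (simp add: g_def indicator_def)
    have lb: "AE z in M. D * (g k1 (fst z) * g k2 (snd z)) \<le> even_heat l t (fst z * A + snd z * B)"
      using AE_M
    proof eventually_elim
      case (elim z)
      let ?w = "fst z * A + snd z * B"
      have w: "\<bar>?w\<bar> \<le> A + B" "\<bar>?w\<bar> \<le> 1" using convex_comb_bounds[OF AB] elim by auto
      have nn: "gegen_heat l t ?w \<ge> 0" "gegen_heat l t (- ?w) \<ge> 0"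
        using w by (auto intro!: gegen_heat_nonneg[OF l t(1)])
      have e: "even_heat l t ?w = (gegen_heat l t ?w + gegen_heat l t (- ?w)) / 2"
        using w by (intro even_heat_eq[OF l t(1)])
      show ?case
      proof (cases "0 \<le> fst z \<and> 0 \<le> snd z")
        case True
        have "g k1 (fst z) * g k2 (snd z) = exp (- ((A + B - ?w) / t))"
          unfolding g_def k1_def k2_def using t True by (simp add: field_simps flip: exp_add)
        then have "2 * (D * (g k1 (fst z) * g k2 (snd z))) =
            c * t powr - (l + 1) * exp (- (arccos (A + B))\<^sup>2 / (4 * t)) * exp (- ((A + B - ?w) / t))"
          by (simp add: D_def)
        also have "\<dots> \<le> gegen_heat l t ?w"
          using True AB w t by (intro c) (auto simp: abs_le_iff)
        finally show ?thesis using nn unfolding e by simp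
      next
        case False
        then have zero: "g k1 (fst z) * g k2 (snd z) = 0" by (auto simp: g_def)
        show ?thesis using nn unfolding e zero by simp
      qed
    qed
    have p1: "integrable M (\<lambda>z. g k1 (fst z) * g k2 (snd z))"
      "(\<integral>z. g k1 (fst z) * g k2 (snd z) \<partial>M) = integral\<^sup>L (Pi_measure \<nu>1) (g k1) * integral\<^sup>L (Pi_measure \<nu>2) (g k2)"
      by (intro integral_M_product[of "g k1" "g k2"] gm g1 k; assumption)+
    have "D * ((c1 * (max 1 k1) powr - (\<nu>1 + 1/2)) * (c2 * (max 1 k2) powr - (\<nu>2 + 1/2)))
      \<le> D * (integral\<^sup>L (Pi_measure \<nu>1) (g k1) * integral\<^sup>L (Pi_measure \<nu>2) (g k2))"
      using c1 c2 k D unfolding g_def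
      by (intro mult_left_mono mult_mono) (auto intro!: integral_nonneg_AE)
    also have "\<dots> = (\<integral>z. D * (g k1 (fst z) * g k2 (snd z)) \<partial>M)"
      using p1 by simp
    also have "\<dots> \<le> (\<integral>z. even_heat l t (fst z * A + snd z * B) \<partial>M)"
      using p1 by (intro integral_mono_AE[OF _ even_heat_exchange(1)[OF t(1) AB] lb]) auto
    finally show "(\<integral>z. even_heat l t (fst z * A + snd z * B) \<partial>M) \<ge>
      c / 2 * (c1 * c2) * t powr - (l + 1) * exp (- (arccos (A + B))\<^sup>2 / (4 * t)) *
      ((max 1 (A / t)) powr - (\<nu>1 + 1/2) * (max 1 (B / t)) powr - (\<nu>2 + 1/2))"
      by (simp add: D_def k1_def k2_def mult_ac)
  qed (use c c1 c2 in simp)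
qed

lemma integral_even_heat_large_time:
  obtains C where "C \<ge> 1" "\<And>t A B. 1 \<le> t \<Longrightarrow> A \<ge> 0 \<Longrightarrow> B \<ge> 0 \<Longrightarrow> A + B \<le> 1 \<Longrightarrow>
    1 / C \<le> (\<integral>z. even_heat l t (fst z * A + snd z * B) \<partial>M) \<and>
    (\<integral>z. even_heat l t (fst z * A + snd z * B) \<partial>M) \<le> C"
proof -
  obtain C where C: "C \<ge> 1" "\<And>t w. 1 \<le> t \<Longrightarrow> \<bar>w\<bar> \<le> 1 \<Longrightarrow> 1 / C \<le> gegen_heat l t w \<and> gegen_heat l t w \<le> C"
    using gegen_heat_large_time[OF l] by blast
  show thesis
  proof (rule that[OF C(1)])
    fix t A B :: real
    assume t: "1 \<le> t" and AB: "A \<ge> 0" "B \<ge> 0" "A + B \<le> 1"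
    have t0: "t > 0" using t by simp
    have ae: "AE z in M. 1 / C \<le> even_heat l t (fst z * A + snd z * B) \<and> even_heat l t (fst z * A + snd z * B) \<le> C"
      using AE_M
    proof eventually_elim
      case (elim z)
      let ?w = "fst z * A + snd z * B"
      have w: "\<bar>?w\<bar> \<le> 1" using convex_comb_bounds[OF AB] elim by auto
      then have "\<bar>- ?w\<bar> \<le> 1" by simp
      from C(2)[OF t w] C(2)[OF t this] show ?case
        unfolding even_heat_eq[OF l t0 w] by simp
    qed
    note i = even_heat_exchange(1)[OF t0 AB]
    have "(\<integral>z. 1 / C \<partial>M) \<le> (\<integral>z. even_heat l t (fst z * A + snd z * B) \<partial>M)"
      using ae by (intro integral_mono_AE i) auto
    moreover have "(\<integral>z. even_heat l t (fst z * A + snd z * B) \<partial>M) \<le> (\<integral>z. C \<partial>M)"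
      using ae by (intro integral_mono_AE i) auto
    ultimately show "1 / C \<le> (\<integral>z. even_heat l t (fst z * A + snd z * B) \<partial>M) \<and>
        (\<integral>z. even_heat l t (fst z * A + snd z * B) \<partial>M) \<le> C"
      using measure_M space_M by simp
  qed
qed

end

subsection \<open>The cone\<close>

text \<open>At t = \<tau> / 4 the quotient A / (16 t) is A / (4 \<tau>). The 8 is this 4 times the 2
  from S \<le> 2 A.\<close>

lemma max_powr_upper:
  fixes A S \<tau> e :: real
  assumes "\<tau> > 0" "A \<ge> 0" "S \<le> 2 * A" "e \<ge> 0"
  shows "(max 1 (A / (4 * \<tau>))) powr - e \<le> 8 powr e * (\<tau> powr e * (max S \<tau>) powr - e)"
proof -
  have "max S \<tau> / (8 * \<tau>) \<le> max 1 (A / (4 * \<tau>))"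
    using assms by (cases "S \<le> \<tau>") (auto simp: max_def field_simps)
  then have "(max 1 (A / (4 * \<tau>))) powr - e \<le> (max S \<tau> / (8 * \<tau>)) powr - e"
    using assms by (intro powr_mono2') (auto simp: max_def)
  also have "\<dots> = 8 powr e * (\<tau> powr e * (max S \<tau>) powr - e)"
    using assms by (simp add: powr_divide powr_mult powr_minus field_simps max_def)
  finally show ?thesis .
qed

lemma max_powr_lower:
  fixes A S \<tau> e :: real
  assumes "\<tau> > 0" "A \<le> S" "e \<ge> 0"
  shows "4 powr - e * (\<tau> powr e * (max S \<tau>) powr - e) \<le> (max 1 (4 * A / \<tau>)) powr - e"
proof -
  have "4 * A / \<tau> \<le> 4 * max S \<tau> / \<tau>" "1 \<le> 4 * max S \<tau> / \<tau>"
    using assms by (auto simp: max_def field_simps)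
  then have "(4 * max S \<tau> / \<tau>) powr - e \<le> (max 1 (4 * A / \<tau>)) powr - e"
    using assms by (intro powr_mono2') auto
  moreover have "(4 * max S \<tau> / \<tau>) powr - e = 4 powr - e * (\<tau> powr e * (max S \<tau>) powr - e)"
    using assms by (simp add: powr_divide powr_mult powr_minus field_simps max_def)
  ultimately show ?thesis by simp
qed

lemma cone_surface_bounds:
  assumes "(x, t) \<in> cone_surface" "(y, s) \<in> cone_surface"
  shows "s * t + x \<bullet> y \<ge> 0" "sqrt (1/2 * (s * t + x \<bullet> y)) + sqrt (1 - t) * sqrt (1 - s) \<le> 1"
proof -
  have xt: "norm x = t" "0 \<le> t" "t \<le> 1" and ys: "norm y = s" "0 \<le> s" "s \<le> 1"
    using assms by (auto simp: cone_surface_def)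
  have cs: "\<bar>x \<bullet> y\<bar> \<le> s * t"
    using Cauchy_Schwarz_ineq2[of x y] xt ys by (simp add: mult.commute)
  then show "s * t + x \<bullet> y \<ge> 0" by linarith
  have "sqrt (1/2 * (s * t + x \<bullet> y)) \<le> sqrt (s * t)"
  proof (intro real_sqrt_le_mono)
    have "1/2 * (s * t + x \<bullet> y) \<le> 1/2 * (s * t + s * t)"
      using cs by (intro mult_left_mono) auto
    then show "1/2 * (s * t + x \<bullet> y) \<le> s * t" by simp
  qed
  also have "\<dots> = sqrt t * sqrt s" by (simp add: real_sqrt_mult mult.commute)
  finally have "sqrt (1/2 * (s * t + x \<bullet> y)) \<le> sqrt t * sqrt s" .
  moreover have "2 * (a * b) \<le> a\<^sup>2 + b\<^sup>2" for a b :: real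
    using zero_le_power2[of "a - b"] by (simp add: power2_eq_square algebra_simps)
  from this[of "sqrt t" "sqrt s"] this[of "sqrt (1 - t)" "sqrt (1 - s)"]
  have "sqrt t * sqrt s + sqrt (1 - t) * sqrt (1 - s) \<le> 1"
    using xt ys by simp
  ultimately show "sqrt (1/2 * (s * t + x \<bullet> y)) + sqrt (1 - t) * sqrt (1 - s) \<le> 1" by linarith
qed

text \<open>Since \<open>4 n (n + \<gamma> + d - 1)\<close> is the Gegenbauer eigenvalue of degree \<open>2 n\<close>, the cone kernel is an
  average of the even part of the Gegenbauer heat kernel at time \<open>\<tau> / 4\<close>.\<close>

lemma cone_heat_eq:
  fixes x y :: "real ^ 'd" and \<gamma> :: real
  assumes d: "CARD('d) \<ge> 2" and \<gamma>: "\<gamma> \<ge> -1/2" and \<tau>: "\<tau> > 0"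
    and p: "(x, t) \<in> cone_surface" "(y, s) \<in> cone_surface"
  shows "cone_heat \<gamma> \<tau> (x, t) (y, s) =
    (\<integral>z. even_heat (\<gamma> + real CARD('d) - 3/2) (\<tau> / 4)
       (fst z * sqrt (1/2 * (s * t + x \<bullet> y)) + snd z * (sqrt (1 - t) * sqrt (1 - s)))
     \<partial>(Pi_measure ((real CARD('d) - 3) / 2) \<Otimes>\<^sub>M Pi_measure \<gamma>))"
proof -
  define l where "l = \<gamma> + real CARD('d) - 3/2"
  have d2: "real CARD('d) \<ge> 2" using d by linarith
  have l: "l \<ge> 0" using d2 \<gamma> by (simp add: l_def)
  have lam: "\<gamma> + real CARD('d) - 1 = l + 1/2" by (simp add: l_def)
  let ?A = "sqrt (1/2 * (s * t + x \<bullet> y))" and ?B = "sqrt (1 - t) * sqrt (1 - s)"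
  let ?M = "Pi_measure ((real CARD('d) - 3) / 2) \<Otimes>\<^sub>M Pi_measure \<gamma>"
  have nn: "?A \<ge> 0" "?B \<ge> 0"
    using p by (auto simp: cone_surface_def intro: cone_surface_bounds(1))
  have "exp (- \<tau> * real n * (real n + \<gamma> + real CARD('d) - 1)) * cone_P n \<gamma> (x, t) (y, s) =
      (\<integral>z. exp (- (\<tau> / 4) * gegen_ev l (2 * n)) * (gegen_zeta l (2 * n) *
        poly (gegen_poly l (2 * n)) (fst z * ?A + snd z * ?B)) \<partial>?M)" for n
  proof -
    have "- \<tau> * real n * (real n + \<gamma> + real CARD('d) - 1) = - (\<tau> / 4) * gegen_ev l (2 * n)"
      by (simp add: gegen_ev_def l_def algebra_simps)
    moreover have "cone_P n \<gamma> (x, t) (y, s) =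
        (\<integral>z. gegen_zeta l (2 * n) * poly (gegen_poly l (2 * n)) (fst z * ?A + snd z * ?B) \<partial>?M)"
      unfolding cone_P_def lam zonal_Z_eq[OF l] by (simp add: case_prod_unfold mult.assoc)
    ultimately show ?thesis by (simp only: integral_mult_right_zero)
  qed
  then show ?thesis
    unfolding cone_heat_def l_def[symmetric]
    using even_heat_exchange(2)[of "(real CARD('d) - 3) / 2" \<gamma> l "\<tau> / 4" ?A ?B]
      cone_surface_bounds(2)[OF p] nn d2 \<gamma> l \<tau> by simp
qed

theorem theorem1p7:
  fixes \<gamma> :: real
  assumes "CARD('d::finite) \<ge> 2" and "\<gamma> \<ge> -1/2"
  shows "\<exists>C\<ge>1. \<forall>(x :: real ^ 'd) t y s.
    (x, t) \<in> cone_surface \<longrightarrow> (y, s) \<in> cone_surface \<longrightarrow>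
      (\<forall>\<tau>. 0 < \<tau> \<and> \<tau> \<le> 4 \<longrightarrow>
         1 / C * cone_K \<gamma> \<tau> (x, t) (y, s) \<le> cone_heat \<gamma> \<tau> (x, t) (y, s) \<and>
         cone_heat \<gamma> \<tau> (x, t) (y, s) \<le> C * cone_K \<gamma> \<tau> (x, t) (y, s)) \<and>
      (\<forall>\<tau>\<ge>4. 1 / C \<le> cone_heat \<gamma> \<tau> (x, t) (y, s) \<and>
         cone_heat \<gamma> \<tau> (x, t) (y, s) \<le> C)"
proof -
  define d where "d = real CARD('d)"
  define l where "l = \<gamma> + d - 3/2"
  define \<nu> where "\<nu> = (d - 3) / 2"
  define M where "M = Pi_measure \<nu> \<Otimes>\<^sub>M Pi_measure \<gamma>"
  have d: "d \<ge> 2" using assms(1) unfolding d_def by linarith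
  have \<nu>: "\<nu> \<ge> -1/2" and l: "l \<ge> 0" using d assms(2) by (auto simp: \<nu>_def l_def)
  obtain c where c: "c > 0" "\<And>t A B. 0 < t \<Longrightarrow> t \<le> 1 \<Longrightarrow> A \<ge> 0 \<Longrightarrow> B \<ge> 0 \<Longrightarrow> A + B \<le> 1 \<Longrightarrow>
    (\<integral>z. even_heat l t (fst z * A + snd z * B) \<partial>M) \<ge>
      c * t powr - (l + 1) * exp (- (arccos (A + B))\<^sup>2 / (4 * t)) *
      ((max 1 (A / t)) powr - (\<nu> + 1/2) * (max 1 (B / t)) powr - (\<gamma> + 1/2))"
    using integral_even_heat_lower[OF \<nu> assms(2) l] unfolding M_def by blast
  obtain C where C: "C > 0" "\<And>t A B. 0 < t \<Longrightarrow> t \<le> 1 \<Longrightarrow> A \<ge> 0 \<Longrightarrow> B \<ge> 0 \<Longrightarrow> A + B \<le> 1 \<Longrightarrow>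
    (\<integral>z. even_heat l t (fst z * A + snd z * B) \<partial>M) \<le>
      C * t powr - (l + 1) * exp (- (arccos (A + B))\<^sup>2 / (4 * t)) *
      ((max 1 (A / (16 * t))) powr - (\<nu> + 1/2) * (max 1 (B / (16 * t))) powr - (\<gamma> + 1/2))"
    using integral_even_heat_upper[OF \<nu> assms(2) l] unfolding M_def by blast
  obtain L where L: "L \<ge> 1" "\<And>t A B. 1 \<le> t \<Longrightarrow> A \<ge> 0 \<Longrightarrow> B \<ge> 0 \<Longrightarrow> A + B \<le> 1 \<Longrightarrow>
    1 / L \<le> (\<integral>z. even_heat l t (fst z * A + snd z * B) \<partial>M) \<and>
    (\<integral>z. even_heat l t (fst z * A + snd z * B) \<partial>M) \<le> L"
    using integral_even_heat_large_time[OF \<nu> assms(2) l] unfolding M_def by blast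
  define e1 where "e1 = \<nu> + 1/2"
  define e2 where "e2 = \<gamma> + 1/2"
  have e: "e1 \<ge> 0" "e2 \<ge> 0" using \<nu> assms(2) by (auto simp: e1_def e2_def)
  \<comment> \<open>The power 4^(l + 1) comes from the time \<tau> / 4, the others from
    \<open>max_powr_lower\<close> and, for \<open>C'\<close>, from
    \<open>max_powr_upper\<close>.\<close>
  define c' where "c' = c * 4 powr (l + 1) * (4 powr - e1 * 4 powr - e2)"
  define C' where "C' = C * 4 powr (l + 1) * (8 powr e1 * 8 powr e2)"
  have c': "c' > 0" using c by (simp add: c'_def)
  define X where "X = max L (max C' (1 / c'))"
  have X: "X \<ge> 1" "C' \<le> X" "L \<le> X" "1 / c' \<le> X" using L by (auto simp: X_def)
  then have X': "1 / X \<le> c'" "1 / X \<le> 1 / L"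
    using c' L by (auto simp: field_simps)
  show ?thesis
  proof (intro exI[of _ X] conjI allI impI X(1))
    fix x y :: "real ^ 'd" and t s \<tau> :: real
    assume p: "(x, t) \<in> cone_surface" "(y, s) \<in> cone_surface"
    define A where "A = sqrt (1/2 * (s * t + x \<bullet> y))"
    define B where "B = sqrt (1 - t) * sqrt (1 - s)"
    define S where "S = sqrt (s * t + x \<bullet> y)"
    have AB: "A \<ge> 0" "B \<ge> 0" "A + B \<le> 1"
      using p cone_surface_bounds[OF p] by (auto simp: A_def B_def cone_surface_def)
    \<comment> \<open>The kernel argument contains the factor 1/2 under the root, the profile
      \<open>cone_K\<close> does not; crude bounds 1/2 and 1 for the ratio suffice.\<close>
    have "A = sqrt (1/2) * S" unfolding A_def S_def by (rule real_sqrt_mult)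
    moreover have "1/2 \<le> sqrt (1/2)"
      by (rule real_le_rsqrt) (simp add: power2_eq_square)
    moreover have "sqrt (1/2) \<le> 1" by simp
    moreover have "S \<ge> 0" using cone_surface_bounds(1)[OF p] by (simp add: S_def)
    ultimately have AS: "A \<le> S" "S \<le> 2 * A"
      using mult_right_mono[of "1/2" "sqrt (1/2)" S] by (auto simp: mult_left_le_one_le)
    have heat: "cone_heat \<gamma> \<tau> (x, t) (y, s) = (\<integral>z. even_heat l (\<tau> / 4) (fst z * A + snd z * B) \<partial>M)" if "\<tau> > 0"
      using cone_heat_eq[OF assms that p] by (simp add: l_def d_def M_def \<nu>_def A_def B_def)
    {
      assume "4 \<le> \<tau>"
      then have "1 / L \<le> cone_heat \<gamma> \<tau> (x, t) (y, s)" "cone_heat \<gamma> \<tau> (x, t) (y, s) \<le> L"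
        using L(2)[of "\<tau> / 4" A B] AB heat by auto
      then show "1 / X \<le> cone_heat \<gamma> \<tau> (x, t) (y, s)" "cone_heat \<gamma> \<tau> (x, t) (y, s) \<le> X"
        using X X' by linarith+
    }
    {
      assume \<tau>: "0 < \<tau> \<and> \<tau> \<le> 4"
      define E where "E = exp (- (1 / \<tau>) * (arccos (A + B))\<^sup>2)"
      have E: "exp (- (arccos (A + B))\<^sup>2 / (4 * (\<tau> / 4))) = E" by (simp add: E_def)
      have tp: "(\<tau> / 4) powr - (l + 1) = 4 powr (l + 1) * \<tau> powr - (l + 1)"
        unfolding powr_divide powr_minus[of 4 "l + 1"] by (simp add: divide_inverse)
      \<comment> \<open>Here e1 = d/2 - 1 and e2 = \<gamma> + 1/2. Each average gives back its power
        of \<tau>, which reduces the Gegenbauer exponent l + 1 = \<gamma> + d - 1/2 to the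
        dimensional d/2.\<close>
      have "- (d / 2) = - (l + 1) + e1 + e2" by (simp add: l_def e1_def e2_def \<nu>_def field_simps)
      then have pw: "\<tau> powr (- (d / 2)) = \<tau> powr - (l + 1) * \<tau> powr e1 * \<tau> powr e2"
        by (simp only: powr_add)
      have "- \<gamma> - 1/2 = - e2" "- (d / 2) + 1 = - e1" by (simp_all add: e1_def e2_def \<nu>_def field_simps)
      then have K: "cone_K \<gamma> \<tau> (x, t) (y, s) =
          \<tau> powr - (l + 1) * E * ((\<tau> powr e1 * (max S \<tau>) powr - e1) * (\<tau> powr e2 * (max B \<tau>) powr - e2))"
        unfolding cone_K.simps cone_dist.simps d_def[symmetric] pw E_def A_def[symmetric] B_def[symmetric] S_def[symmetric]
        by simp
      have Knn: "cone_K \<gamma> \<tau> (x, t) (y, s) \<ge> 0" unfolding K E_def by simp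
      have "cone_heat \<gamma> \<tau> (x, t) (y, s) \<le> C * (4 powr (l + 1) * \<tau> powr - (l + 1)) * E *
          ((max 1 (A / (4 * \<tau>))) powr - e1 * (max 1 (B / (4 * \<tau>))) powr - e2)"
        using C(2)[of "\<tau> / 4" A B] \<tau> AB heat unfolding E tp e1_def[symmetric] e2_def[symmetric] by simp
      also have "\<dots> \<le> C * (4 powr (l + 1) * \<tau> powr - (l + 1)) * E *
          ((8 powr e1 * (\<tau> powr e1 * (max S \<tau>) powr - e1)) * (8 powr e2 * (\<tau> powr e2 * (max B \<tau>) powr - e2)))"
        using C \<tau> AB AS e by (intro mult_left_mono mult_mono max_powr_upper) (auto simp: E_def)
      also have "\<dots> = C' * cone_K \<gamma> \<tau> (x, t) (y, s)"
        unfolding K C'_def by (simp only: mult_ac)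
      also have "\<dots> \<le> X * cone_K \<gamma> \<tau> (x, t) (y, s)"
        using X Knn by (intro mult_right_mono) auto
      finally show "cone_heat \<gamma> \<tau> (x, t) (y, s) \<le> X * cone_K \<gamma> \<tau> (x, t) (y, s)" .
      have "1 / X * cone_K \<gamma> \<tau> (x, t) (y, s) \<le> c' * cone_K \<gamma> \<tau> (x, t) (y, s)"
        using X' Knn by (intro mult_right_mono) auto
      also have "\<dots> = c * (4 powr (l + 1) * \<tau> powr - (l + 1)) * E *
          ((4 powr - e1 * (\<tau> powr e1 * (max S \<tau>) powr - e1)) * (4 powr - e2 * (\<tau> powr e2 * (max B \<tau>) powr - e2)))"
        unfolding K c'_def by (simp only: mult_ac)
      also have "\<dots> \<le> c * (4 powr (l + 1) * \<tau> powr - (l + 1)) * E *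
          ((max 1 (4 * A / \<tau>)) powr - e1 * (max 1 (4 * B / \<tau>)) powr - e2)"
        using c \<tau> AB AS e by (intro mult_left_mono mult_mono max_powr_lower) (auto simp: E_def)
      also have "\<dots> \<le> cone_heat \<gamma> \<tau> (x, t) (y, s)"
        using c(2)[of "\<tau> / 4" A B] \<tau> AB heat unfolding E tp e1_def[symmetric] e2_def[symmetric] 
        by (simp add: mult.commute)
      finally show "1 / X * cone_K \<gamma> \<tau> (x, t) (y, s) \<le> cone_heat \<gamma> \<tau> (x, t) (y, s)" .
    }
  qed
qed

end
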